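(* Let $n\ge2$ and let $\mathbf a=(a_0,\dots,a_n)\in\mathbb Z^{n+1}$ have pairwise distinct entries. Then $$\Theta_{\mathbf a}:=\eta^{-n(n-1)/2}\prod_{0\le i<j\le n}\vartheta_{a_i-a_j}$$ is a theta block of length $n(n+1)/2$ and weight $n/2$; more precisely $\Theta_{\mathbf a}\in J_{\frac n2,Q(\mathbf a)}\bigl(\varepsilon^{n(n+2)}\bigr)$, where $Q(\mathbf a)=\frac12\sum_{0\le i<j\le n}(a_i-a_j)^2$. In particular, if $n+1$ is relatively prime to $6$, then $\Theta_{\mathbf a}\in J_{\frac n2,Q(\mathbf a)}$ (trivial character).
   Context: $\eta(\tau)=q^{1/24}\prod_{n\ge1}(1-q^n)$, $\vartheta(\tau,z)=\sum_{r\in\mathbb Z}\left(\frac{-4}{r}\right)q^{r^2/8}\zeta^{r/2}$, $q=e^{2\pi i\tau}$, $\zeta=e^{2\pi iz}$, $\vartheta_a(\tau,z)=\vartheta(\tau,az)$; $\varepsilon^h$ is the multiplier system of $\eta^h$ (depending only on $h$ mod 24). For rational $k,h$ and $m\in\frac12\mathbb Z_{\ge0}$, $J_{k,m}(\varepsilon^h)$ is the space of holomorphic Jacobi forms of weight $k$, index $m$, character $\varepsilon^h$: for $m\in\mathbb Z$, functions $\phi$ such that $\eta^{-h}\phi$ is a weakly holomorphic Eichler–Zagier Jacobi form of weight $k-h/2$ and index $m$, and for $m\in\frac12+\mathbb Z$, such that $\eta^{-h-3}\vartheta\phi$ is one of weight $k-1-h/2$ and index $m+\frac12$, and whose Fourier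 coefficients $c(n,r)$ ($\phi=\sum c(n,r)q^n\zeta^r$) vanish unless $4nm-r^2\ge0$. $J_{k,m}$ denotes $J_{k,m}(\varepsilon^0)$. A theta block of length $N$ is a product of $N$ functions $\vartheta_{a}$ ($a\ne0$) times an integral power of $\eta$. *)

theory Defs
  imports "HOL-Analysis.Analysis"
begin

text \<open>
  Functions on the product of the upper half-plane with the complex plane are total functions
  of type \<^typ>\<open>complex \<Rightarrow> complex \<Rightarrow> complex\<close>; only their values at points with
  \<^prop>\<open>Im \<tau> > 0\<close> matter.
\<close>

definition ee :: "complex \<Rightarrow> complex" where
  "ee x = exp (2 * of_real pi * \<i> * x)"

definition eta :: "complex \<Rightarrow> complex" where
  "eta \<tau> = ee (\<tau> / 24) * (\<Prod>n. 1 - ee \<tau> ^ Suc n)"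

text \<open>
  The power of \<^const>\<open>eta\<close> with rational exponent, in the branch given by
  \<open>q\<close> to the power \<open>h/24\<close> being \<^term>\<open>ee (of_rat h * \<tau> / 24)\<close>. Each factor of the product has
  positive real part, so the principal branch of \<open>powr\<close> is holomorphic there.
\<close>

definition eta_rpow :: "rat \<Rightarrow> complex \<Rightarrow> complex" where
  "eta_rpow h \<tau> = ee (of_rat h * \<tau> / 24) * (\<Prod>n. (1 - ee \<tau> ^ Suc n) powr of_rat h)"

text \<open>The Kronecker symbol \<open>(-4/r)\<close>.\<close>

definition kronecker_m4 :: "int \<Rightarrow> int" where
  "kronecker_m4 r = (if r mod 4 = 1 then 1 else if r mod 4 = 3 then - 1 else 0)"

definition theta :: "complex \<Rightarrow> complex \<Rightarrow> complex" where
  "theta \<tau> z = (\<Sum>\<^sub>\<infinity>r::int. of_int (kronecker_m4 r) * ee (of_int (r ^ 2) * \<tau> / 8 + of_int r * z / 2))"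

definition theta_mult :: "int \<Rightarrow> complex \<Rightarrow> complex \<Rightarrow> complex" where
  "theta_mult a \<tau> z = theta \<tau> (of_int a * z)"

text \<open>
  Holomorphy in both variables jointly: the total derivative exists and is complex linear.
\<close>

definition holomorphic_HC :: "(complex \<Rightarrow> complex \<Rightarrow> complex) \<Rightarrow> bool" where
  "holomorphic_HC \<phi> \<longleftrightarrow>
    (\<forall>\<tau> z. Im \<tau> > 0 \<longrightarrow>
      (\<exists>A B. ((\<lambda>(t, w). \<phi> t w) has_derivative (\<lambda>(u, v). A * u + B * v)) (at (\<tau>, z))))"

text \<open>
  \<open>\<phi>\<close> is the sum of \<open>c(n,r) q^n \<zeta>^r\<close> over all \<open>n\<close> in \<open>\<alpha> + \<int>\<close> and \<open>r\<close> in \<open>\<beta> + \<int>\<close>.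
\<close>

definition has_fourier_expansion ::
    "rat \<Rightarrow> rat \<Rightarrow> (rat \<Rightarrow> rat \<Rightarrow> complex) \<Rightarrow> (complex \<Rightarrow> complex \<Rightarrow> complex) \<Rightarrow> bool" where
  "has_fourier_expansion \<alpha> \<beta> c \<phi> \<longleftrightarrow>
    (\<forall>\<tau> z. Im \<tau> > 0 \<longrightarrow>
      ((\<lambda>(n, r). c n r * ee (of_rat n * \<tau> + of_rat r * z)) has_sum \<phi> \<tau> z)
        ({n. n - \<alpha> \<in> \<int>} \<times> {r. r - \<beta> \<in> \<int>}))"

text \<open>
  Weakly holomorphic Jacobi forms of weight \<open>w\<close> and index \<open>m\<close> for the full Jacobi group, in the
  sense of Eichler and Zagier: the cusp condition only asks that the exponents of \<open>q\<close> be bounded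
  below.
\<close>

definition weakly_holomorphic_jacobi_form ::
    "int \<Rightarrow> nat \<Rightarrow> (complex \<Rightarrow> complex \<Rightarrow> complex) \<Rightarrow> bool" where
  "weakly_holomorphic_jacobi_form w m \<psi> \<longleftrightarrow>
    holomorphic_HC \<psi> \<and>
    (\<forall>a b c d :: int. \<forall>\<tau> z. a * d - b * c = 1 \<longrightarrow> Im \<tau> > 0 \<longrightarrow>
      \<psi> ((of_int a * \<tau> + of_int b) / (of_int c * \<tau> + of_int d)) (z / (of_int c * \<tau> + of_int d)) =
        (of_int c * \<tau> + of_int d) powi w *
        ee (of_nat m * of_int c * z ^ 2 / (of_int c * \<tau> + of_int d)) * \<psi> \<tau> z) \<and>
    (\<forall>l p :: int. \<forall>\<tau> z. Im \<tau> > 0 \<longrightarrow>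
      \<psi> \<tau> (z + of_int l * \<tau> + of_int p) =
        ee (- of_nat m * (of_int (l ^ 2) * \<tau> + 2 * of_int l * z)) * \<psi> \<tau> z) \<and>
    (\<exists>c N. has_fourier_expansion 0 0 c \<psi> \<and> (\<forall>n r. n < N \<longrightarrow> c n r = 0))"

text \<open>
  Holomorphic Jacobi forms of weight \<open>k\<close>, index \<open>m\<close> and character \<open>\<epsilon>^h\<close>, where \<open>\<epsilon>^h\<close> is the
  multiplier system of \<open>\<eta>^h\<close>. The two disjuncts are the cases of integral and of half-integral
  index; multiplication by \<open>\<eta>^(-h)\<close>, respectively \<open>\<eta>^(-h-3) \<vartheta>\<close>, removes the character.
  Holomorphy of \<open>\<phi>\<close> is required explicitly since \<open>\<vartheta>\<close> vanishes at the lattice points. The weight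
  of the weakly holomorphic form is an integer, so there are no forms unless \<^term>\<open>k - h / 2\<close> is
  integral.
\<close>

definition jacobi_forms :: "rat \<Rightarrow> rat \<Rightarrow> rat \<Rightarrow> (complex \<Rightarrow> complex \<Rightarrow> complex) set" where
  "jacobi_forms k m h = {\<phi>.
    holomorphic_HC \<phi> \<and>
    ((\<exists>(M::nat) w. m = of_nat M \<and> k - h / 2 = of_int w \<and>
        weakly_holomorphic_jacobi_form w M (\<lambda>\<tau> z. eta_rpow (- h) \<tau> * \<phi> \<tau> z)) \<or>
     (\<exists>(M::nat) w. m = of_nat M + 1 / 2 \<and> k - 1 - h / 2 = of_int w \<and>
        weakly_holomorphic_jacobi_form w (M + 1)
          (\<lambda>\<tau> z. eta_rpow (- h - 3) \<tau> * theta \<tau> z * \<phi> \<tau> z))) \<and>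
    (\<exists>c. has_fourier_expansion (h / 24) m c \<phi> \<and>
         (\<forall>n r. c n r \<noteq> 0 \<longrightarrow> 4 * n * m - r ^ 2 \<ge> 0))}"

text \<open>
  Theta blocks of length \<open>N\<close> and weight \<open>k\<close>: each \<open>\<vartheta>_a\<close> and each \<open>\<eta>\<close> contributes weight
  \<open>1/2\<close>.
\<close>

definition is_theta_block ::
    "nat \<Rightarrow> rat \<Rightarrow> (complex \<Rightarrow> complex \<Rightarrow> complex) \<Rightarrow> bool" where
  "is_theta_block N k \<phi> \<longleftrightarrow>
    (\<exists>(as::int list) (s::int). length as = N \<and> 0 \<notin> set as \<and> k = (of_nat N + of_int s) / 2 \<and>
      (\<forall>\<tau> z. Im \<tau> > 0 \<longrightarrow> \<phi> \<tau> z = eta \<tau> powi s * (\<Prod>a\<leftarrow>as. theta_mult a \<tau> z)))"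

text \<open>A vector \<open>(a 0, ..., a n)\<close> is the restriction of \<open>a\<close> to \<open>{..n}\<close>.\<close>

definition Theta :: "nat \<Rightarrow> (nat \<Rightarrow> int) \<Rightarrow> complex \<Rightarrow> complex \<Rightarrow> complex" where
  "Theta n a \<tau> z =
    eta \<tau> powi (- int (n * (n - 1) div 2)) * (\<Prod>j\<le>n. \<Prod>i<j. theta_mult (a i - a j) \<tau> z)"

definition Qform :: "nat \<Rightarrow> (nat \<Rightarrow> int) \<Rightarrow> rat" where
  "Qform n a = (1 / 2) * (\<Sum>j\<le>n. \<Sum>i<j. of_int ((a i - a j) ^ 2))"

end

theory Submission
  imports Defs "HOL-Complex_Analysis.Complex_Analysis" "HOL-Library.Nat_Bijection"
begin

text \<open>
  Put \<open>\<phi> = \<vartheta> / \<eta>^3\<close>. By the triple product, \<open>\<phi>(\<tau>, \<cdot>)\<close> has simple zeros exactly at the lattice points and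
  derivative \<open>2\<pi>i\<close> at \<open>0\<close>, so together with its quasi-periods it is determined by Liouville's theorem. Hence
  \<open>\<phi>\<close> has weight \<open>-1\<close> and index \<open>1/2\<close> without any character, and its values at the 2-torsion points
  yield the modularity of \<open>\<eta>^24\<close>. Since \<open>\<eta>^(-n(n+2)) \<Theta>\<close> is a product of functions \<open>\<phi>(\<tau>, (a_i - a_j) z)\<close>,
  it is a weakly holomorphic Jacobi form; when \<open>n + 1\<close> is prime to 6, \<open>24\<close> divides \<open>n(n+2)\<close> and the missing
  factor is a power of \<open>\<eta>^24\<close>.

  For the condition at infinity, a coefficient \<open>c(N,r)\<close> of a product of theta series can be nonzero only
  if \<open>N + r x\<close> is bounded below, for every rational \<open>x\<close>, by the sum of the bounds of the factors. With
  \<open>x = -r/(2m)\<close> the claim becomes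
  \<open>\<Sum>_{i<j} (frac (x_i - x_j) - 1/2)^2 \<ge> n(n-1)/24\<close>, and this minimum is attained at equally spaced points.
\<close>

section \<open>Infinite products\<close>

text \<open>The obstacle is the multiplier system: eta and theta carry roots of unity,
  \<open>jphi\<close> carries none, because its slope 2 pi i at z = 0 is independent of \<tau> and
  fixes the constant in every transformation. The exponent n(n+2) is 3 n(n+1)/2 - n(n-1)/2, so after
  division by eta^(n(n+2)) each theta keeps exactly eta^(-3). Modularity of eta^24 is extracted from
  \<open>jphi\<close>: its product over the three nonzero 2-torsion points is 2 q^(-1/4) / eta^6,
  and inversion permutes these points. The discriminant condition cannot be checked factor by
  factor, since the negative power of eta violates it. For index m > 0 it says that n + r x + m x^2
  >= 0 for all x, and lower bounds for n + r x add up under multiplication; rational x suffice as r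
  and m are rational. For theta_b, completing the square leaves half the squared distance of b x to
  the half-odd integers, minus b^2 x^2/2; the latter terms sum to m x^2. The eta power contributes
  -n(n-1)/48, whence the bound n(n-1)/24 for the sum of squared distances.\<close>

lemma tendsto_prodinf_summable:
  fixes f :: "nat \<Rightarrow> complex"
  assumes "summable (\<lambda>n. norm (f n))"
  shows "convergent_prod (\<lambda>n. 1 + f n)" "(\<lambda>n. \<Prod>k<n. 1 + f k) \<longlonglongrightarrow> (\<Prod>n. 1 + f n)"
proof -
  show c: "convergent_prod (\<lambda>n. 1 + f n)"
    using assms by (intro abs_convergent_prod_imp_convergent_prod summable_imp_abs_convergent_prod) auto
  show "(\<lambda>n. \<Prod>k<n. 1 + f k) \<longlonglongrightarrow> (\<Prod>n. 1 + f n)"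
    using c convergent_prod_has_prod has_prod_imp_tendsto' by blast
qed

text \<open>Holomorphy passes to locally uniform limits of the partial products. The majorant is
  chosen per closed disc because Euler's product has no summable majorant on the whole unit
  disc.\<close>

lemma holomorphic_on_prodinf:
  fixes f :: "nat \<Rightarrow> complex \<Rightarrow> complex"
  assumes "open S" and hol: "\<And>n. f n holomorphic_on S"
    and bnd: "\<And>z. z \<in> S \<Longrightarrow> \<exists>d M. 0 < d \<and> cball z d \<subseteq> S \<and> summable M \<and>
                (\<forall>n. \<forall>w\<in>cball z d. norm (f n w) \<le> M n)"
  shows "(\<lambda>z. \<Prod>n. 1 + f n z) holomorphic_on S"
proof (rule holomorphic_uniform_sequence[OF \<open>open S\<close>])
  show "(\<lambda>z. \<Prod>k<n. 1 + f k z) holomorphic_on S" for n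
    by (intro holomorphic_intros hol)
next
  fix z assume "z \<in> S"
  from bnd[OF this] obtain d M where dM: "0 < d" "cball z d \<subseteq> S" "summable M"
      "\<forall>n. \<forall>w\<in>cball z d. norm (f n w) \<le> M n"
    by (elim exE conjE)
  have "uniformly_convergent_on (cball z d) (\<lambda>N x. \<Prod>n<N. 1 + f n x)"
  proof (rule uniformly_convergent_on_prod)
    show "continuous_on (cball z d) (f n)" for n
      by (rule continuous_on_subset[OF holomorphic_on_imp_continuous_on[OF hol] dM(2)])
    show "uniformly_convergent_on (cball z d) (\<lambda>N x. \<Sum>n<N. norm (f n x))"
      by (rule Weierstrass_m_test'[OF _ dM(3)]) (use dM in auto)
  qed auto
  then obtain l where l: "uniform_limit (cball z d) (\<lambda>N x. \<Prod>n<N. 1 + f n x) l sequentially"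
    by (auto simp: uniformly_convergent_on_def)
  have "l x = (\<Prod>n. 1 + f n x)" if x: "x \<in> cball z d" for x
  proof -
    have "summable (\<lambda>n. norm (f n x))"
      by (rule summable_comparison_test[OF _ dM(3)]) (use dM x in auto)
    from tendsto_prodinf_summable(2)[OF this] tendsto_uniform_limitI[OF l x] show ?thesis
      using LIMSEQ_unique by blast
  qed
  then have "uniform_limit (cball z d) (\<lambda>N x. \<Prod>n<N. 1 + f n x) (\<lambda>x. \<Prod>n. 1 + f n x) sequentially"
    using l by (metis (no_types, lifting) uniform_limit_cong')
  then show "\<exists>d>0. cball z d \<subseteq> S \<and>
      uniform_limit (cball z d) (\<lambda>n z. \<Prod>k<n. 1 + f k z) (\<lambda>z. \<Prod>n. 1 + f n z) sequentially"
    using dM by blast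
qed

text \<open>The q-Pochhammer symbol (x; q) with infinitely many factors. With \<open>x = q\<close>
  it is Euler's product; separating \<open>x\<close> from \<open>q\<close> lets one function express
  eta, theta and the values at half periods.\<close>

definition qpoch :: "complex \<Rightarrow> complex \<Rightarrow> complex" where
  "qpoch x q = (\<Prod>n. 1 - x * q ^ n)"

definition qpoch_fin :: "complex \<Rightarrow> complex \<Rightarrow> nat \<Rightarrow> complex" where
  "qpoch_fin x q N = (\<Prod>k<N. 1 - x * q ^ k)"

lemma summable_qpoch: "norm q < 1 \<Longrightarrow> summable (\<lambda>n. norm (- (x * q ^ n)))" for q :: complex
  by (auto simp: norm_mult norm_power intro!: summable_mult)

lemma convergent_qpoch: "norm q < 1 \<Longrightarrow> convergent_prod (\<lambda>n. 1 - x * q ^ n)" for q :: complex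
  using tendsto_prodinf_summable(1)[OF summable_qpoch] by simp

lemma qpoch_fin_tendsto: "norm q < 1 \<Longrightarrow> qpoch_fin x q \<longlonglongrightarrow> qpoch x q"
  unfolding qpoch_def qpoch_fin_def
  using tendsto_prodinf_summable(2)[OF summable_qpoch] by (simp cong: prod.cong)

lemma qpoch_nonzero:
  assumes "norm q < 1" "\<And>n. x * q ^ n \<noteq> 1"
  shows "qpoch x q \<noteq> 0"
  unfolding qpoch_def by (rule prodinf_nonzero[OF convergent_qpoch]) (use assms in auto)

lemma qpoch_self_nonzero:
  assumes "norm q < 1"
  shows "qpoch q q \<noteq> 0"
proof (rule qpoch_nonzero[OF assms])
  show "q * q ^ n \<noteq> 1" for n
    using assms by (metis norm_one norm_power power_Suc power_less_one_iff less_irrefl norm_ge_zero zero_less_Suc)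
qed

lemma qpoch_split:
  assumes "norm q < 1"
  shows "qpoch x q = (1 - x) * qpoch (x * q) q"
proof (rule LIMSEQ_unique)
  show "(\<lambda>N. qpoch_fin x q (Suc N)) \<longlonglongrightarrow> qpoch x q"
    using qpoch_fin_tendsto[OF assms] by (rule LIMSEQ_Suc)
  have "qpoch_fin x q (Suc N) = (1 - x) * qpoch_fin (x * q) q N" for N
    unfolding qpoch_fin_def by (subst prod.lessThan_Suc_shift) (simp add: mult_ac)
  then show "(\<lambda>N. qpoch_fin x q (Suc N)) \<longlonglongrightarrow> (1 - x) * qpoch (x * q) q"
    using qpoch_fin_tendsto[OF assms, of "x * q"] by (simp add: tendsto_mult_left)
qed

lemma holomorphic_qpoch:
  assumes "norm q < 1"
  shows "(\<lambda>x. qpoch x q) holomorphic_on UNIV"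
proof -
  have "(\<lambda>x. \<Prod>n. 1 + (- (x * q ^ n))) holomorphic_on UNIV"
  proof (rule holomorphic_on_prodinf, goal_cases)
    case (3 z)
    have "norm w \<le> norm z + 1" if "w \<in> cball z 1" for w
      using that norm_triangle_ineq2[of w z] by (auto simp: dist_norm norm_minus_commute)
    then have "norm (- (w * q ^ n)) \<le> (norm z + 1) * norm q ^ n" if "w \<in> cball z 1" for w n
      using that unfolding norm_minus_cancel norm_mult norm_power by (intro mult_right_mono) auto
    moreover have "summable (\<lambda>n. (norm z + 1) * norm q ^ n)"
      using assms by (intro summable_mult summable_geometric) auto
    ultimately show ?case using zero_less_one subset_UNIV by blast
  qed (auto intro!: holomorphic_intros)
  then show ?thesis by (simp add: qpoch_def[abs_def])
qed

lemma holomorphic_euler: "(\<lambda>q. qpoch q q) holomorphic_on ball 0 1"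
proof -
  have "(\<lambda>q. \<Prod>n. 1 + (- (q * q ^ n))) holomorphic_on ball 0 1"
  proof (rule holomorphic_on_prodinf, goal_cases)
    case (3 z)
    \<comment> \<open>Half the distance to the unit circle, so that \<open>norm z + d < 1\<close> is
      the ratio of a geometric majorant on the disc.\<close>
    define d where "d = (1 - norm z) / 2"
    have d: "d > 0" "norm z + d < 1" using 3 by (auto simp: d_def field_simps)
    have *: "norm w \<le> norm z + d" if "w \<in> cball z d" for w
      using that norm_triangle_ineq2[of w z] by (auto simp: dist_norm norm_minus_commute)
    have "norm (- (w * w ^ n)) \<le> (norm z + d) ^ n" if "w \<in> cball z d" for w n
    proof -
      have "norm w ^ n * norm w \<le> (norm z + d) ^ n * 1"
        using *[OF that] d by (intro mult_mono power_mono) auto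
      then show ?thesis by (simp add: norm_mult norm_power mult.commute)
    qed
    moreover have "cball z d \<subseteq> ball 0 1" using * d by fastforce
    moreover have "summable (\<lambda>n. (norm z + d) ^ n)" using d by (intro summable_geometric) auto
    ultimately show ?case using d(1) by blast
  qed (auto intro!: holomorphic_intros)
  then show ?thesis by (simp add: qpoch_def[abs_def])
qed

section \<open>The Jacobi triple product\<close>

text \<open>Gaussian binomial coefficients through the q-Pascal rule, which makes sense for every
  \<open>q\<close>, roots of unity included. For \<open>j > M\<close> the truncated
  \<open>M - j\<close> is harmless since the coefficient it multiplies is 0.\<close>

fun gauss_binom :: "complex \<Rightarrow> nat \<Rightarrow> nat \<Rightarrow> complex" where
  "gauss_binom q 0 0 = 1"
| "gauss_binom q 0 (Suc j) = 0"
| "gauss_binom q (Suc M) 0 = 1"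
| "gauss_binom q (Suc M) (Suc j) = gauss_binom q M (Suc j) + q ^ (M - j) * gauss_binom q M j"

lemma gauss_binom_0 [simp]: "gauss_binom q M 0 = 1"
  by (cases M) auto

lemma gauss_binom_eq_0: "j > M \<Longrightarrow> gauss_binom q M j = 0"
proof (induction M arbitrary: j)
  case (Suc M) then show ?case by (cases j) auto
qed (auto simp: gr0_conv_Suc)

lemma q_binomial_theorem:
  "(\<Prod>k<M. 1 + x * q ^ Suc k) = (\<Sum>j\<le>M. q ^ triangle j * gauss_binom q M j * x ^ j)"
proof (induction M)
  case (Suc M)
  have "(\<Sum>j\<le>Suc M. q ^ triangle j * gauss_binom q (Suc M) j * x ^ j) =
      1 + (\<Sum>j\<le>M. q ^ triangle (Suc j) * gauss_binom q (Suc M) (Suc j) * x ^ Suc j)"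
    by (subst sum.atMost_Suc_shift) simp
  also have "\<dots> = 1 + ((\<Sum>j\<le>M. q ^ triangle (Suc j) * gauss_binom q M (Suc j) * x ^ Suc j) +
      (\<Sum>j\<le>M. x * q ^ Suc M * (q ^ triangle j * gauss_binom q M j * x ^ j)))"
  proof -
    have "q ^ triangle (Suc j) * gauss_binom q (Suc M) (Suc j) * x ^ Suc j =
        q ^ triangle (Suc j) * gauss_binom q M (Suc j) * x ^ Suc j +
        x * q ^ Suc M * (q ^ triangle j * gauss_binom q M j * x ^ j)" if "j \<le> M" for j
    proof -
      have "q ^ triangle (Suc j) * gauss_binom q (Suc M) (Suc j) * x ^ Suc j =
        q ^ triangle (Suc j) * gauss_binom q M (Suc j) * x ^ Suc j +
        (q ^ triangle (Suc j) * q ^ (M - j)) * (gauss_binom q M j * x ^ Suc j)"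
        by (simp only: gauss_binom.simps ring_distribs mult_ac)
      \<comment> \<open>\<open>triangle (Suc j)\<close> exceeds \<open>triangle j\<close> by
        \<open>Suc j\<close>, and \<open>Suc j + (M - j) = Suc M\<close>.\<close>
      also have "q ^ triangle (Suc j) * q ^ (M - j) = q ^ triangle j * q ^ Suc M"
        using that by (simp flip: power_add power_Suc add: add_ac)
      finally show ?thesis by (simp only: power_Suc mult_ac)
    qed
    then show ?thesis by (simp add: sum.distrib)
  qed
  also have "\<dots> = (\<Sum>j\<le>Suc M. q ^ triangle j * gauss_binom q M j * x ^ j) +
      (\<Sum>j\<le>M. x * q ^ Suc M * (q ^ triangle j * gauss_binom q M j * x ^ j))"
    unfolding sum.atMost_Suc_shift[of _ M] by simp
  also have "(\<Sum>j\<le>Suc M. q ^ triangle j * gauss_binom q M j * x ^ j) =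
      (\<Sum>j\<le>M. q ^ triangle j * gauss_binom q M j * x ^ j)"
    by (simp add: gauss_binom_eq_0)
  finally have "(\<Sum>j\<le>Suc M. q ^ triangle j * gauss_binom q (Suc M) j * x ^ j) =
      (\<Sum>j\<le>M. q ^ triangle j * gauss_binom q M j * x ^ j) +
      (\<Sum>j\<le>M. x * q ^ Suc M * (q ^ triangle j * gauss_binom q M j * x ^ j))" .
  then show ?case
    by (simp only: Suc.IH prod.lessThan_Suc sum_distrib_left[symmetric]) (simp add: algebra_simps)
qed simp

lemma qpoch_fin_Suc: "qpoch_fin q q (Suc n) = qpoch_fin q q n * (1 - q ^ Suc n)"
  by (simp add: qpoch_fin_def)

text \<open>The quotient formula, multiplied out so that no factor \<open>1 - q^k\<close> is divided
  by. In the induction the two q-Pascal terms contribute \<open>1 - q^(M-i)\<close> and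
  \<open>q^(M-i) (1 - q^(i+1))\<close>, which sum to \<open>1 - q^(M+1)\<close>.\<close>

lemma gauss_binom_closed:
  "j \<le> M \<Longrightarrow> gauss_binom q M j * (qpoch_fin q q j * qpoch_fin q q (M - j)) = qpoch_fin q q M"
proof (induction M arbitrary: j)
  case 0 then show ?case by (simp add: qpoch_fin_def)
next
  case (Suc M)
  show ?case
  proof (cases j)
    case 0 then show ?thesis by (simp add: qpoch_fin_def)
  next
    case j: (Suc i)
    then have i: "i \<le> M" using Suc by simp
    have 2: "gauss_binom q M i * (qpoch_fin q q i * qpoch_fin q q (M - i)) = qpoch_fin q q M"
      using Suc.IH[OF i] .
    have 1: "gauss_binom q M (Suc i) * (qpoch_fin q q (Suc i) * qpoch_fin q q (M - i)) =
        qpoch_fin q q M * (1 - q ^ (M - i))"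
    \<comment> \<open>For \<open>i = M\<close> both sides are 0: the coefficient lies outside the
      triangle and \<open>1 - q^0 = 0\<close>.\<close>
    proof (cases "i = M")
      case False
      then have "M - i = Suc (M - Suc i)" using i by simp
      then have "qpoch_fin q q (M - i) = qpoch_fin q q (M - Suc i) * (1 - q ^ (M - i))"
        using qpoch_fin_Suc by metis
      then show ?thesis
        using Suc.IH[of "Suc i"] i False by (simp add: mult_ac)
    qed (simp add: gauss_binom_eq_0)
    have "gauss_binom q (Suc M) j * (qpoch_fin q q j * qpoch_fin q q (Suc M - j)) =
       gauss_binom q M (Suc i) * (qpoch_fin q q (Suc i) * qpoch_fin q q (M - i)) +
       q ^ (M - i) * (1 - q ^ Suc i) * (gauss_binom q M i * (qpoch_fin q q i * qpoch_fin q q (M - i)))"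
      by (simp only: j gauss_binom.simps diff_Suc_Suc qpoch_fin_Suc) (simp add: algebra_simps)
    also have "\<dots> = qpoch_fin q q M * (1 - q ^ (M - i) * q ^ Suc i)"
      unfolding 1 2 by (simp add: algebra_simps)
    also have "q ^ (M - i) * q ^ Suc i = q ^ Suc M"
      using i by (simp flip: power_add power_Suc)
    finally show ?thesis by (simp only: qpoch_fin_Suc)
  qed
qed

lemma double_triangle: "2 * triangle n = n * (n + 1)"
  by (induction n) auto

lemma prod_power_triangle: "(\<Prod>i<N. q ^ i) * q ^ N = (q :: complex) ^ triangle N"
  by (induction N) (auto simp: power_add mult_ac)

lemma prod_lessThan_add: "(\<Prod>k<N + M. f k) = (\<Prod>k<N. f k) * (\<Prod>k<M. f (N + k))"
  for f :: "nat \<Rightarrow> 'a :: comm_monoid_mult"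
  by (induction M) (auto simp: mult_ac)

lemma sum_lessThan_add: "(\<Sum>k<N + M. f k) = (\<Sum>k<N. f k) + (\<Sum>k<M. f (N + k))"
  for f :: "nat \<Rightarrow> 'a :: comm_monoid_add"
  by (induction M) (auto simp: add_ac)

text \<open>
  The q-binomial theorem with \<open>2N\<close> factors at \<open>x = -z q^(-N)\<close>, the terms \<open>N + k\<close> and \<open>N - k - 1\<close> being paired.
\<close>

lemma cauchy_triple_product:
  assumes "q \<noteq> 0" "z \<noteq> 0"
  shows "qpoch_fin (q * z) q N * qpoch_fin (1 / z) q N =
    (\<Sum>k\<le>N. (-1) ^ k * q ^ triangle k * (z ^ k * gauss_binom q (2 * N) (N + k) -
       (if k < N then gauss_binom q (2 * N) (N - Suc k) / z ^ Suc k else 0)))"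
proof -
  define x where "x = - z / q ^ N"
  \<comment> \<open>The product of the coefficients \<open>- z / q^i\<close> taken out of the first
    \<open>N\<close> factors; \<open>triangle N - N\<close> is the sum of all
    \<open>i < N\<close>.\<close>
  define C where "C = (-z) ^ N * q ^ N / q ^ triangle N"
  have [simp]: "C \<noteq> 0" using assms by (simp add: C_def)
  have "(\<Prod>k<2*N. 1 + x * q ^ Suc k) = (\<Prod>k<N. 1 + x * q ^ Suc k) * (\<Prod>k<N. 1 + x * q ^ Suc (N + k))"
    unfolding mult_2 by (rule prod_lessThan_add)
  also have "(\<Prod>k<N. 1 + x * q ^ Suc (N + k)) = qpoch_fin (q * z) q N"
    unfolding qpoch_fin_def by (rule prod.cong) (use assms in \<open>auto simp: x_def power_add\<close>)
  also have "(\<Prod>k<N. 1 + x * q ^ Suc k) = (\<Prod>i<N. 1 + x * q ^ (N - i))"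
    by (subst prod.nat_diff_reindex[symmetric]) (rule prod.cong, auto simp: Suc_diff_Suc)
  also have "\<dots> = (\<Prod>i<N. (- z / q ^ i) * (1 - 1 / z * q ^ i))"
  proof (rule prod.cong)
    fix i assume "i \<in> {..<N}"
    then have "q ^ N = q ^ (N - i) * q ^ i" by (simp flip: power_add)
    then show "1 + x * q ^ (N - i) = (- z / q ^ i) * (1 - 1 / z * q ^ i)"
      using assms by (simp add: x_def field_simps)
  qed simp
  also have "\<dots> = C * qpoch_fin (1 / z) q N"
    unfolding prod.distrib qpoch_fin_def C_def prod_dividef prod_constant
    using assms by (simp add: prod_power_triangle[symmetric])
  finally have L: "(\<Prod>k<2*N. 1 + x * q ^ Suc k) = C * (qpoch_fin (q * z) q N * qpoch_fin (1 / z) q N)"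
    by (simp add: mult_ac)
  define T where "T j = q ^ triangle j * gauss_binom q (2 * N) j * x ^ j" for j
  have T1: "T (N + k) = C * ((-1) ^ k * q ^ triangle k * (z ^ k * gauss_binom q (2 * N) (N + k)))" for k
  proof -
    have "2 * (triangle (N + k) + triangle N) = 2 * (N * (N + k) + N + triangle k)"
      unfolding distrib_left double_triangle by (simp add: algebra_simps)
    then have "triangle (N + k) + triangle N = N * (N + k) + N + triangle k"
      by (simp only: mult_cancel1) simp
    then have "q ^ triangle (N + k) * q ^ triangle N = q ^ (N * (N + k)) * q ^ N * q ^ triangle k"
      by (simp only: power_add [symmetric])
    then have A: "q ^ triangle (N + k) / q ^ (N * (N + k)) = q ^ N / q ^ triangle N * q ^ triangle k"
      using assms by (simp add: field_simps)
    have X: "x ^ (N + k) = (-z) ^ N * (-1) ^ k * z ^ k / q ^ (N * (N + k))"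
      unfolding x_def power_divide by (simp add: power_mult power_add power_minus[of z k])
    have "T (N + k) = (q ^ triangle (N + k) / q ^ (N * (N + k))) *
        ((-z) ^ N * ((-1) ^ k * z ^ k * gauss_binom q (2 * N) (N + k)))"
      unfolding T_def X by simp
    then show ?thesis unfolding A C_def by simp
  qed
  have T2: "T (N - Suc k) = C * (- ((-1) ^ k * q ^ triangle k * (gauss_binom q (2 * N) (N - Suc k) / z ^ Suc k)))"
    if "k < N" for k
  proof -
    define m where "m = N - Suc k"
    have m: "N = m + Suc k" using that by (simp add: m_def)
    have "2 * (triangle m + triangle N) = 2 * (N * m + N + triangle k)"
      unfolding distrib_left double_triangle m by (simp add: algebra_simps)
    then have "triangle m + triangle N = N * m + N + triangle k"
      by (simp only: mult_cancel1) simp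
    then have "q ^ triangle m * q ^ triangle N = q ^ (N * m) * q ^ N * q ^ triangle k"
      by (simp only: power_add [symmetric])
    then have A: "q ^ triangle m / q ^ (N * m) = q ^ N / q ^ triangle N * q ^ triangle k"
      using assms by (simp add: field_simps)
    have X: "x ^ m = (-z) ^ N * (- ((-1) ^ k)) / z ^ Suc k / q ^ (N * m)"
    proof -
      have "(-z) ^ N = (-z) ^ m * (- ((-1) ^ k) * z ^ Suc k)"
        unfolding m power_add by (simp add: power_minus[of z k])
      then show ?thesis unfolding x_def power_divide using assms 
        by (simp add: power_mult field_simps flip: power_mult_distrib)
    qed
    have "T m = (q ^ triangle m / q ^ (N * m)) *
        ((-z) ^ N * (- ((-1) ^ k) / z ^ Suc k * gauss_binom q (2 * N) m))"
      unfolding T_def X by (simp add: mult_ac)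
    then have "T m = C * (- ((-1) ^ k * q ^ triangle k * (gauss_binom q (2 * N) m / z ^ Suc k)))"
      unfolding A C_def by simp
    then show ?thesis unfolding m_def .
  qed
  have "(\<Sum>j\<le>2*N. T j) = (\<Sum>k\<le>N. T (N + k)) + (\<Sum>k<N. T (N - Suc k))"
    using sum_lessThan_add[of T N "Suc N"]
    by (simp add: lessThan_Suc_atMost mult_2 sum.nat_diff_reindex add.commute)
  \<comment> \<open>Index \<open>k = N\<close> has no partner; without the guard the truncated
    \<open>N - Suc N = 0\<close> would count the term 0 twice.\<close>
  also have "(\<Sum>k<N. T (N - Suc k)) = (\<Sum>k\<le>N. if k < N then T (N - Suc k) else 0)"
    by (rule sum.mono_neutral_cong_left) auto
  also have "(\<Sum>k\<le>N. T (N + k)) + \<dots> = (\<Sum>k\<le>N. C * ((-1) ^ k * q ^ triangle k * (z ^ k * gauss_binom q (2 * N) (N + k) -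
       (if k < N then gauss_binom q (2 * N) (N - Suc k) / z ^ Suc k else 0))))"
    unfolding sum.distrib[symmetric]
  proof (rule sum.cong)
    fix k assume "k \<in> {..N}"
    show "T (N + k) + (if k < N then T (N - Suc k) else 0) = C * ((-1) ^ k * q ^ triangle k * (z ^ k * gauss_binom q (2 * N) (N + k) -
       (if k < N then gauss_binom q (2 * N) (N - Suc k) / z ^ Suc k else 0)))"
      using T1[of k] T2[of k] by (cases "k < N") (simp_all add: right_diff_distrib)
  qed simp
  finally have "C * (qpoch_fin (q * z) q N * qpoch_fin (1 / z) q N) = C * (\<Sum>k\<le>N. (-1) ^ k * q ^ triangle k * (z ^ k * gauss_binom q (2 * N) (N + k) -
       (if k < N then gauss_binom q (2 * N) (N - Suc k) / z ^ Suc k else 0)))"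
    using L q_binomial_theorem[of x q "2 * N"] unfolding T_def sum_distrib_left by (simp add: mult_ac)
  then show ?thesis by simp
qed

text \<open>Successive terms have ratio \<open>norm q ^ Suc k * R\<close>, which tends to 0 whatever
  \<open>R\<close> is, so both \<open>norm z\<close> and its inverse can be inserted.\<close>

lemma summable_triangle:
  assumes "norm q < 1" "q \<noteq> (0::complex)" "R > (0::real)"
  shows "summable (\<lambda>k. norm q ^ triangle k * R ^ k)"
proof -
  have "(\<lambda>k. norm q ^ Suc k * R) \<longlonglongrightarrow> 0 * R"
    using assms by (intro tendsto_mult tendsto_const LIMSEQ_Suc LIMSEQ_power_zero) auto
  then have "eventually (\<lambda>k. norm q ^ Suc k * R < 1 / 2) sequentially"
    by (rule order_tendstoD) auto
  then obtain N where N: "\<And>k. k \<ge> N \<Longrightarrow> norm q ^ Suc k * R < 1 / 2"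
    unfolding eventually_sequentially by blast
  show ?thesis
  proof (rule summable_ratio_test[of "1/2" N])
    fix k assume "N \<le> k"
    have "norm q ^ triangle (Suc k) * R ^ Suc k = (norm q ^ Suc k * R) * (norm q ^ triangle k * R ^ k)"
      by (simp only: triangle_Suc power_add power_Suc mult_ac)
    also have "\<dots> \<le> 1 / 2 * (norm q ^ triangle k * R ^ k)"
      using N[OF \<open>N \<le> k\<close>] assms by (intro mult_right_mono) auto
    finally show "norm (norm q ^ triangle (Suc k) * R ^ Suc k) \<le> 1 / 2 * norm (norm q ^ triangle k * R ^ k)"
      using assms by simp
  qed simp
qed

text \<open>The finite identity is passed to the limit by Tannery's theorem. Each Gaussian binomial
  tends to the inverse of Euler's product, and all are bounded by one constant, because the partial
  Euler products are bounded and bounded away from 0.\<close>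

theorem jacobi_triple_product:
  assumes q: "norm q < 1" "q \<noteq> 0" and z: "z \<noteq> 0"
  shows "(\<lambda>k. (-1) ^ k * q ^ triangle k * (z ^ k - 1 / z ^ Suc k)) sums
           (qpoch q q * qpoch (q * z) q * qpoch (1 / z) q)"
proof -
  define E where "E = qpoch_fin q q"
  define Einf where "Einf = qpoch q q"
  have E_lim: "E \<longlonglongrightarrow> Einf" unfolding E_def Einf_def by (rule qpoch_fin_tendsto[OF q(1)])
  have Einf_nz: "Einf \<noteq> 0" unfolding Einf_def by (rule qpoch_self_nonzero[OF q(1)])
  have E_nz: "E n \<noteq> 0" for n
  proof -
    have "q * q ^ k \<noteq> 1" for k
      using q(1) by (metis norm_one norm_power power_Suc power_less_one_iff less_irrefl norm_ge_zero zero_less_Suc)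
    then show ?thesis by (auto simp: E_def qpoch_fin_def)
  qed
  have "Bseq (\<lambda>n. inverse (E n))"
    by (rule convergent_imp_Bseq[OF convergentI[OF tendsto_inverse[OF E_lim Einf_nz]]])
  then obtain b where b: "b > 0" "\<And>n. norm (inverse (E n)) \<le> b"
    by (auto simp: Bseq_def)
  obtain B where B: "B > 0" "\<And>n. norm (E n) \<le> B"
    using convergent_imp_Bseq[OF convergentI[OF E_lim]] by (auto simp: Bseq_def)
  have g: "gauss_binom q M j = E M * (inverse (E j) * inverse (E (M - j)))" if "j \<le> M" for M j
    using gauss_binom_closed[OF that, of q] E_nz by (simp add: E_def field_simps)
  have g_bound: "norm (gauss_binom q M j) \<le> B * (b * b)" for M j
  proof (cases "j \<le> M")
    case True
    show ?thesis unfolding g[OF True] norm_mult using b B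
      by (intro mult_mono) (auto intro: less_imp_le)
  qed (use b B in \<open>auto simp: gauss_binom_eq_0\<close>)
  define a where "a k N = (-1) ^ k * q ^ triangle k * (z ^ k * gauss_binom q (2 * N) (N + k) -
       (if k < N then gauss_binom q (2 * N) (N - Suc k) / z ^ Suc k else 0))" for k N
  define M where "M k = norm q ^ triangle k * (norm z ^ k * (B * (b * b)) + (B * (b * b)) / norm z ^ Suc k)" for k
  have g_lim: "(\<lambda>N. gauss_binom q (2 * N) (N + k)) \<longlonglongrightarrow> 1 / Einf"
      "(\<lambda>N. if k < N then gauss_binom q (2 * N) (N - Suc k) / z ^ Suc k else 0) \<longlonglongrightarrow> 1 / Einf / z ^ Suc k" for k
  proof -
    have f: "filterlim (\<lambda>N. 2 * N) sequentially sequentially" "filterlim (\<lambda>N. N + k) sequentially sequentially"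
      "filterlim (\<lambda>N. N - k) sequentially sequentially" for k :: nat
      by (auto intro!: filterlim_subseq strict_monoI filterlim_minus_const_nat_at_top)
    note [tendsto_intros] = filterlim_compose[OF E_lim]
    have *: "Einf * (inverse Einf * inverse Einf) = 1 / Einf" using Einf_nz by (simp add: field_simps)
    have "(\<lambda>N. E (2 * N) * (inverse (E (N + k)) * inverse (E (N - k)))) \<longlonglongrightarrow> Einf * (inverse Einf * inverse Einf)"
      by (intro tendsto_intros Einf_nz f)
    then show "(\<lambda>N. gauss_binom q (2 * N) (N + k)) \<longlonglongrightarrow> 1 / Einf"
      unfolding * by (rule Lim_transform_eventually)
        (rule eventually_sequentiallyI[of k], subst g, auto)
    have "(\<lambda>N. E (2 * N) * (inverse (E (N - Suc k)) * inverse (E (N + Suc k))) / z ^ Suc k) \<longlonglongrightarrow> Einf * (inverse Einf * inverse Einf) / z ^ Suc k"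
      using f z by (intro tendsto_intros Einf_nz f) auto
    then show "(\<lambda>N. if k < N then gauss_binom q (2 * N) (N - Suc k) / z ^ Suc k else 0) \<longlonglongrightarrow> 1 / Einf / z ^ Suc k"
      unfolding * by (rule Lim_transform_eventually)
       (rule eventually_sequentiallyI[of "Suc k"], subst g, auto simp: mult_2 Suc_diff_le)
  qed
  have lim: "(\<lambda>N. a k N) \<longlonglongrightarrow> (-1) ^ k * q ^ triangle k * (z ^ k * (1 / Einf) - 1 / Einf / z ^ Suc k)" for k
    unfolding a_def by (intro tendsto_intros g_lim)
  have bound: "norm (a k N) \<le> M k" for k N
  proof -
    have "norm (z ^ k * gauss_binom q (2 * N) (N + k) -
       (if k < N then gauss_binom q (2 * N) (N - Suc k) / z ^ Suc k else 0)) \<le>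
       norm z ^ k * (B * (b * b)) + (B * (b * b)) / norm z ^ Suc k"
    proof (rule order_trans[OF norm_triangle_ineq4 add_mono])
      show "norm (z ^ k * gauss_binom q (2 * N) (N + k)) \<le> norm z ^ k * (B * (b * b))"
        unfolding norm_mult norm_power by (intro mult_left_mono g_bound) auto
      show "norm (if k < N then gauss_binom q (2 * N) (N - Suc k) / z ^ Suc k else 0) \<le> B * (b * b) / norm z ^ Suc k"
      proof (cases "k < N")
        case True
        then show ?thesis
          using divide_right_mono[OF g_bound, of "norm z ^ Suc k"] by (simp add: norm_divide norm_mult norm_power)
      qed (use b B in simp)
    qed
    then show ?thesis unfolding a_def M_def norm_mult norm_power
      by (intro mult_mono) auto
  qed
  have sM: "summable M"
  proof -
    have "summable (\<lambda>k. (B * (b * b)) * (norm q ^ triangle k * norm z ^ k) +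
        (B * (b * b)) / norm z * (norm q ^ triangle k * (1 / norm z) ^ k))"
      using q z by (intro summable_add summable_mult summable_triangle) auto
    then show ?thesis unfolding M_def by (rule summable_cong[THEN iffD1, rotated]) (auto simp: field_simps power_divide)
  qed
  have tann: "summable (\<lambda>k. norm ((-1) ^ k * q ^ triangle k * (z ^ k * (1 / Einf) - 1 / Einf / z ^ Suc k))) \<and>
     (\<lambda>N. \<Sum>k. a k N) \<longlonglongrightarrow> (\<Sum>k. (-1) ^ k * q ^ triangle k * (z ^ k * (1 / Einf) - 1 / Einf / z ^ Suc k))"
  proof -
    have "eventually (\<lambda>(k, N). norm (a k N) \<le> M k) (sequentially \<times>\<^sub>F sequentially)"
      using bound by (intro always_eventually) auto
    from tannerys_theorem[OF lim this sM] show ?thesis by simp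
  qed
  have "(\<Sum>k. a k N) = qpoch_fin (q * z) q N * qpoch_fin (1 / z) q N" for N
  proof -
    have "(\<Sum>k. a k N) = (\<Sum>k\<le>N. a k N)"
      by (rule suminf_finite) (auto simp: a_def gauss_binom_eq_0)
    then show ?thesis unfolding cauchy_triple_product[OF q(2) z] a_def .
  qed
  then have "(\<lambda>N. \<Sum>k. a k N) \<longlonglongrightarrow> qpoch (q * z) q * qpoch (1 / z) q"
    using tendsto_mult[OF qpoch_fin_tendsto[OF q(1)] qpoch_fin_tendsto[OF q(1)]] by simp
  then have "(\<Sum>k. (-1) ^ k * q ^ triangle k * (z ^ k * (1 / Einf) - 1 / Einf / z ^ Suc k)) = qpoch (q * z) q * qpoch (1 / z) q"
    using tann LIMSEQ_unique by blast
  then have "(\<lambda>k. (-1) ^ k * q ^ triangle k * (z ^ k * (1 / Einf) - 1 / Einf / z ^ Suc k)) sums (qpoch (q * z) q * qpoch (1 / z) q)"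
    using summable_sums[OF summable_norm_cancel[OF conjunct1[OF tann]]] by (simp only:)
  from sums_mult[OF this, of Einf] 
  have "(\<lambda>k. Einf * ((-1) ^ k * q ^ triangle k * (z ^ k * (1 / Einf) - 1 / Einf / z ^ Suc k))) sums
      (qpoch q q * qpoch (q * z) q * qpoch (1 / z) q)"
    by (simp only: Einf_def mult.assoc)
  moreover have "Einf * ((-1) ^ k * q ^ triangle k * (z ^ k * (1 / Einf) - 1 / Einf / z ^ Suc k)) =
      (-1) ^ k * q ^ triangle k * (z ^ k - 1 / z ^ Suc k)" for k
    using Einf_nz z by (simp add: field_simps)
  ultimately show ?thesis by (simp only:)
qed

section \<open>The theta series\<close>

lemma ee_0 [simp]: "ee 0 = 1"
  by (simp add: ee_def)

lemma ee_nonzero [simp]: "ee x \<noteq> 0"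
  by (simp add: ee_def)

lemma ee_add: "ee (x + y) = ee x * ee y"
  by (simp add: ee_def distrib_left exp_add)

lemma ee_diff: "ee (x - y) = ee x / ee y"
  by (simp add: ee_def right_diff_distrib exp_diff)

lemma ee_minus: "ee (- x) = 1 / ee x"
  by (simp add: ee_def exp_minus field_simps)

lemma ee_power: "ee (of_nat n * x) = ee x ^ n"
  by (simp add: ee_def exp_of_nat_mult[symmetric] mult_ac)

lemma ee_power_int: "ee (of_int n * x) = ee x powi n"
proof (cases n rule: int_cases2)
  case (nonneg m)
  then show ?thesis by (simp add: ee_power)
next
  case (nonpos m)
  then show ?thesis by (simp add: ee_power ee_minus power_int_minus inverse_eq_divide)
qed

lemma ee_of_int [simp]: "ee (of_int n) = 1"
proof -
  have "ee 1 = 1" by (simp add: ee_def)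
  then show ?thesis using ee_power_int[of n 1] by simp
qed

lemma ee_eq_1_iff: "ee x = 1 \<longleftrightarrow> x \<in> \<int>"
proof
  assume "ee x = 1"
  then obtain n :: int where n: "Re (2 * of_real pi * \<i> * x) = 0" "Im (2 * of_real pi * \<i> * x) = of_int (2 * n) * pi"
    unfolding ee_def exp_eq_1 by auto
  then have "Im x = 0" "Re x = of_int n" by auto
  then have "x = of_int n" by (simp add: complex_eq_iff)
  then show "x \<in> \<int>" by simp
qed (auto elim: Ints_cases)

lemma ee_half: "ee (1 / 2) = - 1"
proof -
  have "2 * complex_of_real pi * \<i> * (1 / 2) = of_real pi * \<i>" by simp
  then show ?thesis unfolding ee_def by (simp only: exp_pi_i)
qed

lemma ee_quarter: "ee (1 / 4) = \<i>"
proof -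
  have "2 * complex_of_real pi * \<i> * (1 / 4) = \<i> * of_real (pi / 2)" by simp
  then show ?thesis unfolding ee_def by (simp only: cis_conv_exp[symmetric] cis_pi_half)
qed

lemma ee_of_int_half: "ee (of_int n / 2) = (if even n then 1 else - 1)"
  using ee_power_int[of n "1 / 2"] by (simp add: ee_half power_int_minus_left)

lemma norm_ee: "norm (ee x) = exp (- 2 * pi * Im x)"
  by (simp add: ee_def)

lemma norm_ee_less_1: "Im \<tau> > 0 \<Longrightarrow> norm (ee \<tau>) < 1"
  by (simp add: norm_ee)

lemma holomorphic_ee [holomorphic_intros]: "f holomorphic_on S \<Longrightarrow> (\<lambda>x. ee (f x)) holomorphic_on S"
  unfolding ee_def by (intro holomorphic_intros)

lemma kronecker_m4_minus: "kronecker_m4 (- r) = - kronecker_m4 r"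
  unfolding kronecker_m4_def by (simp add: zmod_zminus1_eq_if)

lemma kronecker_m4_add_2: "kronecker_m4 (r + 2) = - kronecker_m4 r"
  unfolding kronecker_m4_def by presburger

lemma kronecker_m4_odd: "kronecker_m4 (2 * int k + 1) = (-1) ^ k"
proof (induction k)
  case (Suc k)
  have "2 * int (Suc k) + 1 = (2 * int k + 1) + 2" by simp
  then show ?case using Suc kronecker_m4_add_2[of "2 * int k + 1"] by (simp only: power_Suc)
qed (simp add: kronecker_m4_def)

lemma kronecker_m4_nonzero_odd: "kronecker_m4 r \<noteq> 0 \<longleftrightarrow> odd r"
  unfolding kronecker_m4_def by presburger

definition theta_term :: "complex \<Rightarrow> complex \<Rightarrow> int \<Rightarrow> complex" where
  "theta_term \<tau> z r = ee (of_int (r ^ 2) * \<tau> / 8 + of_int r * z / 2)"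

text \<open>Gaussian decay, uniform for \<tau> above a horizontal line and z in a strip. The weight
  \<open>r^2\<close> is what differentiating a term in \<tau> brings down, so the bound also
  controls the derivative series.\<close>

lemma theta_term_bound:
  assumes "\<delta> > 0"
  shows "\<exists>C>0. \<forall>\<tau> z r. Im \<tau> \<ge> \<delta> \<longrightarrow> \<bar>Im z\<bar> \<le> M \<longrightarrow>
    norm (theta_term \<tau> z r) * (of_int r)^2 \<le> C * exp (- \<bar>of_int r\<bar>)"
proof -
  define a where "a = pi * \<delta> / 4"
  \<comment> \<open>The surplus 2 leaves a factor \<open>exp (- 2 * x)\<close>: one
    \<open>exp (- x)\<close> absorbs \<open>x^2\<close>, the other one gives summability.\<close>
  define b where "b = pi * M + 2"
  have a: "a > 0" using assms by (simp add: a_def)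
  have "norm (theta_term \<tau> z r) * (of_int r)^2 \<le> 2 * exp (b^2 / (4 * a)) * exp (- \<bar>of_int r\<bar>)"
    if *: "Im \<tau> \<ge> \<delta>" "\<bar>Im z\<bar> \<le> M" for \<tau> z r
  proof -
    define x where "x = \<bar>real_of_int r\<bar>"
    have x: "x \<ge> 0" "x^2 = (of_int r)^2" by (auto simp: x_def)
    have "Im (of_int (r ^ 2) * \<tau> / 8 + of_int r * z / 2) = x^2 * Im \<tau> / 8 + of_int r * Im z / 2"
      by (simp add: x)
    moreover have "- (x * M) \<le> of_int r * Im z"
    proof -
      have "\<bar>of_int r * Im z\<bar> \<le> x * M" unfolding abs_mult x_def[symmetric]
        using * x by (intro mult_left_mono) auto
      then show ?thesis by linarith
    qed
    moreover have "x^2 * \<delta> \<le> x^2 * Im \<tau>" using * by (intro mult_left_mono) auto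
    ultimately have "x^2 * \<delta> / 8 - x * M / 2 \<le> Im (of_int (r ^ 2) * \<tau> / 8 + of_int r * z / 2)"
      by linarith
    then have "2 * pi * (x^2 * \<delta> / 8 - x * M / 2) \<le> 2 * pi * Im (of_int (r ^ 2) * \<tau> / 8 + of_int r * z / 2)"
      by (intro mult_left_mono) auto
    then have "norm (theta_term \<tau> z r) \<le> exp (- (a * x^2) + b * x - 2 * x)"
      unfolding theta_term_def norm_ee by (simp add: a_def b_def algebra_simps)
    also have "\<dots> \<le> exp (b^2 / (4 * a) - 2 * x)"
    proof -
      have "0 \<le> (2 * a * x - b)^2" by simp
      then have "4 * a * (- (a * x^2) + b * x) \<le> b^2" by (simp add: power2_eq_square algebra_simps)
      then have "- (a * x^2) + b * x \<le> b^2 / (4 * a)" using a by (simp add: field_simps)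
      then show ?thesis by simp
    qed
    finally have 1: "norm (theta_term \<tau> z r) \<le> exp (b^2 / (4 * a) - 2 * x)" .
    have 2: "x^2 \<le> 2 * exp x" using exp_lower_Taylor_quadratic[of x] x by auto
    have "norm (theta_term \<tau> z r) * x^2 \<le> exp (b^2 / (4 * a) - 2 * x) * (2 * exp x)"
      using 1 2 by (intro mult_mono) auto
    also have "\<dots> = 2 * exp (b^2 / (4 * a)) * exp (- x)"
      by (simp add: exp_diff exp_minus field_simps flip: exp_add)
    finally show "norm (theta_term \<tau> z r) * (of_int r)^2 \<le> 2 * exp (b^2 / (4 * a)) * exp (- \<bar>of_int r\<bar>)"
      by (simp add: x_def)
  qed
  moreover have "2 * exp (b^2 / (4 * a)) > 0" by simp
  ultimately show ?thesis by blast
qed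

lemma theta_term_summable_bound:
  assumes "\<delta> > 0"
  shows "\<exists>B. summable B \<and> (\<forall>\<tau> z r k. Im \<tau> \<ge> \<delta> \<longrightarrow> \<bar>Im z\<bar> \<le> M \<longrightarrow>
    \<bar>r\<bar> = 2 * int k + 1 \<longrightarrow> norm (theta_term \<tau> z r) * (of_int r)^2 \<le> B k)"
proof -
  obtain C where C: "C > 0" 
    "\<And>\<tau> z r. Im \<tau> \<ge> \<delta> \<Longrightarrow> \<bar>Im z\<bar> \<le> M \<Longrightarrow> norm (theta_term \<tau> z r) * (of_int r)^2 \<le> C * exp (- \<bar>of_int r\<bar>)"
    using theta_term_bound[OF assms, of M] by blast
  show ?thesis
  proof (intro exI[of _ "\<lambda>k. C * exp (- 1) ^ k"] conjI allI impI)
    show "summable (\<lambda>k. C * exp (- 1) ^ k)"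
      by (intro summable_mult summable_geometric) auto
    fix \<tau> z and r :: int and k assume *: "Im \<tau> \<ge> \<delta>" "\<bar>Im z\<bar> \<le> M" "\<bar>r\<bar> = 2 * int k + 1"
    have "real k \<le> \<bar>real_of_int r\<bar>" using *(3) by linarith
    then have "exp (- \<bar>real_of_int r\<bar>) \<le> exp (- 1) ^ k"
      by (simp add: exp_of_nat_mult[symmetric])
    then show "norm (theta_term \<tau> z r) * (of_int r)^2 \<le> C * exp (- 1) ^ k"
      using C(2)[OF *(1,2), of r] C(1) by (meson mult_left_mono order_trans less_imp_le)
  qed
qed

text \<open>The terms at \<open>r\<close> and \<open>- r\<close> combined, which turns the bilateral
  sum into a series over the naturals: the shape of the triple product and of termwise
  differentiation.\<close>

definition theta_pair :: "nat \<Rightarrow> complex \<Rightarrow> complex \<Rightarrow> complex" where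
  "theta_pair k \<tau> z = (-1) ^ k * (theta_term \<tau> z (2 * int k + 1) - theta_term \<tau> z (- (2 * int k + 1)))"

text \<open>The positive and the negative odd integers are summed absolutely and separately, and the
  symbol vanishes at even ones. This identifies the unordered sum in the definition with an ordered
  series.\<close>

lemma theta_has_sum_pairs:
  assumes "Im \<tau> > 0"
  shows "((\<lambda>r. of_int (kronecker_m4 r) * theta_term \<tau> z r) has_sum theta \<tau> z) UNIV"
    and "(\<lambda>k. theta_pair k \<tau> z) sums theta \<tau> z"
proof -
  obtain B where B: "summable B"
    "\<And>r k. \<bar>r\<bar> = 2 * int k + 1 \<Longrightarrow> norm (theta_term \<tau> z r) * (of_int r)^2 \<le> B k"
    using theta_term_summable_bound[OF assms, of "\<bar>Im z\<bar>"] by blast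
  define T where "T = (\<lambda>r. of_int (kronecker_m4 r) * theta_term \<tau> z r)"
  have s: "summable (\<lambda>k. norm (theta_term \<tau> z (s * (2 * int k + 1))))" if "\<bar>s\<bar> = 1" for s
  proof (rule summable_comparison_test[OF _ B(1)], intro exI allI impI)
    fix k :: nat
    have a: "\<bar>s * (2 * int k + 1)\<bar> = 2 * int k + 1" using that by (simp add: abs_mult)
    have "1 \<le> (s * (2 * int k + 1))^2"
    proof -
      have "1 \<le> \<bar>s * (2 * int k + 1)\<bar>" unfolding a by simp
      then have "1 \<le> \<bar>s * (2 * int k + 1)\<bar>^2" by (rule one_le_power)
      then show ?thesis by (simp only: power2_abs)
    qed
    then have "1 \<le> (real_of_int (s * (2 * int k + 1)))^2"
      by (simp only: of_int_power[symmetric] of_int_1_le_iff)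
    then have "norm (theta_term \<tau> z (s * (2 * int k + 1))) * 1 \<le> 
        norm (theta_term \<tau> z (s * (2 * int k + 1))) * (real_of_int (s * (2 * int k + 1)))^2"
      by (intro mult_left_mono) auto
    then show "norm (norm (theta_term \<tau> z (s * (2 * int k + 1)))) \<le> B k"
      using B(2)[OF a] by simp
  qed
  define P where "P = (\<lambda>k. T (2 * int k + 1))"
  define N where "N = (\<lambda>k. T (- (2 * int k + 1)))"
  have sP: "summable (\<lambda>k. norm (P k))" and sN: "summable (\<lambda>k. norm (N k))"
    using s[of 1] s[of "-1"] unfolding P_def N_def T_def
    by (simp_all add: kronecker_m4_odd kronecker_m4_minus norm_mult norm_power del: minus_add_distrib)
  have hP: "(P has_sum suminf P) UNIV" and hN: "(N has_sum suminf N) UNIV"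
    using norm_summable_imp_has_sum[OF sP] norm_summable_imp_has_sum[OF sN]
      summable_sums[OF summable_norm_cancel[OF sP]] summable_sums[OF summable_norm_cancel[OF sN]] by auto
  have "(T has_sum suminf P) (range (\<lambda>k. 2 * int k + 1))"
    by (subst has_sum_reindex) (use hP in \<open>auto simp: inj_on_def o_def P_def\<close>)
  moreover have "(T has_sum suminf N) (range (\<lambda>k. - (2 * int k + 1)))"
    by (subst has_sum_reindex) (use hN in \<open>auto simp: inj_on_def o_def N_def\<close>)
  ultimately have "(T has_sum (suminf P + suminf N)) (range (\<lambda>k. 2 * int k + 1) \<union> range (\<lambda>k. - (2 * int k + 1)))"
  proof (rule has_sum_Un_disjoint)
    have False if "2 * int k + 1 = - (2 * int l + 1)" for k l using that by linarith
    then show "range (\<lambda>k. 2 * int k + 1) \<inter> range (\<lambda>k. - (2 * int k + 1)) = {}" by fast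
  qed
  also have "?this \<longleftrightarrow> (T has_sum (suminf P + suminf N)) UNIV"
  proof (rule has_sum_cong_neutral)
    fix r assume r: "r \<in> UNIV - (range (\<lambda>k. 2 * int k + 1) \<union> range (\<lambda>k. - (2 * int k + 1)))"
    have "even r"
    proof (rule ccontr)
      assume "odd r"
      then obtain m where m: "r = 2 * m + 1" by (elim oddE)
      then have "r = 2 * int (nat m) + 1 \<or> r = - (2 * int (nat (- m - 1)) + 1)" by auto
      then show False using r by blast
    qed
    then show "T r = 0" using kronecker_m4_nonzero_odd[of r] by (auto simp: T_def)
  qed auto
  finally have T: "(T has_sum (suminf P + suminf N)) UNIV" .
  moreover from T have "theta \<tau> z = suminf P + suminf N"
    unfolding theta_def theta_term_def[symmetric] T_def by (rule infsumI)
  ultimately show "((\<lambda>r. of_int (kronecker_m4 r) * theta_term \<tau> z r) has_sum theta \<tau> z) UNIV"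
    by (simp add: T_def)
  have "(\<lambda>k. P k + N k) sums (suminf P + suminf N)"
    using sP sN summable_norm_cancel by (intro sums_add summable_sums) auto
  moreover have "P k + N k = theta_pair k \<tau> z" for k
    by (simp add: P_def N_def T_def theta_pair_def kronecker_m4_odd kronecker_m4_minus right_diff_distrib del: minus_add_distrib)
  ultimately show "(\<lambda>k. theta_pair k \<tau> z) sums theta \<tau> z"
    using \<open>theta \<tau> z = _\<close> by simp
qed

text \<open>Odd squares are \<open>8 * triangle k + 1\<close>, so the exponents r^2/8 become 1/8
  plus triangular numbers, as in the triple product.\<close>

lemma theta_term_nat:
  "theta_term \<tau> z (2 * int k + 1) = ee (\<tau> / 8) * ee (z / 2) * (ee \<tau> ^ triangle k * ee z ^ k)"
  "theta_term \<tau> z (- (2 * int k + 1)) = ee (\<tau> / 8) * ee (z / 2) * (ee \<tau> ^ triangle k / ee z ^ Suc k)"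
proof -
  have t: "complex_of_int ((2 * int k + 1)\<^sup>2) = 8 * of_nat (triangle k) + 1"
  proof -
    have "(2 * int k + 1)\<^sup>2 = 8 * int (triangle k) + 1"
      using arg_cong[OF double_triangle[of k], of int] by (simp add: power2_eq_square algebra_simps)
    then show ?thesis by simp
  qed
  have "of_int ((2 * int k + 1) ^ 2) * \<tau> / 8 + of_int (2 * int k + 1) * z / 2 = \<tau> / 8 + z / 2 + (of_nat (triangle k) * \<tau> + of_nat k * z)"
    unfolding t by (simp add: field_simps)
  then show "theta_term \<tau> z (2 * int k + 1) = ee (\<tau> / 8) * ee (z / 2) * (ee \<tau> ^ triangle k * ee z ^ k)"
    unfolding theta_term_def by (simp only: ee_add ee_power)
  have "of_int ((- (2 * int k + 1)) ^ 2) * \<tau> / 8 + of_int (- (2 * int k + 1)) * z / 2 = \<tau> / 8 + z / 2 + (of_nat (triangle k) * \<tau> - of_nat (Suc k) * z)"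
    unfolding power2_minus t by (simp add: field_simps)
  then show "theta_term \<tau> z (- (2 * int k + 1)) = ee (\<tau> / 8) * ee (z / 2) * (ee \<tau> ^ triangle k / ee z ^ Suc k)"
    unfolding theta_term_def by (simp only: ee_add ee_diff ee_power)
qed

text \<open>The triple product without its Euler factor and without the factor vanishing at z = 0;
  it is even in z and nonzero there.\<close>

definition theta_prod :: "complex \<Rightarrow> complex \<Rightarrow> complex" where
  "theta_prod \<tau> z = qpoch (ee \<tau> * ee z) (ee \<tau>) * qpoch (ee \<tau> / ee z) (ee \<tau>)"

lemma theta_eq_product:
  assumes "Im \<tau> > 0"
  shows "theta \<tau> z = ee (\<tau> / 8) * qpoch (ee \<tau>) (ee \<tau>) * (ee (z / 2) - ee (- z / 2)) * theta_prod \<tau> z"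
proof -
  have n: "norm (ee \<tau>) < 1" using assms by (rule norm_ee_less_1)
  have "(\<lambda>k. ee (\<tau> / 8) * ee (z / 2) * ((-1) ^ k * ee \<tau> ^ triangle k * (ee z ^ k - 1 / ee z ^ Suc k))) sums
      (ee (\<tau> / 8) * ee (z / 2) * (qpoch (ee \<tau>) (ee \<tau>) * qpoch (ee \<tau> * ee z) (ee \<tau>) * qpoch (1 / ee z) (ee \<tau>)))"
    by (intro sums_mult jacobi_triple_product n) auto
  moreover have "theta_pair k \<tau> z = ee (\<tau> / 8) * ee (z / 2) * ((-1) ^ k * ee \<tau> ^ triangle k * (ee z ^ k - 1 / ee z ^ Suc k))" for k
    unfolding theta_pair_def theta_term_nat by (simp add: field_simps)
  ultimately have "theta \<tau> z = ee (\<tau> / 8) * ee (z / 2) * (qpoch (ee \<tau>) (ee \<tau>) * qpoch (ee \<tau> * ee z) (ee \<tau>) * qpoch (1 / ee z) (ee \<tau>))"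
    using sums_unique2[OF theta_has_sum_pairs(2)[OF assms]] by (simp only:)
  also have "qpoch (1 / ee z) (ee \<tau>) = (1 - 1 / ee z) * qpoch (ee \<tau> / ee z) (ee \<tau>)"
    using qpoch_split[OF n, of "1 / ee z"] by simp
  finally have "theta \<tau> z = ee (\<tau> / 8) * qpoch (ee \<tau>) (ee \<tau>) * (ee (z / 2) * (1 - 1 / ee z)) * theta_prod \<tau> z"
    by (simp only: theta_prod_def mult_ac)
  also have "ee (z / 2) * (1 - 1 / ee z) = ee (z / 2) - ee (- z / 2)"
    using ee_add[of "z / 2" "- z"] by (simp add: right_diff_distrib ee_minus)
  finally show ?thesis .
qed

lemma eta_eq: "eta \<tau> = ee (\<tau> / 24) * qpoch (ee \<tau>) (ee \<tau>)"
  by (simp add: eta_def qpoch_def)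

lemma eta_nonzero: "Im \<tau> > 0 \<Longrightarrow> eta \<tau> \<noteq> 0"
  unfolding eta_eq using qpoch_self_nonzero[OF norm_ee_less_1] by simp

section \<open>Joint holomorphy\<close>

lemma has_derivative_theta_term:
  "((\<lambda>p. theta_term (fst p) (snd p) r) has_derivative
     (\<lambda>h. theta_term (fst p) (snd p) r *
       (2 * of_real pi * \<i> * (of_int (r ^ 2) / 8) * fst h + 2 * of_real pi * \<i> * (of_int r / 2) * snd h))) (at p within S)"
proof -
  define c d where "c = 2 * of_real pi * \<i> * (of_int (r ^ 2) / 8)" and "d = 2 * of_real pi * \<i> * (of_int r / 2)"
  have "theta_term (fst p) (snd p) r = exp (c * fst p + d * snd p)" for p
    unfolding theta_term_def ee_def c_def d_def by (simp add: algebra_simps)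
  moreover have lin: "((\<lambda>p. c * fst p + d * snd p) has_derivative (\<lambda>h. c * fst h + d * snd h)) (at p within S)"
    by (auto intro!: derivative_eq_intros)
  moreover have "(exp has_derivative (*) (exp (c * fst p + d * snd p))) (at (c * fst p + d * snd p))"
    using DERIV_exp by (simp add: has_field_derivative_def)
  ultimately have "((\<lambda>p. theta_term (fst p) (snd p) r) has_derivative
      (\<lambda>h. theta_term (fst p) (snd p) r * (c * fst h + d * snd h))) (at p within S)"
    using has_derivative_compose[OF lin] by simp
  then show ?thesis unfolding c_def d_def by simp
qed

definition theta_pair_d\<tau> :: "nat \<Rightarrow> complex \<times> complex \<Rightarrow> complex" where
  "theta_pair_d\<tau> k p = (-1) ^ k * (2 * of_real pi * \<i>) * (of_int ((2 * int k + 1) ^ 2) / 8) *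
     (theta_term (fst p) (snd p) (2 * int k + 1) - theta_term (fst p) (snd p) (- (2 * int k + 1)))"

definition theta_pair_dz :: "nat \<Rightarrow> complex \<times> complex \<Rightarrow> complex" where
  "theta_pair_dz k p = (-1) ^ k * (2 * of_real pi * \<i>) * (of_int (2 * int k + 1) / 2) *
     (theta_term (fst p) (snd p) (2 * int k + 1) + theta_term (fst p) (snd p) (- (2 * int k + 1)))"

lemma has_derivative_theta_pair:
  "((\<lambda>p. theta_pair k (fst p) (snd p)) has_derivative
     (\<lambda>h. theta_pair_d\<tau> k p * fst h + theta_pair_dz k p * snd h)) (at p within S)"
proof -
  define r where "r = 2 * int k + 1"
  show ?thesis
    unfolding theta_pair_def theta_pair_d\<tau>_def theta_pair_dz_def r_def[symmetric]
    by (rule has_derivative_eq_rhs[OF has_derivative_mult_right[OF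
          has_derivative_diff[OF has_derivative_theta_term has_derivative_theta_term]]])
       (simp add: fun_eq_iff field_simps)
qed

text \<open>The \<tau>-derivative brings down r^2/8 and the z-derivative r/2; as r <= r^2 for these
  r, one majorant of the terms weighted by r^2 serves both.\<close>

lemma theta_pair_derivative_bound:
  assumes "\<delta> > 0"
  shows "\<exists>B. summable B \<and> (\<forall>k p. Im (fst p) \<ge> \<delta> \<longrightarrow> \<bar>Im (snd p)\<bar> \<le> M \<longrightarrow>
    norm (theta_pair_d\<tau> k p) \<le> B k \<and> norm (theta_pair_dz k p) \<le> B k)"
proof -
  obtain B where B: "summable B" "\<And>\<tau> z r k. Im \<tau> \<ge> \<delta> \<Longrightarrow> \<bar>Im z\<bar> \<le> M \<Longrightarrow>
    \<bar>r\<bar> = 2 * int k + 1 \<Longrightarrow> norm (theta_term \<tau> z r) * (of_int r)^2 \<le> B k"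
    using theta_term_summable_bound[OF assms, of M] by blast
  have "norm (theta_pair_d\<tau> k p) \<le> 2 * pi * B k \<and> norm (theta_pair_dz k p) \<le> 2 * pi * B k"
    if p: "Im (fst p) \<ge> \<delta>" "\<bar>Im (snd p)\<bar> \<le> M" for k p
  proof -
    define x where "x = real_of_int (2 * int k + 1)"
    define P where "P = norm (theta_term (fst p) (snd p) (2 * int k + 1))"
    define N where "N = norm (theta_term (fst p) (snd p) (- (2 * int k + 1)))"
    have x: "x \<ge> 1" "x \<le> x^2" "x^2 \<ge> 0" unfolding x_def by (auto simp: power2_eq_square)
    have PN: "P * x^2 \<le> B k" "N * x^2 \<le> B k" "P \<ge> 0" "N \<ge> 0"
      using B(2)[OF p, of "2 * int k + 1" k] B(2)[OF p, of "- (2 * int k + 1)" k]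
      unfolding P_def N_def x_def by (auto simp: power2_eq_square algebra_simps)
    have nx: "norm (complex_of_int (2 * int k + 1)) = x" "norm (complex_of_int ((2 * int k + 1)^2)) = x^2"
      unfolding norm_of_int x_def by simp_all
    have "norm (theta_pair_d\<tau> k p) \<le> 2 * pi * (x^2 / 8) * (P + N)"
    proof -
      have "norm (theta_pair_d\<tau> k p) = 2 * pi * (x^2 / 8) *
          norm (theta_term (fst p) (snd p) (2 * int k + 1) - theta_term (fst p) (snd p) (- (2 * int k + 1)))"
        unfolding theta_pair_d\<tau>_def norm_mult norm_divide norm_power nx by simp
      also have "\<dots> \<le> 2 * pi * (x^2 / 8) * (P + N)"
        unfolding P_def N_def by (intro mult_left_mono norm_triangle_ineq4) auto
      finally show ?thesis .
    qed
    also have "\<dots> = 2 * pi * ((P * x^2 + N * x^2) / 8)" by (simp add: algebra_simps)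
    also have "\<dots> \<le> 2 * pi * B k"
    proof (intro mult_left_mono)
      have "0 \<le> P * x^2" using PN by simp
      then have "P * x^2 + N * x^2 \<le> 8 * B k" using PN by linarith
      then show "(P * x^2 + N * x^2) / 8 \<le> B k" by simp
    qed auto
    finally have 1: "norm (theta_pair_d\<tau> k p) \<le> 2 * pi * B k" .
    have "norm (theta_pair_dz k p) \<le> 2 * pi * (x / 2) * (P + N)"
    proof -
      have "norm (theta_pair_dz k p) = 2 * pi * (x / 2) *
          norm (theta_term (fst p) (snd p) (2 * int k + 1) + theta_term (fst p) (snd p) (- (2 * int k + 1)))"
        unfolding theta_pair_dz_def norm_mult norm_divide norm_power nx by simp
      also have "\<dots> \<le> 2 * pi * (x / 2) * (P + N)"
        unfolding P_def N_def using x(1) by (intro mult_left_mono norm_triangle_ineq) auto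
      finally show ?thesis .
    qed
    also have "\<dots> \<le> 2 * pi * (x^2 / 2) * (P + N)"
      using PN x by (intro mult_right_mono mult_left_mono) auto
    also have "\<dots> = 2 * pi * ((P * x^2 + N * x^2) / 2)" by (simp add: algebra_simps)
    also have "\<dots> \<le> 2 * pi * B k"
      using PN by (intro mult_left_mono) auto
    finally show ?thesis using 1 by simp
  qed
  then show ?thesis using B(1) by (intro exI[of _ "\<lambda>k. 2 * pi * B k"]) (auto intro: summable_mult)
qed

text \<open>\<open>holomorphic_HC\<close> asks for a joint derivative, hence termwise
  differentiation in two variables: on a convex product of a half-plane and a strip the series of
  both partial derivatives converge uniformly, so the total derivatives converge uniformly as linear
  maps.\<close>

lemma holomorphic_HC_theta: "holomorphic_HC theta"
  unfolding holomorphic_HC_def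
proof (intro allI impI)
  fix \<tau> z :: complex assume \<tau>: "Im \<tau> > 0"
  define \<delta> where "\<delta> = Im \<tau> / 2"
  define M where "M = \<bar>Im z\<bar> + 1"
  define S where "S = {t. Im t > \<delta>} \<times> ({w. Im w > - M} \<inter> {w. Im w < M})"
  have S: "open S" "convex S" "(\<tau>, z) \<in> S"
  proof -
    show "open S" unfolding S_def
      by (intro open_Times open_Int open_halfspace_Im_gt open_halfspace_Im_lt)
    show "convex S" unfolding S_def
      by (intro convex_Times convex_Int convex_halfspace_Im_gt convex_halfspace_Im_lt)
    show "(\<tau>, z) \<in> S" unfolding S_def \<delta>_def M_def using \<tau> by auto
  qed
  have SI: "Im (fst p) \<ge> \<delta>" "\<bar>Im (snd p)\<bar> \<le> M" "Im (fst p) > 0" if "p \<in> S" for p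
    using that \<tau> by (auto simp: S_def \<delta>_def)
  have "\<delta> > 0" using \<tau> by (simp add: \<delta>_def)
  then obtain B where B: "summable B"
    "\<And>k p. p \<in> S \<Longrightarrow> norm (theta_pair_d\<tau> k p) \<le> B k" "\<And>k p. p \<in> S \<Longrightarrow> norm (theta_pair_dz k p) \<le> B k"
    using theta_pair_derivative_bound[of \<delta> M] SI by blast
  define D1 where "D1 p = (\<Sum>k. theta_pair_d\<tau> k p)" for p
  define D2 where "D2 p = (\<Sum>k. theta_pair_dz k p)" for p
  have u1: "uniform_limit S (\<lambda>n p. \<Sum>i<n. theta_pair_d\<tau> i p) D1 sequentially"
    unfolding D1_def by (rule Weierstrass_m_test[OF B(2) B(1)])
  have u2: "uniform_limit S (\<lambda>n p. \<Sum>i<n. theta_pair_dz i p) D2 sequentially"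
    unfolding D2_def by (rule Weierstrass_m_test[OF B(3) B(1)])
  have unif: "\<forall>\<^sub>F n in sequentially. \<forall>p\<in>S. \<forall>h. norm ((\<Sum>i<n. theta_pair_d\<tau> i p * fst h + theta_pair_dz i p * snd h) -
        (D1 p * fst h + D2 p * snd h)) \<le> e * norm h" if e: "e > 0" for e :: real
  proof -
    have "eventually (\<lambda>n. \<forall>p\<in>S. dist (\<Sum>i<n. theta_pair_d\<tau> i p) (D1 p) < e / 2) sequentially"
         "eventually (\<lambda>n. \<forall>p\<in>S. dist (\<Sum>i<n. theta_pair_dz i p) (D2 p) < e / 2) sequentially"
      using uniform_limitD[OF u1, of "e / 2"] uniform_limitD[OF u2, of "e / 2"] e by simp_all
    then show ?thesis
    proof eventually_elim
      case (elim n)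
      show ?case
      proof (intro ballI allI)
        fix p and h :: "complex \<times> complex" assume p: "p \<in> S"
        have "(\<Sum>i<n. theta_pair_d\<tau> i p * fst h + theta_pair_dz i p * snd h) - (D1 p * fst h + D2 p * snd h) =
          ((\<Sum>i<n. theta_pair_d\<tau> i p) - D1 p) * fst h + ((\<Sum>i<n. theta_pair_dz i p) - D2 p) * snd h"
          by (simp add: sum.distrib sum_distrib_right[symmetric] left_diff_distrib)
        also have "norm \<dots> \<le> e / 2 * norm h + e / 2 * norm h"
        proof (rule order_trans[OF norm_triangle_ineq add_mono])
          show "norm (((\<Sum>i<n. theta_pair_d\<tau> i p) - D1 p) * fst h) \<le> e / 2 * norm h"
            unfolding norm_mult using elim(1) p e norm_fst_le[of "fst h" "snd h"]
            by (intro mult_mono) (auto simp: dist_norm less_imp_le)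
          show "norm (((\<Sum>i<n. theta_pair_dz i p) - D2 p) * snd h) \<le> e / 2 * norm h"
            unfolding norm_mult using elim(2) p e norm_snd_le[of "snd h" "fst h"]
            by (intro mult_mono) (auto simp: dist_norm less_imp_le)
        qed
        finally show "norm ((\<Sum>i<n. theta_pair_d\<tau> i p * fst h + theta_pair_dz i p * snd h) -
          (D1 p * fst h + D2 p * snd h)) \<le> e * norm h" by simp
      qed
    qed
  qed
  have "(\<lambda>k. theta_pair k (fst (\<tau>, z)) (snd (\<tau>, z))) sums theta \<tau> z"
    using theta_has_sum_pairs(2)[OF \<tau>] by simp
  note has_derivative_series[OF S(2) has_derivative_theta_pair unif S(3) this]
  then obtain g where g: "\<And>p. p \<in> S \<Longrightarrow> (\<lambda>k. theta_pair k (fst p) (snd p)) sums g p"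
      "\<And>p. p \<in> S \<Longrightarrow> (g has_derivative (\<lambda>h. D1 p * fst h + D2 p * snd h)) (at p within S)"
    by blast
  have geq: "g p = (\<lambda>(t, w). theta t w) p" if "p \<in> S" for p
    using sums_unique2[OF g(1)[OF that] theta_has_sum_pairs(2)[OF SI(3)[OF that]]] by (simp add: case_prod_unfold)
  have "((\<lambda>(t, w). theta t w) has_derivative (\<lambda>h. D1 (\<tau>, z) * fst h + D2 (\<tau>, z) * snd h)) (at (\<tau>, z) within S)"
    by (rule has_derivative_transform[OF S(3) _ g(2)[OF S(3)]]) (use geq in auto)
  then have "((\<lambda>(t, w). theta t w) has_derivative (\<lambda>(u, v). D1 (\<tau>, z) * u + D2 (\<tau>, z) * v)) (at (\<tau>, z))"
    unfolding at_within_open[OF S(3,1)] by (simp add: case_prod_unfold)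
  then show "\<exists>A B. ((\<lambda>(t, w). theta t w) has_derivative (\<lambda>(u, v). A * u + B * v)) (at (\<tau>, z))"
    by blast
qed

lemma holomorphic_HC_mult:
  assumes "holomorphic_HC f" "holomorphic_HC g"
  shows "holomorphic_HC (\<lambda>\<tau> z. f \<tau> z * g \<tau> z)"
  unfolding holomorphic_HC_def
proof (intro allI impI)
  fix \<tau> z :: complex assume \<tau>: "Im \<tau> > 0"
  obtain A B C D where d: "((\<lambda>(t, w). f t w) has_derivative (\<lambda>(u, v). A * u + B * v)) (at (\<tau>, z))"
    "((\<lambda>(t, w). g t w) has_derivative (\<lambda>(u, v). C * u + D * v)) (at (\<tau>, z))"
    using assms \<tau> unfolding holomorphic_HC_def by blast
  have "((\<lambda>p. (\<lambda>(t, w). f t w) p * (\<lambda>(t, w). g t w) p) has_derivative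
      (\<lambda>h. f \<tau> z * (\<lambda>(u, v). C * u + D * v) h + (\<lambda>(u, v). A * u + B * v) h * g \<tau> z)) (at (\<tau>, z))"
    using has_derivative_mult[OF d] by simp
  then have "((\<lambda>(t, w). f t w * g t w) has_derivative
      (\<lambda>(u, v). (f \<tau> z * C + A * g \<tau> z) * u + (f \<tau> z * D + B * g \<tau> z) * v)) (at (\<tau>, z))"
    by (simp add: case_prod_unfold algebra_simps)
  then show "\<exists>A B. ((\<lambda>(t, w). f t w * g t w) has_derivative (\<lambda>(u, v). A * u + B * v)) (at (\<tau>, z))"
    by blast
qed

lemma holomorphic_HC_const: "holomorphic_HC (\<lambda>\<tau> z. c)"
  unfolding holomorphic_HC_def by (intro allI impI exI[of _ 0]) (simp add: case_prod_unfold)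

lemma holomorphic_HC_prod_list:
  "(\<And>x. x \<in> set xs \<Longrightarrow> holomorphic_HC (f x)) \<Longrightarrow> holomorphic_HC (\<lambda>\<tau> z. \<Prod>x\<leftarrow>xs. f x \<tau> z)"
  by (induction xs) (auto intro!: holomorphic_HC_const holomorphic_HC_mult)

lemma holomorphic_HC_fst:
  assumes "f holomorphic_on {t. Im t > 0}"
  shows "holomorphic_HC (\<lambda>\<tau> z. f \<tau>)"
  unfolding holomorphic_HC_def
proof (intro allI impI)
  fix \<tau> z :: complex assume \<tau>: "Im \<tau> > 0"
  have "(f has_field_derivative deriv f \<tau>) (at \<tau>)"
    using holomorphic_derivI[OF assms open_halfspace_Im_gt] \<tau> by auto
  then have "((\<lambda>p. f (fst p)) has_derivative (\<lambda>h. fst h * deriv f \<tau>)) (at (\<tau>, z))"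
    using has_derivative_compose[OF has_derivative_fst[OF has_derivative_ident], of f "\<lambda>x. x * deriv f \<tau>" "(\<tau>, z)" UNIV]
    by (simp add: has_field_derivative_def mult_commute_abs)
  then show "\<exists>A B. ((\<lambda>(t, w). f t) has_derivative (\<lambda>(u, v). A * u + B * v)) (at (\<tau>, z))"
    by (intro exI[of _ "deriv f \<tau>"] exI[of _ 0]) (simp add: case_prod_unfold mult.commute)
qed

lemma holomorphic_HC_scale:
  assumes "holomorphic_HC f"
  shows "holomorphic_HC (\<lambda>\<tau> z. f \<tau> (a * z))"
  unfolding holomorphic_HC_def
proof (intro allI impI)
  fix \<tau> z :: complex assume \<tau>: "Im \<tau> > 0"
  obtain A B where d: "((\<lambda>(t, w). f t w) has_derivative (\<lambda>(u, v). A * u + B * v)) (at (\<tau>, a * z))"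
    using assms \<tau> unfolding holomorphic_HC_def by blast
  have "((\<lambda>p. (fst p, a * snd p)) has_derivative (\<lambda>h. (fst h, a * snd h))) (at (\<tau>, z))"
    by (auto intro!: derivative_eq_intros)
  from has_derivative_compose[OF this, of "\<lambda>(t, w). f t w" "\<lambda>(u, v). A * u + B * v"] d
  have "((\<lambda>p. f (fst p) (a * snd p)) has_derivative (\<lambda>h. A * fst h + B * (a * snd h))) (at (\<tau>, z))"
    by (simp add: case_prod_unfold)
  then show "\<exists>A B. ((\<lambda>(t, w). f t (a * w)) has_derivative (\<lambda>(u, v). A * u + B * v)) (at (\<tau>, z))"
    by (intro exI[of _ A] exI[of _ "B * a"]) (simp add: case_prod_unfold mult_ac)
qed

lemma holomorphic_HC_imp_entire:
  assumes "holomorphic_HC f" "Im \<tau> > 0"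
  shows "f \<tau> holomorphic_on S"
proof (rule holomorphic_on_subset[OF _ subset_UNIV])
  have "f \<tau> field_differentiable (at z)" for z
  proof -
    obtain A B where d: "((\<lambda>(t, w). f t w) has_derivative (\<lambda>(u, v). A * u + B * v)) (at (\<tau>, z))"
      using assms unfolding holomorphic_HC_def by blast
    have "((\<lambda>w. (\<tau>, w)) has_derivative (\<lambda>h. (0, h))) (at z)"
      by (auto intro!: derivative_eq_intros)
    from has_derivative_compose[OF this, of "\<lambda>(t, w). f t w" "\<lambda>(u, v). A * u + B * v"] d
    have "(f \<tau> has_derivative (\<lambda>h. B * h)) (at z)" by (simp add: case_prod_unfold)
    then show ?thesis by (auto simp: field_differentiable_def has_field_derivative_def)
  qed
  then show "f \<tau> holomorphic_on UNIV" by (simp add: holomorphic_on_def field_differentiable_at_within)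
qed

lemma holomorphic_HC_cong:
  assumes "holomorphic_HC f" "\<And>\<tau> z. Im \<tau> > 0 \<Longrightarrow> g \<tau> z = f \<tau> z"
  shows "holomorphic_HC g"
  unfolding holomorphic_HC_def
proof (intro allI impI)
  fix \<tau> z :: complex assume \<tau>: "Im \<tau> > 0"
  have o: "open ({t. Im t > 0} \<times> (UNIV :: complex set))" by (intro open_Times open_halfspace_Im_gt open_UNIV)
  obtain A B where d: "((\<lambda>(t, w). f t w) has_derivative (\<lambda>(u, v). A * u + B * v)) (at (\<tau>, z))"
    using assms(1) \<tau> unfolding holomorphic_HC_def by blast
  have "((\<lambda>(t, w). g t w) has_derivative (\<lambda>(u, v). A * u + B * v)) (at (\<tau>, z))"
    by (rule has_derivative_transform_within_open[OF d o]) (use \<tau> assms(2) in auto)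
  then show "\<exists>A B. ((\<lambda>(t, w). g t w) has_derivative (\<lambda>(u, v). A * u + B * v)) (at (\<tau>, z))" by blast
qed

section \<open>Elliptic and modular transformations\<close>

definition jphi :: "complex \<Rightarrow> complex \<Rightarrow> complex" where
  "jphi \<tau> z = theta \<tau> z / eta \<tau> ^ 3"

text \<open>\<open>ee (\<tau> / 24) ^ 3\<close> cancels \<open>ee (\<tau> / 8)\<close>. What remains
  depends on \<tau> only through \<open>ee \<tau>\<close>, hence the invariance under \<tau> + 1
  without a root of unity.\<close>

lemma jphi_eq_product:
  assumes "Im \<tau> > 0"
  shows "jphi \<tau> z = (ee (z / 2) - ee (- z / 2)) * theta_prod \<tau> z / qpoch (ee \<tau>) (ee \<tau>) ^ 2"
proof -
  have "ee (\<tau> / 24) ^ 3 = ee (\<tau> / 8)" by (simp flip: ee_power)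
  then show ?thesis
    using qpoch_self_nonzero[OF norm_ee_less_1[OF assms]]
    by (simp add: jphi_def theta_eq_product[OF assms] eta_eq power_mult_distrib field_simps power3_eq_cube power2_eq_square)
qed

lemma theta_eq_jphi: "Im \<tau> > 0 \<Longrightarrow> theta \<tau> z = eta \<tau> ^ 3 * jphi \<tau> z"
  by (simp add: jphi_def eta_nonzero)

text \<open>A convergent product vanishes only if one of its factors does, so at a zero some
  multiple of \<tau> plus or minus z is an integer.\<close>

lemma jphi_eq_0_imp_lattice:
  assumes "Im \<tau> > 0" "jphi \<tau> z = 0"
  shows "\<exists>l p :: int. z = of_int l * \<tau> + of_int p"
proof -
  let ?q = "ee \<tau>"
  have n: "norm ?q < 1" using assms(1) by (rule norm_ee_less_1)
  have "ee (z / 2) - ee (- z / 2) = 0 \<or> qpoch (?q * ee z) ?q = 0 \<or> qpoch (?q / ee z) ?q = 0"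
    using assms(2) unfolding jphi_eq_product[OF assms(1)] theta_prod_def
    using qpoch_self_nonzero[OF n] by auto
  then consider "ee (z / 2) = ee (- z / 2)" | "qpoch (?q * ee z) ?q = 0" | "qpoch (?q / ee z) ?q = 0"
    by auto
  then show ?thesis
  proof cases
    case 1
    then have "ee (z / 2 - (- z / 2)) = 1" unfolding ee_diff by simp
    then have "z \<in> \<int>" by (simp add: ee_eq_1_iff)
    then show ?thesis by (auto elim!: Ints_cases intro: exI[of _ 0])
  next
    case 2
    then obtain k where "?q * ee z * ?q ^ k = 1" using qpoch_nonzero[OF n] by blast
    then have "ee (of_nat (Suc k) * \<tau> + z) = 1" unfolding ee_add ee_power by (simp add: mult_ac)
    then obtain p where "of_nat (Suc k) * \<tau> + z = of_int p" by (auto simp: ee_eq_1_iff elim!: Ints_cases)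
    then have "z = of_int (- int (Suc k)) * \<tau> + of_int p" by (simp add: algebra_simps)
    then show ?thesis by blast
  next
    case 3
    then obtain k where "?q / ee z * ?q ^ k = 1" using qpoch_nonzero[OF n] by blast
    then have "ee (of_nat (Suc k) * \<tau> - z) = 1" unfolding ee_diff ee_power by (simp add: mult_ac)
    then obtain p where "of_nat (Suc k) * \<tau> - z = of_int p" by (auto simp: ee_eq_1_iff elim!: Ints_cases)
    then have "z = of_int (int (Suc k)) * \<tau> + of_int (- p)" by (simp add: algebra_simps)
    then show ?thesis by blast
  qed
qed

definition parity_sign :: "int \<Rightarrow> complex" where
  "parity_sign n = (if even n then 1 else - 1)"

lemma kronecker_m4_add_even:
  "of_int (kronecker_m4 (r + 2 * l)) = parity_sign l * of_int (kronecker_m4 r)"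
proof (cases "even l")
  case True
  then obtain m where "l = 2 * m" by (elim evenE)
  then have "(r + 2 * l) mod 4 = r mod 4" by (simp add: mod_add_eq[symmetric])
  then show ?thesis using True by (simp add: kronecker_m4_def parity_sign_def)
next
  case False
  then obtain m where m: "l = 2 * m + 1" by (elim oddE)
  have "(r + 2 * l) mod 4 = (r + 2) mod 4" unfolding m by presburger
  then have "kronecker_m4 (r + 2 * l) = kronecker_m4 (r + 2)" by (simp add: kronecker_m4_def)
  then show ?thesis using False kronecker_m4_add_2[of r] by (simp add: parity_sign_def)
qed

text \<open>Completing the square in the exponent shifts \<open>r\<close> to
  \<open>r + 2 * l\<close>. The Kronecker symbol turns this shift into (-1)^l, and translation by
  \<open>p\<close> gives (-1)^(r p) = (-1)^p as only odd \<open>r\<close> contribute.\<close>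

lemma theta_elliptic:
  assumes "Im \<tau> > 0"
  shows "theta \<tau> (z + of_int l * \<tau> + of_int p) =
    parity_sign (l + p) * ee (- (of_int (l ^ 2) * \<tau> / 2 + of_int l * z)) * theta \<tau> z"
proof -
  define c where "c = parity_sign (l + p) * ee (- (of_int (l ^ 2) * \<tau> / 2 + of_int l * z))"
  define T where "T = (\<lambda>r. of_int (kronecker_m4 r) * theta_term \<tau> z r)"
  have "of_int (kronecker_m4 r) * theta_term \<tau> (z + of_int l * \<tau> + of_int p) r = c * T (r + 2 * l)" for r
  proof (cases "odd r")
    case False
    then show ?thesis using kronecker_m4_nonzero_odd[of r] kronecker_m4_nonzero_odd[of "r + 2 * l"]
      by (auto simp: T_def)
  next
    case True
    have "of_int (r ^ 2) * \<tau> / 8 + of_int r * (z + of_int l * \<tau> + of_int p) / 2 =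
      (of_int ((r + 2 * l) ^ 2) * \<tau> / 8 + of_int (r + 2 * l) * z / 2) +
      (- (of_int (l ^ 2) * \<tau> / 2 + of_int l * z)) + of_int (r * p) / 2"
      by (simp add: field_simps power2_eq_square)
    then have "theta_term \<tau> (z + of_int l * \<tau> + of_int p) r =
       theta_term \<tau> z (r + 2 * l) * ee (- (of_int (l ^ 2) * \<tau> / 2 + of_int l * z)) * parity_sign (r * p)"
      unfolding theta_term_def by (simp only: ee_add ee_of_int_half parity_sign_def)
    also have "parity_sign (r * p) = parity_sign p" using True by (simp add: parity_sign_def)
    finally show ?thesis
      unfolding T_def c_def kronecker_m4_add_even by (simp add: parity_sign_def)
  qed
  moreover have "((\<lambda>r. c * T (r + 2 * l)) has_sum c * theta \<tau> z) UNIV"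
  proof (rule has_sum_cmult_right)
    have "bij_betw (\<lambda>r. r + 2 * l) UNIV UNIV" by (rule bij_betwI[of _ _ _ "\<lambda>r. r - 2 * l"]) auto
    then show "((\<lambda>r. T (r + 2 * l)) has_sum theta \<tau> z) UNIV"
      using theta_has_sum_pairs(1)[OF assms, of z] unfolding T_def[symmetric] by (subst has_sum_reindex_bij_betw)
  qed
  ultimately have "((\<lambda>r. of_int (kronecker_m4 r) * theta_term \<tau> (z + of_int l * \<tau> + of_int p) r) has_sum c * theta \<tau> z) UNIV"
    by simp
  then show ?thesis
    using theta_has_sum_pairs(1)[OF assms] has_sum_unique unfolding c_def by blast
qed

lemma jphi_elliptic:
  assumes "Im \<tau> > 0"
  shows "jphi \<tau> (z + of_int l * \<tau> + of_int p) =
    parity_sign (l + p) * ee (- (of_int (l ^ 2) * \<tau> / 2 + of_int l * z)) * jphi \<tau> z"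
  unfolding jphi_def theta_elliptic[OF assms] by simp

lemma jphi_minus:
  assumes "Im \<tau> > 0"
  shows "jphi \<tau> (- z) = - jphi \<tau> z"
proof -
  have "theta_prod \<tau> (- z) = theta_prod \<tau> z"
    by (simp add: theta_prod_def ee_minus mult.commute)
  moreover have "ee (- z / 2) - ee (- (- z) / 2) = - (ee (z / 2) - ee (- z / 2))" by simp
  ultimately show ?thesis unfolding jphi_eq_product[OF assms]
    by (simp add: left_diff_distrib diff_divide_distrib)
qed

lemma jphi_0 [simp]: "Im \<tau> > 0 \<Longrightarrow> jphi \<tau> 0 = 0"
  by (simp add: jphi_eq_product)

lemma jphi_T: "Im \<tau> > 0 \<Longrightarrow> jphi (\<tau> + 1) z = jphi \<tau> z"
  using ee_of_int[of 1] by (simp add: jphi_eq_product theta_prod_def ee_add del: ee_of_int)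

lemma eta_T: "eta (\<tau> + 1) ^ 24 = eta \<tau> ^ 24"
proof -
  have 1: "ee 1 = 1" using ee_of_int[of 1] by simp
  have "ee (x / 24) ^ 24 = ee x" for x by (simp flip: ee_power)
  then show ?thesis by (simp add: eta_eq power_mult_distrib ee_add 1)
qed

lemma jphi_holomorphic: "Im \<tau> > 0 \<Longrightarrow> jphi \<tau> holomorphic_on S"
  unfolding jphi_def by (intro holomorphic_intros holomorphic_HC_imp_entire holomorphic_HC_theta) (auto simp: eta_nonzero)

text \<open>The normalisation that singles out \<open>jphi\<close> among functions with the same
  quasi-periods, and the simplicity of its zeros. As the limit does not depend on \<tau>, comparing
  it before and after a modular substitution leaves no unknown multiplier.\<close>

lemma jphi_derivative_at_0:
  assumes "Im \<tau> > 0"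
  shows "((\<lambda>z. jphi \<tau> z / z) \<longlongrightarrow> 2 * of_real pi * \<i>) (at 0)"
proof -
  let ?q = "ee \<tau>"
  have n: "norm ?q < 1" using assms by (rule norm_ee_less_1)
  have "((\<lambda>z. ee (z / 2) - ee (- z / 2)) has_field_derivative 2 * of_real pi * \<i>) (at 0)"
    unfolding ee_def by (auto intro!: derivative_eq_intros)
  then have 1: "((\<lambda>z. (ee (z / 2) - ee (- z / 2)) / z) \<longlongrightarrow> 2 * of_real pi * \<i>) (at 0)"
    unfolding has_field_derivative_iff by simp
  have "(\<lambda>z. theta_prod \<tau> z) holomorphic_on UNIV"
    unfolding theta_prod_def
    by (intro holomorphic_intros holomorphic_on_compose_gen[OF _ holomorphic_qpoch[OF n], unfolded o_def]) auto
  then have "isCont (theta_prod \<tau>) 0"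
    using holomorphic_on_imp_continuous_on continuous_on_eq_continuous_at open_UNIV by blast
  then have 2: "(theta_prod \<tau> \<longlongrightarrow> qpoch ?q ?q ^ 2) (at 0)"
    by (simp add: isCont_def theta_prod_def power2_eq_square)
  have "((\<lambda>z. (ee (z / 2) - ee (- z / 2)) / z * theta_prod \<tau> z / qpoch ?q ?q ^ 2) \<longlongrightarrow>
     2 * of_real pi * \<i> * qpoch ?q ?q ^ 2 / qpoch ?q ?q ^ 2) (at 0)"
    by (intro tendsto_intros 1 2) (use qpoch_self_nonzero[OF n] in auto)
  then show ?thesis
    using qpoch_self_nonzero[OF n] by (simp add: jphi_eq_product[OF assms] mult.commute)
qed

text \<open>The quotient \<open>F / jphi\<close> is doubly periodic with removable singularities:
  \<open>jphi\<close> has only simple zeros, at lattice points, and at 0 both functions have the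
  same slope. By Liouville the quotient is constant, and the common slope makes it 1.\<close>

lemma jphi_unique:
  assumes \<tau>: "Im \<tau> > 0" and F: "F holomorphic_on UNIV"
    and per: "\<And>z l p. F (z + of_int l * \<tau> + of_int p) =
      parity_sign (l + p) * ee (- (of_int (l ^ 2) * \<tau> / 2 + of_int l * z)) * F z"
    and lim: "((\<lambda>z. F z / z) \<longlongrightarrow> 2 * of_real pi * \<i>) (at 0)"
  shows "F z = jphi \<tau> z"
proof -
  \<comment> \<open>The value 1 at zeros of \<open>jphi\<close> is the limit of the quotient at 0;
    periodicity carries it to the other lattice points.\<close>
  define H where "H z = (if jphi \<tau> z = 0 then 1 else F z / jphi \<tau> z)" for z
  have ps: "parity_sign m * ee w \<noteq> 0" for m w by (simp add: parity_sign_def)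
  have Hper: "H (z + of_int l * \<tau> + of_int p) = H z" for z l p
    unfolding H_def per jphi_elliptic[OF \<tau>] using ps by (simp add: field_simps)
  have jcont: "continuous_on UNIV (jphi \<tau>)"
    using jphi_holomorphic[OF \<tau>] holomorphic_on_imp_continuous_on by blast
  have open_nz: "open {z. jphi \<tau> z \<noteq> 0}"
    using open_Collect_neq[OF jcont continuous_on_const] .
  have "(\<lambda>z. F z / jphi \<tau> z) holomorphic_on {z. jphi \<tau> z \<noteq> 0}"
    by (intro holomorphic_intros jphi_holomorphic[OF \<tau>] holomorphic_on_subset[OF F]) auto
  then have hol_nz: "H holomorphic_on {z. jphi \<tau> z \<noteq> 0}"
    by (rule holomorphic_transform) (simp add: H_def)
  have "eventually (\<lambda>z. jphi \<tau> z / z \<noteq> 0) (at 0)"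
    using jphi_derivative_at_0[OF \<tau>] by (rule tendsto_imp_eventually_ne) simp
  then obtain r where r: "r > 0" "\<And>z. z \<noteq> 0 \<Longrightarrow> dist z 0 < r \<Longrightarrow> jphi \<tau> z \<noteq> 0"
    unfolding eventually_at by auto
  have Hlim: "(H \<longlongrightarrow> H 0) (at 0)"
  proof -
    have "((\<lambda>z. (F z / z) / (jphi \<tau> z / z)) \<longlongrightarrow> 2 * of_real pi * \<i> / (2 * of_real pi * \<i>)) (at 0)"
      by (intro tendsto_intros lim jphi_derivative_at_0[OF \<tau>]) simp
    then have "((\<lambda>z. (F z / z) / (jphi \<tau> z / z)) \<longlongrightarrow> H 0) (at 0)"
      using \<tau> by (simp add: H_def)
    moreover have "eventually (\<lambda>z. (F z / z) / (jphi \<tau> z / z) = H z) (at 0)"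
      unfolding eventually_at using r by (intro exI[of _ r]) (auto simp: H_def)
    ultimately show ?thesis by (rule Lim_transform_eventually)
  qed
  have "H holomorphic_on ball 0 r"
  proof (rule no_isolated_singularity'[of "{0}"])
    show "(H \<longlongrightarrow> H z) (at z within ball 0 r)" if "z \<in> {0}" for z
      using that Hlim tendsto_within_subset[of H _ 0 UNIV] by auto
    show "H holomorphic_on ball 0 r - {0}"
      by (rule holomorphic_on_subset[OF hol_nz]) (use r in auto)
  qed auto
  then have H0: "H field_differentiable (at 0)"
    using r(1) by (simp add: holomorphic_on_imp_differentiable_at)
  have "H field_differentiable (at z)" for z
  proof (cases "jphi \<tau> z = 0")
    case False
    then show ?thesis using holomorphic_on_imp_differentiable_at[OF hol_nz open_nz] by simp
  next
    case True
    obtain l p :: int where z: "z = of_int l * \<tau> + of_int p"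
      using jphi_eq_0_imp_lattice[OF \<tau> True] by blast
    have "H = H \<circ> (\<lambda>w. w - z)"
    proof
      fix w show "H w = (H \<circ> (\<lambda>w. w - z)) w"
        using Hper[of "w - z" l p] by (simp add: z)
    qed
    moreover have "(H \<circ> (\<lambda>w. w - z)) field_differentiable (at z)"
      using H0 by (intro field_differentiable_compose) (auto intro!: derivative_intros)
    ultimately show ?thesis by simp
  qed
  then have Hhol: "H holomorphic_on UNIV"
    by (simp add: holomorphic_on_def field_differentiable_at_within)
  \<comment> \<open>By periodicity all values are taken on a compact period parallelogram, so
    \<open>H\<close> is bounded.\<close>
  have "range H \<subseteq> H ` ((\<lambda>(s, t). of_real s + of_real t * \<tau>) ` ({0..1} \<times> {0..1}))"
  proof clarify
    fix z
    define t where "t = Im z / Im \<tau>"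
    define s where "s = Re z - t * Re \<tau>"
    have z: "z = of_real s + of_real t * \<tau>"
      using \<tau> by (simp add: complex_eq_iff s_def t_def)
    have "z = (of_real (frac s) + of_real (frac t) * \<tau>) + of_int \<lfloor>t\<rfloor> * \<tau> + of_int \<lfloor>s\<rfloor>"
      unfolding z frac_def by (simp add: algebra_simps)
    then have "H z = H (of_real (frac s) + of_real (frac t) * \<tau>)"
      using Hper by metis
    moreover have "(frac s, frac t) \<in> {0..1} \<times> {0..1}"
      by (auto simp: less_imp_le[OF frac_lt_1])
    ultimately show "H z \<in> H ` ((\<lambda>(s, t). of_real s + of_real t * \<tau>) ` ({0..1} \<times> {0..1}))"
      by force
  qed
  moreover have "compact (H ` ((\<lambda>(s, t). of_real s + of_real t * \<tau>) ` ({0..1} \<times> {0..1})))"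
  proof (intro compact_continuous_image)
    show "continuous_on ((\<lambda>(s, t). of_real s + of_real t * \<tau>) ` ({0..1} \<times> {0..1})) H"
      using Hhol holomorphic_on_imp_continuous_on continuous_on_subset by blast
    show "compact ({0..1::real} \<times> {0..1::real})" by (intro compact_Times compact_Icc)
  qed (auto simp: case_prod_unfold intro!: continuous_intros)
  ultimately have "bounded (range H)"
    using compact_imp_bounded bounded_subset by blast
  then obtain c where c: "\<And>z. H z = c"
    using Liouville_theorem[OF Hhol] by (auto simp: constant_on_def)
  then have H1: "H z = 1" for z using c[of 0] \<tau> by (simp add: H_def)
  then have eq: "F z = jphi \<tau> z" if "jphi \<tau> z \<noteq> 0" for z
    using that H1[of z] by (simp add: H_def)
  show ?thesis
  proof (cases "jphi \<tau> z = 0")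
    case True
    obtain l p :: int where z: "z = 0 + of_int l * \<tau> + of_int p"
      using jphi_eq_0_imp_lattice[OF \<tau> True] by auto
    \<comment> \<open>At a zero of \<open>jphi\<close> the quotient says nothing about
      \<open>F\<close>. That \<open>F\<close> vanishes at 0 follows from the slope and continuity,
      and at the other lattice points from the quasi-periods.\<close>
    have "((\<lambda>z. F z / z * z) \<longlongrightarrow> 2 * of_real pi * \<i> * 0) (at 0)"
      by (intro tendsto_intros lim)
    moreover have "eventually (\<lambda>z. F z / z * z = F z) (at 0)"
      by (simp add: eventually_at_filter)
    ultimately have "(F \<longlongrightarrow> 2 * of_real pi * \<i> * 0) (at 0)"
      by (rule Lim_transform_eventually)
    moreover have "(F \<longlongrightarrow> F 0) (at 0)"
      using F holomorphic_on_imp_continuous_on continuous_on_eq_continuous_at isCont_def open_UNIV by blast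
    ultimately have "F 0 = 0" using LIM_unique by fastforce
    then show ?thesis using True unfolding z per by simp
  qed (use eq in auto)
qed

lemma Im_S: "Im \<tau> > 0 \<Longrightarrow> Im (- 1 / \<tau>) > 0"
  by (auto simp: Im_divide intro!: divide_pos_pos add_nonneg_pos)

text \<open>The inverted function, multiplied by the inverse Gaussian factor and by \<tau>,
  satisfies the hypotheses of \<open>jphi_unique\<close>. The factor \<tau> restores the slope at 0
  and is the source of the weight -1.\<close>

lemma jphi_S:
  assumes \<tau>: "Im \<tau> > 0"
  shows "jphi (- 1 / \<tau>) (z / \<tau>) = ee (z ^ 2 / (2 * \<tau>)) / \<tau> * jphi \<tau> z"
proof -
  have \<tau>0: "\<tau> \<noteq> 0" using \<tau> by auto
  define F where "F z = \<tau> * ee (- (z ^ 2 / (2 * \<tau>))) * jphi (- 1 / \<tau>) (z / \<tau>)" for z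
  have "F z = jphi \<tau> z"
  proof (rule jphi_unique[OF \<tau>])
    show "F holomorphic_on UNIV"
      unfolding F_def
      by (intro holomorphic_intros holomorphic_on_compose_gen[OF _ jphi_holomorphic[OF Im_S[OF \<tau>], of UNIV], unfolded o_def])
        (use \<tau>0 in auto)
    show "F (z + of_int l * \<tau> + of_int p) =
      parity_sign (l + p) * ee (- (of_int (l ^ 2) * \<tau> / 2 + of_int l * z)) * F z" for z l p
    proof -
      \<comment> \<open>Division by \<tau> exchanges the periods: \<open>(l, p)\<close> becomes
        \<open>(- p, l)\<close> for the lattice of \<open>- 1 / \<tau>\<close>.\<close>
      have "(z + of_int l * \<tau> + of_int p) / \<tau> = z / \<tau> + of_int (- p) * (- 1 / \<tau>) + of_int l"
        using \<tau>0 by (simp add: field_simps)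
      then have "F (z + of_int l * \<tau> + of_int p) = \<tau> * ee (- ((z + of_int l * \<tau> + of_int p) ^ 2 / (2 * \<tau>))) *
          (parity_sign (- p + l) * ee (- (of_int ((- p) ^ 2) * (- 1 / \<tau>) / 2 + of_int (- p) * (z / \<tau>))) * jphi (- 1 / \<tau>) (z / \<tau>))"
        unfolding F_def by (simp only: jphi_elliptic[OF Im_S[OF \<tau>]])
      also have "parity_sign (- p + l) = parity_sign (l + p)" by (simp add: parity_sign_def)
      finally have "F (z + of_int l * \<tau> + of_int p) = \<tau> * parity_sign (l + p) *
         (ee (- ((z + of_int l * \<tau> + of_int p) ^ 2 / (2 * \<tau>))) * ee (- (of_int ((- p) ^ 2) * (- 1 / \<tau>) / 2 + of_int (- p) * (z / \<tau>)))) *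
         jphi (- 1 / \<tau>) (z / \<tau>)" by (simp only: mult_ac)
      also have "ee (- ((z + of_int l * \<tau> + of_int p) ^ 2 / (2 * \<tau>))) * ee (- (of_int ((- p) ^ 2) * (- 1 / \<tau>) / 2 + of_int (- p) * (z / \<tau>))) =
         ee (- (of_int (l ^ 2) * \<tau> / 2 + of_int l * z)) * ee (- (z ^ 2 / (2 * \<tau>))) * ee (of_int (- (l * p)))"
        unfolding ee_add[symmetric]
        by (rule arg_cong[of _ _ ee]) (use \<tau>0 in \<open>simp add: field_simps power2_eq_square\<close>)
      also have "ee (of_int (- (l * p))) = 1" by (rule ee_of_int)
      finally show ?thesis by (simp only: F_def mult_ac mult_1_right mult_1_left)
    qed
    have "filterlim (\<lambda>z. z / \<tau>) (at 0) (at 0)"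
      unfolding filterlim_at using \<tau>0 by (auto simp: eventually_at intro!: tendsto_eq_intros exI[of _ 1])
    then have "((\<lambda>z. jphi (- 1 / \<tau>) (z / \<tau>) / (z / \<tau>)) \<longlongrightarrow> 2 * of_real pi * \<i>) (at 0)"
      by (rule filterlim_compose[OF jphi_derivative_at_0[OF Im_S[OF \<tau>]]])
    moreover have "((\<lambda>z. ee (- (z ^ 2 / (2 * \<tau>)))) \<longlongrightarrow> 1) (at 0)"
      unfolding ee_def using \<tau>0 by (auto intro!: tendsto_eq_intros)
    ultimately have "((\<lambda>z. ee (- (z ^ 2 / (2 * \<tau>))) * (jphi (- 1 / \<tau>) (z / \<tau>) / (z / \<tau>))) \<longlongrightarrow> 1 * (2 * of_real pi * \<i>)) (at 0)"
      by (intro tendsto_mult)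
    then show "((\<lambda>z. F z / z) \<longlongrightarrow> 2 * of_real pi * \<i>) (at 0)"
      by (simp add: F_def field_simps)
  qed
  then show ?thesis using \<tau>0 by (simp add: F_def ee_minus field_simps)
qed

section \<open>Values at the 2-torsion points and the modularity of eta^24\<close>

lemma qpoch_mult_minus:
  assumes "norm q < 1"
  shows "qpoch x q * qpoch (- x) q = qpoch (x ^ 2) (q ^ 2)"
proof -
  have "qpoch x q * qpoch (- x) q = (\<Prod>n. (1 - x * q ^ n) * (1 - (- x) * q ^ n))"
    unfolding qpoch_def by (intro prodinf_mult convergent_qpoch assms)
  also have "\<dots> = qpoch (x ^ 2) (q ^ 2)"
    unfolding qpoch_def by (rule prodinf_cong) (simp add: power2_eq_square power_mult_distrib algebra_simps)
  finally show ?thesis .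
qed

lemma qpoch_even_odd:
  assumes "norm q < 1"
  shows "qpoch x q = qpoch x (q ^ 2) * qpoch (x * q) (q ^ 2)"
proof (rule LIMSEQ_unique)
  have q2: "norm (q ^ 2) < 1" using assms by (simp add: norm_power power_less_one_iff)
  have "filterlim (\<lambda>N. 2 * N) sequentially sequentially" by (auto intro!: filterlim_subseq strict_monoI)
  then show "(\<lambda>N. qpoch_fin x q (2 * N)) \<longlonglongrightarrow> qpoch x q"
    by (rule filterlim_compose[OF qpoch_fin_tendsto[OF assms]])
  have "qpoch_fin x q (2 * N) = qpoch_fin x (q ^ 2) N * qpoch_fin (x * q) (q ^ 2) N" for N
    by (induction N) (auto simp: qpoch_fin_def power_mult[symmetric] mult_ac)
  then show "(\<lambda>N. qpoch_fin x q (2 * N)) \<longlonglongrightarrow> qpoch x (q ^ 2) * qpoch (x * q) (q ^ 2)"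
    using tendsto_mult[OF qpoch_fin_tendsto[OF q2] qpoch_fin_tendsto[OF q2]] by simp
qed

text \<open>Euler's identity that the product of all (1 + q^n)(1 - q^(2n-1)) is 1, with q = s^2 and
  each second factor split over s; for the Weber functions it reads f f1 f2 = sqrt 2.\<close>

lemma weber_product:
  assumes "norm s < 1"
  shows "qpoch (- (s^2)) (s^2) * (qpoch s (s^2) * qpoch (- s) (s^2)) = 1"
proof -
  define q where "q = s^2"
  have q: "norm q < 1" unfolding q_def using assms by (simp add: norm_power power_less_one_iff)
  have q2: "norm (q^2) < 1" using q by (simp add: norm_power power_less_one_iff)
  have "qpoch q q * (qpoch (- q) q * qpoch q (q^2)) = (qpoch q q * qpoch (- q) q) * qpoch q (q^2)"
    by simp
  also have "\<dots> = qpoch (q^2) (q^2) * qpoch q (q^2)"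
    using qpoch_mult_minus[OF q, of q] by simp
  also have "\<dots> = qpoch q q"
    using qpoch_even_odd[OF q, of q] by (simp add: power2_eq_square mult.commute)
  finally have "qpoch (- q) q * qpoch q (q^2) = 1"
    using qpoch_self_nonzero[OF q] by simp
  moreover have "qpoch s q * qpoch (- s) q = qpoch q (q^2)"
    using qpoch_mult_minus[OF q, of s] by (simp add: q_def)
  ultimately show ?thesis by (simp add: q_def)
qed

text \<open>One value for each nonzero 2-torsion point. Inversion permutes these points up to
  translations and signs, so the product has a transformation law of its own.\<close>

definition torsion_prod :: "complex \<Rightarrow> complex" where
  "torsion_prod \<tau> = jphi \<tau> (1 / 2) * jphi \<tau> (\<tau> / 2) * jphi \<tau> ((\<tau> + 1) / 2)"

text \<open>The infinite products in the three numerators form the square of the Weber product and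
  thus cancel, leaving Euler's product to the power -6 and elementary factors.\<close>

lemma torsion_prod_eta:
  assumes "Im \<tau> > 0"
  shows "torsion_prod \<tau> * eta \<tau> ^ 6 = 2 * ee (- \<tau> / 4)"
proof -
  define s where "s = ee (\<tau> / 2)"
  define f where "f = ee (\<tau> / 4)"
  have f0: "f \<noteq> 0" by (simp add: f_def)
  have sf: "s = f^2" unfolding s_def f_def by (simp flip: ee_power)
  have q: "ee \<tau> = s^2" unfolding s_def by (simp flip: ee_power)
  have s: "norm s < 1" unfolding s_def norm_ee using assms by simp
  have s0: "s \<noteq> 0" by (simp add: s_def)
  have q1: "norm (s^2) < 1" using s by (simp add: norm_power power_less_one_iff)
  define E where "E = qpoch (s^2) (s^2)"
  have E0: "E \<noteq> 0" unfolding E_def by (rule qpoch_self_nonzero[OF q1])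
  note prod = jphi_eq_product[OF assms] theta_prod_def q E_def[symmetric]
  have 1: "jphi \<tau> (1 / 2) = 2 * \<i> * qpoch (- (s^2)) (s^2) ^ 2 / E ^ 2"
    unfolding prod ee_half ee_minus[of "1/4"] by (simp add: ee_half ee_quarter ee_minus power2_eq_square)
  have 2: "jphi \<tau> (\<tau> / 2) = - (qpoch s (s^2) ^ 2 / f / E ^ 2)"
  proof -
    have "jphi \<tau> (\<tau> / 2) = (f - 1 / f) * (qpoch (s^2 * s) (s^2) * qpoch s (s^2)) / E ^ 2"
      unfolding prod s_def[symmetric] using s0 by (simp add: ee_minus f_def power2_eq_square)
    \<comment> \<open>The linear factor \<open>1 - s\<close> is the missing first factor of
      \<open>qpoch s (s^2)\<close>.\<close>
    also have "f - 1 / f = - (1 - s) / f" using f0 by (simp add: sf field_simps power2_eq_square)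
    finally have "jphi \<tau> (\<tau> / 2) = (- (1 - s) / f) * (qpoch (s^2 * s) (s^2) * qpoch s (s^2)) / E ^ 2" .
    moreover have "(- t / f) * (Y * X) / e = - (t * Y * X / f / e)" for t X Y e :: complex by simp
    moreover have "(1 - s) * qpoch (s^2 * s) (s^2) = qpoch s (s^2)"
      using qpoch_split[OF q1, of s, symmetric] by (simp only: mult.commute[of "s^2" s])
    ultimately show ?thesis by (simp only: power2_eq_square[of "qpoch s (s^2)"])
  qed
  have 3: "jphi \<tau> ((\<tau> + 1) / 2) = \<i> * qpoch (- s) (s^2) ^ 2 / f / E ^ 2"
  proof -
    have "ee ((\<tau> + 1) / 2) = - s" by (simp add: add_divide_distrib ee_add ee_half s_def)
    moreover have "ee ((\<tau> + 1) / 2 / 2) = \<i> * f" by (simp add: add_divide_distrib ee_add ee_quarter f_def)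
    moreover have "ee (- ((\<tau> + 1) / 2) / 2) = - (\<i> / f)"
    proof -
      have "ee (- ((\<tau> + 1) / 2) / 2) = 1 / (\<i> * f)"
        using calculation(2) ee_minus[of "(\<tau> + 1) / 2 / 2"] by simp
      also have "\<dots> = - (\<i> / f)" using f0 by (simp add: field_simps)
      finally show ?thesis .
    qed
    ultimately have "jphi \<tau> ((\<tau> + 1) / 2) = (\<i> * f + \<i> / f) * (qpoch (s^2 * (- s)) (s^2) * qpoch (s^2 / (- s)) (s^2)) / E ^ 2"
      unfolding prod by simp
    also have "s^2 / (- s) = - s" using s0 by (simp add: power2_eq_square)
    also have "\<i> * f + \<i> / f = \<i> * (1 + s) / f" using f0 by (simp add: sf field_simps power2_eq_square)
    finally have "jphi \<tau> ((\<tau> + 1) / 2) =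
        (\<i> * (1 + s) / f) * (qpoch (s^2 * (- s)) (s^2) * qpoch (- s) (s^2)) / E ^ 2" .
    moreover have "(\<i> * t / f) * (Y * X) / e = \<i> * (t * Y * X) / f / e" for t X Y e :: complex by simp
    moreover have "(1 + s) * qpoch (s^2 * (- s)) (s^2) = qpoch (- s) (s^2)"
      using qpoch_split[OF q1, of "- s", symmetric] by (simp only: mult.commute[of "s^2" "- s"] diff_minus_eq_add)
    ultimately show ?thesis by (simp only: power2_eq_square[of "qpoch (- s) (s^2)"])
  qed
  have "torsion_prod \<tau> = 2 * (qpoch (- (s^2)) (s^2) * (qpoch s (s^2) * qpoch (- s) (s^2))) ^ 2 / f^2 / E ^ 6"
    unfolding torsion_prod_def 1 2 3 by (simp add: power_mult_distrib field_simps eval_nat_numeral)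
  then have "torsion_prod \<tau> = 2 / f^2 / E ^ 6"
    unfolding weber_product[OF s] by simp
  moreover have "eta \<tau> ^ 6 = f * E ^ 6"
  proof -
    have "ee (\<tau> / 24) ^ 6 = f" unfolding f_def by (simp flip: ee_power)
    then show ?thesis unfolding eta_eq q E_def by (simp add: power_mult_distrib)
  qed
  moreover have "ee (- \<tau> / 4) = 1 / f" using ee_minus[of "\<tau> / 4"] by (simp add: f_def)
  ultimately have "torsion_prod \<tau> * eta \<tau> ^ 6 = 2 / f^2 / E ^ 6 * (f * E ^ 6)" "ee (- \<tau> / 4) = 1 / f"
    by (simp_all only:)
  moreover have "2 / f^2 / E ^ 6 * (f * E ^ 6) = 2 * (1 / f)"
    using f0 E0 by (simp add: power2_eq_square)
  ultimately show ?thesis by (simp only:)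
qed

text \<open>The points 1/2 and \<tau>/2 are interchanged up to sign. The third one leads to (\<tau>
  - 1)/2, which is the third point again up to a translation by -1, at the cost of a sign.\<close>

lemma torsion_prod_S:
  assumes \<tau>: "Im \<tau> > 0"
  shows "torsion_prod (- 1 / \<tau>) = - \<i> * ee (\<tau> / 4) * ee (1 / (4 * \<tau>)) / \<tau> ^ 3 * torsion_prod \<tau>"
proof -
  have \<tau>0: "\<tau> \<noteq> 0" using \<tau> by auto
  have 1: "jphi (- 1 / \<tau>) (1 / 2) = ee (\<tau> / 8) / \<tau> * jphi \<tau> (\<tau> / 2)"
    using jphi_S[OF \<tau>, of "\<tau> / 2"] \<tau>0 by (simp add: power2_eq_square)
  have 2: "jphi (- 1 / \<tau>) (- 1 / \<tau> / 2) = - (ee (1 / (8 * \<tau>)) / \<tau> * jphi \<tau> (1 / 2))"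
    using jphi_S[OF \<tau>, of "- (1 / 2)"] \<tau>0 jphi_minus[OF \<tau>, of "1 / 2"] by (simp add: power2_eq_square mult.commute)
  have "jphi (- 1 / \<tau>) ((- 1 / \<tau> + 1) / 2) = ee (((\<tau> - 1) / 2) ^ 2 / (2 * \<tau>)) / \<tau> * jphi \<tau> ((\<tau> - 1) / 2)"
  proof -
    have "(- 1 / \<tau> + 1) / 2 = ((\<tau> - 1) / 2) / \<tau>" using \<tau>0 by (simp add: field_simps)
    then show ?thesis using jphi_S[OF \<tau>, of "(\<tau> - 1) / 2"] by (simp only:)
  qed
  also have "jphi \<tau> ((\<tau> - 1) / 2) = - jphi \<tau> ((\<tau> + 1) / 2)"
  proof -
    have "(\<tau> - 1) / 2 = (\<tau> + 1) / 2 + of_int 0 * \<tau> + of_int (- 1)" by (simp add: field_simps)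
    then have "jphi \<tau> ((\<tau> - 1) / 2) = jphi \<tau> ((\<tau> + 1) / 2 + of_int 0 * \<tau> + of_int (- 1))" by (rule arg_cong)
    also have "\<dots> = - jphi \<tau> ((\<tau> + 1) / 2)"
      unfolding jphi_elliptic[OF \<tau>] by (simp add: parity_sign_def)
    finally show ?thesis .
  qed
  also have "ee (((\<tau> - 1) / 2) ^ 2 / (2 * \<tau>)) = ee (\<tau> / 8) * ee (1 / (8 * \<tau>)) * - \<i>"
  proof -
    have "((\<tau> - 1) / 2) ^ 2 / (2 * \<tau>) = \<tau> / 8 + 1 / (8 * \<tau>) + - (1 / 4)"
      using \<tau>0 by (simp add: field_simps power2_eq_square)
    then show ?thesis by (simp only: ee_add ee_minus ee_quarter) simp
  qed
  finally have 3: "jphi (- 1 / \<tau>) ((- 1 / \<tau> + 1) / 2) = ee (\<tau> / 8) * ee (1 / (8 * \<tau>)) * \<i> / \<tau> * jphi \<tau> ((\<tau> + 1) / 2)"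
    by simp
  have 4: "ee (\<tau> / 4) = ee (\<tau> / 8) * ee (\<tau> / 8)" "ee (1 / (4 * \<tau>)) = ee (1 / (8 * \<tau>)) * ee (1 / (8 * \<tau>))"
    unfolding ee_add[symmetric] using \<tau>0 by (simp_all add: field_simps)
  show ?thesis unfolding torsion_prod_def 1 2 3 4 using \<tau>0 by (simp add: field_simps power3_eq_cube)
qed

text \<open>\<open>torsion_prod_eta\<close> at \<tau> and at \<open>- 1 / \<tau>\<close>, linked by
  \<open>torsion_prod_S\<close>, determines the sixth power: it acquires
  \<open>\<i> * \<tau> ^ 3\<close>. Taking the fourth power removes the root of unity.\<close>

lemma eta_S: 
  assumes \<tau>: "Im \<tau> > 0"
  shows "eta (- 1 / \<tau>) ^ 24 = \<tau> ^ 12 * eta \<tau> ^ 24"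
proof -
  have \<tau>0: "\<tau> \<noteq> 0" using \<tau> by auto
  have e: "ee (- (- 1 / \<tau>) / 4) = ee (1 / (4 * \<tau>))" by (simp add: mult.commute)
  have "2 * ee (1 / (4 * \<tau>)) = - \<i> * ee (\<tau> / 4) * ee (1 / (4 * \<tau>)) / \<tau> ^ 3 * torsion_prod \<tau> * eta (- 1 / \<tau>) ^ 6"
    using torsion_prod_eta[OF Im_S[OF \<tau>]] unfolding torsion_prod_S[OF \<tau>] e by simp
  then have "ee (1 / (4 * \<tau>)) * (2 * \<tau> ^ 3) =
      ee (1 / (4 * \<tau>)) * (- \<i> * ee (\<tau> / 4) * torsion_prod \<tau> * eta (- 1 / \<tau>) ^ 6)"
    using \<tau>0 by (simp add: field_simps)
  then have "2 * \<tau> ^ 3 = - \<i> * ee (\<tau> / 4) * torsion_prod \<tau> * eta (- 1 / \<tau>) ^ 6"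
    unfolding mult_cancel_left using ee_nonzero by blast
  then have "2 * \<tau> ^ 3 * eta \<tau> ^ 6 = - \<i> * ee (\<tau> / 4) * (torsion_prod \<tau> * eta \<tau> ^ 6) * eta (- 1 / \<tau>) ^ 6"
    by simp
  also have "\<dots> = - 2 * \<i> * eta (- 1 / \<tau>) ^ 6"
    unfolding torsion_prod_eta[OF \<tau>] using ee_minus[of "\<tau> / 4"] by simp
  finally have "eta (- 1 / \<tau>) ^ 6 = \<i> * \<tau> ^ 3 * eta \<tau> ^ 6"
    by (simp add: field_simps complex_eq_iff)
  then have "(eta (- 1 / \<tau>) ^ 6) ^ 4 = \<i> ^ 4 * (\<tau> ^ 3) ^ 4 * (eta \<tau> ^ 6) ^ 4"
    by (simp add: power_mult_distrib)
  then show ?thesis by (simp flip: power_mult)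
qed

section \<open>Invariance under the full Jacobi group\<close>

text \<open>
  Induction on \<open>|c|\<close>: a translation reduces \<open>d\<close> modulo \<open>c\<close>, then the inversion moves the remainder to the
  place of \<open>c\<close>.
\<close>

lemma jacobi_invariance_from_generators:
  fixes F :: "complex \<Rightarrow> complex \<Rightarrow> complex" and m :: complex and w :: int
  assumes T: "\<And>\<tau> z. Im \<tau> > 0 \<Longrightarrow> F (\<tau> + 1) z = F \<tau> z"
    and S: "\<And>\<tau> z. Im \<tau> > 0 \<Longrightarrow> F (- 1 / \<tau>) (z / \<tau>) = \<tau> powi w * ee (m * z ^ 2 / \<tau>) * F \<tau> z"
    and N: "\<And>\<tau> z. Im \<tau> > 0 \<Longrightarrow> F \<tau> (- z) = (- 1) powi w * F \<tau> z"
    and det: "a * d - b * c = (1 :: int)" and \<tau>: "Im \<tau> > 0"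
  shows "F ((of_int a * \<tau> + of_int b) / (of_int c * \<tau> + of_int d)) (z / (of_int c * \<tau> + of_int d)) =
    (of_int c * \<tau> + of_int d) powi w * ee (m * of_int c * z ^ 2 / (of_int c * \<tau> + of_int d)) * F \<tau> z"
proof -
  have Tn: "F (\<tau> + of_nat k) z = F \<tau> z" if "Im \<tau> > 0" for k \<tau> z
  proof (induction k)
    case (Suc k)
    have "F (\<tau> + of_nat (Suc k)) z = F ((\<tau> + of_nat k) + 1) z" by (simp add: add_ac)
    also have "\<dots> = F \<tau> z" using T[of "\<tau> + of_nat k"] that Suc by simp
    finally show ?case .
  qed simp
  have Tk: "F (\<tau> + of_int k) z = F \<tau> z" if "Im \<tau> > 0" for k \<tau> z
  proof (cases k rule: int_cases2)
    case (nonneg j)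
    then show ?thesis using Tn[OF that] by simp
  next
    case (nonpos j)
    then show ?thesis using Tn[of "\<tau> + of_int k" j z] that by simp
  qed
  show ?thesis using det \<tau>
  proof (induction "nat \<bar>c\<bar>" arbitrary: a b c d \<tau> z rule: less_induct)
    case less
    note \<tau> = \<open>Im \<tau> > 0\<close>
    have \<tau>0: "\<tau> \<noteq> 0" using \<tau> by auto
    show ?case
    proof (cases "c = 0")
      case True
      then have "a = 1 \<and> d = 1 \<or> a = - 1 \<and> d = - 1"
        using less.prems(1) zmult_eq_1_iff[of a d] by simp
      then show ?thesis
      proof
        assume "a = 1 \<and> d = 1"
        then show ?thesis using True Tk[OF \<tau>] by simp
      next
        \<comment> \<open>The matrix is minus a translation; -I fixes \<tau> and negates z, which is
          what \<open>N\<close> describes.\<close>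
        assume "a = - 1 \<and> d = - 1"
        moreover have "- (of_int b - \<tau>) = \<tau> + of_int (- b)" by simp
        ultimately show ?thesis using True Tk[OF \<tau>, of "- b" "- z"] N[OF \<tau>, of z] by simp
      qed
    next
      case False
      \<comment> \<open>With \<open>u = \<tau> + k\<close>, the matrix with rows
        \<open>(b', - a)\<close> and \<open>(r, - c)\<close> applied to \<open>- 1 / u\<close> gives
        the original fraction. The composite is minus the original matrix, whence \<open>- z\<close>
        and the factor (-1)^w below.\<close>
      define k r b' where "k = d div c" and "r = d mod c" and "b' = b - k * a"
      have d: "d = k * c + r" by (simp add: k_def r_def)
      have r: "nat \<bar>r\<bar> < nat \<bar>c\<bar>" using False abs_mod_less[of c d] by (simp add: r_def)
      have det': "b' * (- c) - (- a) * r = 1"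
        using less.prems(1) by (simp add: b'_def d algebra_simps)
      define u where "u = \<tau> + of_int k"
      have "Im u > 0" using \<tau> by (simp add: u_def)
      then have u: "Im u > 0" "u \<noteq> 0" by auto
      define j where "j = of_int c * u + of_int r"
      have j: "j = of_int c * \<tau> + of_int d" by (simp add: j_def u_def d algebra_simps)
      have j0: "j \<noteq> 0"
      proof
        assume "j = 0"
        then have "Im j = 0" by simp
        then show False using False u by (simp add: j_def)
      qed
      have num: "of_int a * \<tau> + of_int b = of_int a * u + of_int b'"
        by (simp add: u_def b'_def algebra_simps)
      have den: "of_int r * (- 1 / u) + of_int (- c) = - (j / u)"
        using u by (simp add: j_def field_simps)
      have frac: "(of_int b' * (- 1 / u) + of_int (- a)) / - (j / u) = (of_int a * u + of_int b') / j"
        using u j0 by (simp add: field_simps)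
      have arg: "(- z / u) / - (j / u) = z / j"
        using u j0 by (simp add: field_simps)
      have "F ((of_int b' * (- 1 / u) + of_int (- a)) / (of_int r * (- 1 / u) + of_int (- c)))
              ((- z / u) / (of_int r * (- 1 / u) + of_int (- c))) =
            (of_int r * (- 1 / u) + of_int (- c)) powi w *
            ee (m * of_int r * (- z / u) ^ 2 / (of_int r * (- 1 / u) + of_int (- c))) * F (- 1 / u) (- z / u)"
        by (rule less.hyps[OF r det' Im_S[OF u(1)]])
      then have "F ((of_int a * u + of_int b') / j) (z / j) =
          (- (j / u)) powi w * ee (m * of_int r * (- z / u) ^ 2 / - (j / u)) * F (- 1 / u) (- z / u)"
        unfolding den frac arg .
      also have "F (- 1 / u) (- z / u) = u powi w * ee (m * (- z) ^ 2 / u) * ((- 1) powi w * F u z)"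
        using S[OF u(1), of "- z"] N[OF u(1), of z] by simp
      also have "(- (j / u)) powi w * ee (m * of_int r * (- z / u) ^ 2 / - (j / u)) *
          (u powi w * ee (m * (- z) ^ 2 / u) * ((- 1) powi w * F u z)) =
          ((- (j / u)) powi w * u powi w * (- 1) powi w) *
          ee (m * of_int r * (- z / u) ^ 2 / - (j / u) + m * (- z) ^ 2 / u) * F u z"
        by (simp only: ee_add mult_ac)
      also have "(- (j / u)) powi w * u powi w * (- 1) powi w = j powi w"
        using u by (simp flip: power_int_mult_distrib)
      also have "m * of_int r * (- z / u) ^ 2 / - (j / u) + m * (- z) ^ 2 / u = m * of_int c * z ^ 2 / j"
      proof -
        have "m * of_int r * (- z / u) ^ 2 / - (j / u) + m * (- z) ^ 2 / u = m * z ^ 2 * (j - of_int r) / (u * j)"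
          using u j0 by (simp add: field_simps power2_eq_square)
        also have "\<dots> = m * of_int c * z ^ 2 / j"
          using u by (simp add: j_def)
        finally show ?thesis .
      qed
      also have "F u z = F \<tau> z" unfolding u_def by (rule Tk[OF \<tau>])
      finally show ?thesis unfolding num j .
    qed
  qed
qed

section \<open>Theta blocks as products over lists\<close>

definition block :: "int \<Rightarrow> int list \<Rightarrow> complex \<Rightarrow> complex \<Rightarrow> complex" where
  "block s bs \<tau> z = eta \<tau> powi s * (\<Prod>b\<leftarrow>bs. theta_mult b \<tau> z)"

text \<open>Twice the index, kept as an integer because the index may be half-integral.\<close>

definition square_sum :: "int list \<Rightarrow> int" where
  "square_sum bs = (\<Sum>b\<leftarrow>bs. b ^ 2)"

definition jphi_list :: "int list \<Rightarrow> complex \<Rightarrow> complex \<Rightarrow> complex" where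
  "jphi_list bs \<tau> z = (\<Prod>b\<leftarrow>bs. jphi \<tau> (of_int b * z))"

lemma jphi_list_simps [simp]:
  "jphi_list [] \<tau> z = 1" "jphi_list (b # bs) \<tau> z = jphi \<tau> (of_int b * z) * jphi_list bs \<tau> z"
  by (simp_all add: jphi_list_def)

lemma square_sum_simps [simp]: "square_sum [] = 0" "square_sum (b # bs) = b ^ 2 + square_sum bs"
  by (simp_all add: square_sum_def)

lemma prod_list_theta_mult:
  "Im \<tau> > 0 \<Longrightarrow> (\<Prod>b\<leftarrow>bs. theta_mult b \<tau> z) = eta \<tau> powi (3 * int (length bs)) * jphi_list bs \<tau> z"
proof (induction bs)
  case (Cons b bs)
  have "eta \<tau> powi (3 * int (length (b # bs))) = eta \<tau> ^ 3 * eta \<tau> powi (3 * int (length bs))"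
    using eta_nonzero[OF Cons.prems] by (simp add: distrib_left power_int_add)
  then show ?case using Cons by (simp add: theta_mult_def theta_eq_jphi)
qed simp

lemma block_eq_jphi_list:
  "Im \<tau> > 0 \<Longrightarrow> block (s - 3 * int (length bs)) bs \<tau> z = eta \<tau> powi s * jphi_list bs \<tau> z"
  using eta_nonzero[of \<tau>] by (simp add: block_def prod_list_theta_mult power_int_diff)

lemma jphi_list_S:
  assumes "Im \<tau> > 0"
  shows "jphi_list bs (- 1 / \<tau>) (z / \<tau>) =
    ee (of_int (square_sum bs) * z ^ 2 / (2 * \<tau>)) / \<tau> ^ length bs * jphi_list bs \<tau> z"
proof (induction bs)
  case (Cons b bs)
  have "jphi (- 1 / \<tau>) (of_int b * (z / \<tau>)) = ee (of_int (b ^ 2) * z ^ 2 / (2 * \<tau>)) / \<tau> * jphi \<tau> (of_int b * z)"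
    using jphi_S[OF assms, of "of_int b * z"] by (simp add: power_mult_distrib)
  moreover have "ee (of_int (square_sum (b # bs)) * z ^ 2 / (2 * \<tau>)) =
      ee (of_int (b ^ 2) * z ^ 2 / (2 * \<tau>)) * ee (of_int (square_sum bs) * z ^ 2 / (2 * \<tau>))"
    by (simp add: distrib_right add_divide_distrib flip: ee_add)
  ultimately show ?case using Cons by simp
qed simp

lemma jphi_list_minus: "Im \<tau> > 0 \<Longrightarrow> jphi_list bs \<tau> (- z) = (- 1) ^ length bs * jphi_list bs \<tau> z"
  by (induction bs) (auto simp: jphi_minus)

lemma jphi_list_T: "Im \<tau> > 0 \<Longrightarrow> jphi_list bs (\<tau> + 1) z = jphi_list bs \<tau> z"
  by (induction bs) (auto simp: jphi_T)

lemma parity_sign_add: "parity_sign (m + n) = parity_sign m * parity_sign n"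
  by (simp add: parity_sign_def)

text \<open>Each factor contributes the sign with exponent b (l + p), and b and b^2 have the same
  parity; so the sign depends on the square sum alone and disappears when that is even.\<close>

lemma jphi_list_elliptic:
  assumes "Im \<tau> > 0"
  shows "jphi_list bs \<tau> (z + of_int l * \<tau> + of_int p) =
    parity_sign ((l + p) * square_sum bs) * ee (- of_int (square_sum bs) * (of_int (l ^ 2) * \<tau> / 2 + of_int l * z)) *
    jphi_list bs \<tau> z"
proof (induction bs)
  case (Cons b bs)
  have "of_int b * (z + of_int l * \<tau> + of_int p) = of_int b * z + of_int (b * l) * \<tau> + of_int (b * p)"
    by (simp add: algebra_simps)
  then have "jphi \<tau> (of_int b * (z + of_int l * \<tau> + of_int p)) =
      parity_sign (b * l + b * p) * ee (- (of_int ((b * l) ^ 2) * \<tau> / 2 + of_int (b * l) * (of_int b * z))) * jphi \<tau> (of_int b * z)"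
    by (simp only: jphi_elliptic[OF assms])
  also have "parity_sign (b * l + b * p) = parity_sign ((l + p) * b ^ 2)"
    by (auto simp: parity_sign_def)
  also have "- (of_int ((b * l) ^ 2) * \<tau> / 2 + of_int (b * l) * (of_int b * z)) =
      - of_int (b ^ 2) * (of_int (l ^ 2) * \<tau> / 2 + of_int l * z)"
    by (simp add: algebra_simps power2_eq_square)
  finally have 1: "jphi \<tau> (of_int b * (z + of_int l * \<tau> + of_int p)) =
      parity_sign ((l + p) * b ^ 2) * ee (- of_int (b ^ 2) * (of_int (l ^ 2) * \<tau> / 2 + of_int l * z)) * jphi \<tau> (of_int b * z)" .
  have 2: "parity_sign ((l + p) * square_sum (b # bs)) = parity_sign ((l + p) * b ^ 2) * parity_sign ((l + p) * square_sum bs)"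
    by (simp add: distrib_left parity_sign_add)
  have 3: "ee (- of_int (square_sum (b # bs)) * (of_int (l ^ 2) * \<tau> / 2 + of_int l * z)) =
      ee (- of_int (b ^ 2) * (of_int (l ^ 2) * \<tau> / 2 + of_int l * z)) *
      ee (- of_int (square_sum bs) * (of_int (l ^ 2) * \<tau> / 2 + of_int l * z))"
    unfolding ee_add[symmetric] by (rule arg_cong[of _ _ ee]) (simp add: field_simps)
  show ?case unfolding jphi_list_simps 1 2 3 Cons.IH by (simp only: mult_ac)
qed (simp add: parity_sign_def)

lemma eta_holomorphic: "eta holomorphic_on {t. Im t > 0}"
proof -
  have "(\<lambda>\<tau>. ee (\<tau> / 24) * qpoch (ee \<tau>) (ee \<tau>)) holomorphic_on {t. Im t > 0}"
    by (intro holomorphic_intros holomorphic_on_compose_gen[OF _ holomorphic_euler, unfolded o_def])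
       (auto simp: norm_ee_less_1)
  then show ?thesis by (simp add: eta_eq[abs_def])
qed

lemma holomorphic_HC_block: "holomorphic_HC (block s bs)"
proof -
  have "holomorphic_HC (\<lambda>\<tau> z. eta \<tau> powi s)"
    by (intro holomorphic_HC_fst holomorphic_intros eta_holomorphic) (auto simp: eta_nonzero)
  moreover have "holomorphic_HC (theta_mult b)" for b
    unfolding theta_mult_def[abs_def] by (intro holomorphic_HC_scale holomorphic_HC_theta)
  ultimately show ?thesis
    unfolding block_def[abs_def] by (intro holomorphic_HC_mult holomorphic_HC_prod_list)
qed

text \<open>The condition on \<open>s\<close> makes the block equal to \<open>(eta ^ 24) ^ k\<close>
  times one \<open>jphi\<close> per list entry. Its weight is 12 k minus the length, no root of
  unity is left, and the generators are covered by the laws of eta^24 and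
  \<open>jphi_list\<close>.\<close>

lemma block_modular:
  assumes sq: "square_sum bs = 2 * int M" and w: "w = 12 * int k - int (length bs)"
    and s: "s = 24 * int k - 3 * int (length bs)"
    and det: "a * d - b * c = (1::int)" and \<tau>: "Im \<tau> > 0"
  shows "block s bs ((of_int a * \<tau> + of_int b) / (of_int c * \<tau> + of_int d)) (z / (of_int c * \<tau> + of_int d)) =
    (of_int c * \<tau> + of_int d) powi w * ee (of_nat M * of_int c * z ^ 2 / (of_int c * \<tau> + of_int d)) * block s bs \<tau> z"
proof (rule jacobi_invariance_from_generators[OF _ _ _ det \<tau>])
  have B: "block s bs \<tau> z = (eta \<tau> ^ 24) ^ k * jphi_list bs \<tau> z" if "Im \<tau> > 0" for \<tau> z
    unfolding s block_eq_jphi_list[OF that] by (simp add: power_int_def nat_mult_distrib flip: power_mult)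
  fix \<tau> z :: complex assume t: "Im \<tau> > 0"
  then have t0: "\<tau> \<noteq> 0" by auto
  show "block s bs (\<tau> + 1) z = block s bs \<tau> z"
    using t by (simp add: B jphi_list_T eta_T)
  have "block s bs (- 1 / \<tau>) (z / \<tau>) =
      (\<tau> ^ 12 * eta \<tau> ^ 24) ^ k * (ee (of_int (square_sum bs) * z ^ 2 / (2 * \<tau>)) / \<tau> ^ length bs * jphi_list bs \<tau> z)"
    unfolding B[OF Im_S[OF t]] jphi_list_S[OF t] eta_S[OF t] ..
  moreover have "\<tau> powi w = (\<tau> ^ 12) ^ k / \<tau> ^ length bs"
    unfolding w using t0 by (simp add: power_int_diff) (simp add: power_int_def nat_mult_distrib flip: power_mult)
  ultimately show "block s bs (- 1 / \<tau>) (z / \<tau>) = \<tau> powi w * ee (of_nat M * z ^ 2 / \<tau>) * block s bs \<tau> z"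
    unfolding B[OF t] sq using t0 by (simp add: power_mult_distrib)
  have "(-1 :: complex) powi w = (-1) ^ length bs"
  proof -
    have "(-1 :: complex) powi w = (if even w then 1 else - 1)" by (simp add: power_int_minus_left)
    then show ?thesis unfolding w by simp
  qed
  then show "block s bs \<tau> (- z) = (- 1) powi w * block s bs \<tau> z"
    unfolding B[OF t] jphi_list_minus[OF t] by simp
qed

lemma block_elliptic:
  assumes "square_sum bs = 2 * int M" and s: "s = 24 * int k - 3 * int (length bs)" and \<tau>: "Im \<tau> > 0"
  shows "block s bs \<tau> (z + of_int l * \<tau> + of_int p) =
    ee (- of_nat M * (of_int (l ^ 2) * \<tau> + 2 * of_int l * z)) * block s bs \<tau> z"
proof -
  have "- of_int (2 * int M) * (of_int (l ^ 2) * \<tau> / 2 + of_int l * z) = - of_nat M * (of_int (l ^ 2) * \<tau> + 2 * of_int l * z)"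
    by (simp add: algebra_simps)
  then show ?thesis
    unfolding s block_eq_jphi_list[OF \<tau>] jphi_list_elliptic[OF \<tau>] assms(1)
    by (simp only:) (simp add: parity_sign_def)
qed

section \<open>Fourier expansions\<close>

text \<open>Substituting z = x \<tau> turns q^n zeta^r into a power of q with exponent n + r x, so
  \<open>L x\<close> bounds the exponents along that line. Such bounds describe the support by
  half-planes and add when functions are multiplied.\<close>

definition fourier_bounded ::
    "rat \<Rightarrow> rat \<Rightarrow> (rat \<Rightarrow> rat) \<Rightarrow> (complex \<Rightarrow> complex \<Rightarrow> complex) \<Rightarrow> bool" where
  "fourier_bounded \<alpha> \<beta> L \<phi> \<longleftrightarrow>
    (\<exists>c. has_fourier_expansion \<alpha> \<beta> c \<phi> \<and> (\<forall>n r x. c n r \<noteq> 0 \<longrightarrow> L x \<le> n + r * x))"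

lemma fourier_bounded_cong:
  assumes "fourier_bounded \<alpha> \<beta> L \<phi>" "\<And>\<tau> z. Im \<tau> > 0 \<Longrightarrow> \<psi> \<tau> z = \<phi> \<tau> z"
  shows "fourier_bounded \<alpha> \<beta> L \<psi>"
  using assms unfolding fourier_bounded_def has_fourier_expansion_def by auto

lemma has_fourier_expansion_shift:
  assumes "has_fourier_expansion \<alpha> \<beta> c \<phi>" "\<alpha> - \<alpha>' \<in> \<int>" "\<beta> - \<beta>' \<in> \<int>"
  shows "has_fourier_expansion \<alpha>' \<beta>' c \<phi>"
proof -
  have "n - a \<in> \<int> \<longleftrightarrow> n - a' \<in> \<int>" if "a - a' \<in> \<int>" for n a a' :: rat
    using Ints_add[of "n - a" "a - a'"] Ints_diff[of "n - a'" "a - a'"] that by auto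
  then show ?thesis using assms unfolding has_fourier_expansion_def by simp
qed

text \<open>Unconditional summability of complex families is absolute, so the product family is
  absolutely summable too.\<close>

lemma has_sum_mult_Times:
  fixes f g :: "_ \<Rightarrow> complex"
  assumes "(f has_sum a) A" "(g has_sum b) B"
  shows "((\<lambda>(x, y). f x * g y) has_sum a * b) (A \<times> B)"
proof (rule has_sum_SigmaI[where g = "\<lambda>x. f x * b"])
  have f: "(\<lambda>x. norm (f x)) summable_on A" and g: "(\<lambda>x. norm (g x)) summable_on B"
    using has_sum_imp_summable[OF assms(1)] has_sum_imp_summable[OF assms(2)]
    by (simp_all add: summable_on_iff_abs_summable_on_complex)
  show "((\<lambda>y. case (x, y) of (x, y) \<Rightarrow> f x * g y) has_sum f x * b) B" for x
    using has_sum_cmult_right[OF assms(2)] by simp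
  show "((\<lambda>x. f x * b) has_sum a * b) A"
    by (rule has_sum_cmult_left[OF assms(1)])
  have "(\<lambda>p. norm (case p of (x, y) \<Rightarrow> f x * g y)) summable_on A \<times> B"
  proof (rule summable_on_SigmaI[where g = "\<lambda>x. norm (f x) * (\<Sum>\<^sub>\<infinity>y\<in>B. norm (g y))"])
    show "((\<lambda>y. norm (case (x, y) of (x, y) \<Rightarrow> f x * g y)) has_sum norm (f x) * (\<Sum>\<^sub>\<infinity>y\<in>B. norm (g y))) B" for x
      using has_sum_cmult_right[OF has_sum_infsum[OF g]] by (simp add: norm_mult)
    show "(\<lambda>x. norm (f x) * (\<Sum>\<^sub>\<infinity>y\<in>B. norm (g y))) summable_on A"
      by (rule summable_on_cmult_left[OF f])
  qed auto
  then show "(\<lambda>(x, y). f x * g y) summable_on A \<times> B"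
    by (simp only: summable_on_iff_abs_summable_on_complex)
qed

text \<open>Pairs of exponents are reindexed by their sum and their first member. Summing over the
  first member gives the convolution \<open>c\<close>, because the exponential depends on the sum
  only. A nonzero \<open>c n r\<close> has a nonzero term, whose two bounds add up.\<close>

lemma fourier_bounded_mult:
  assumes "fourier_bounded \<alpha>1 \<beta>1 L1 f" "fourier_bounded \<alpha>2 \<beta>2 L2 g"
  shows "fourier_bounded (\<alpha>1 + \<alpha>2) (\<beta>1 + \<beta>2) (\<lambda>x. L1 x + L2 x) (\<lambda>\<tau> z. f \<tau> z * g \<tau> z)"
proof -
  obtain c1 where c1: "has_fourier_expansion \<alpha>1 \<beta>1 c1 f" "\<And>n r x. c1 n r \<noteq> 0 \<Longrightarrow> L1 x \<le> n + r * x"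
    using assms(1) unfolding fourier_bounded_def by blast
  obtain c2 where c2: "has_fourier_expansion \<alpha>2 \<beta>2 c2 g" "\<And>n r x. c2 n r \<noteq> 0 \<Longrightarrow> L2 x \<le> n + r * x"
    using assms(2) unfolding fourier_bounded_def by blast
  define A1 where "A1 = {n. n - \<alpha>1 \<in> \<int>} \<times> {r. r - \<beta>1 \<in> \<int>}"
  define A2 where "A2 = {n. n - \<alpha>2 \<in> \<int>} \<times> {r. r - \<beta>2 \<in> \<int>}"
  define A where "A = {n. n - (\<alpha>1 + \<alpha>2) \<in> \<int>} \<times> {r. r - (\<beta>1 + \<beta>2) \<in> \<int>}"
  define c where "c n r = (\<Sum>\<^sub>\<infinity>(n1, r1)\<in>A1. c1 n1 r1 * c2 (n - n1) (r - r1))" for n r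
  have Z: "n - n1 - b \<in> \<int>" if "n - (a + b) \<in> \<int>" "n1 - a \<in> \<int>" for n n1 a b :: rat
    using Ints_diff[OF that] by (simp add: algebra_simps)
  have Z': "n1 + n2 - (a + b) \<in> \<int>" if "n1 - a \<in> \<int>" "n2 - b \<in> \<int>" for n1 n2 a b :: rat
    using Ints_add[OF that] by (simp add: algebra_simps)
  have "has_fourier_expansion (\<alpha>1 + \<alpha>2) (\<beta>1 + \<beta>2) c (\<lambda>\<tau> z. f \<tau> z * g \<tau> z)"
    unfolding has_fourier_expansion_def
  proof (intro allI impI)
    fix \<tau> z :: complex assume \<tau>: "Im \<tau> > 0"
    define e where "e = (\<lambda>(n, r). ee (of_rat n * \<tau> + of_rat r * z))"
    have e_add: "e (n1, r1) * e (n - n1, r - r1) = e (n, r)" for n n1 r r1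
      unfolding e_def by (simp add: ee_add[symmetric] of_rat_diff algebra_simps)
    have s1: "((\<lambda>(n, r). c1 n r * e (n, r)) has_sum f \<tau> z) A1"
      and s2: "((\<lambda>(n, r). c2 n r * e (n, r)) has_sum g \<tau> z) A2"
      using c1(1) c2(1) \<tau> unfolding has_fourier_expansion_def A1_def A2_def e_def by auto
    define h where "h = (\<lambda>(s, p). c1 (fst p) (snd p) * c2 (fst s - fst p) (snd s - snd p) * e s)"
    have "((\<lambda>(p1, p2). (case p1 of (n, r) \<Rightarrow> c1 n r * e (n, r)) * (case p2 of (n, r) \<Rightarrow> c2 n r * e (n, r)))
        has_sum f \<tau> z * g \<tau> z) (A1 \<times> A2)"
      by (rule has_sum_mult_Times[OF s1 s2])
    also have "?this \<longleftrightarrow> (h has_sum f \<tau> z * g \<tau> z) (A \<times> A1)"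
    proof (rule has_sum_reindex_bij_witness[of _ "\<lambda>(s, p). (p, (fst s - fst p, snd s - snd p))"
            "\<lambda>(p1, p2). ((fst p1 + fst p2, snd p1 + snd p2), p1)"], goal_cases)
      case (5 a)
      then show ?case
        using e_add[of "fst (fst a)" "snd (fst a)" "fst (fst a) + fst (snd a)" "snd (fst a) + snd (snd a)"]
        by (auto simp: h_def case_prod_unfold)
    qed (auto simp: A_def A1_def A2_def Z Z')
    finally have hs: "(h has_sum f \<tau> z * g \<tau> z) (A \<times> A1)" .
    have "((\<lambda>s. \<Sum>\<^sub>\<infinity>p\<in>A1. h (s, p)) has_sum f \<tau> z * g \<tau> z) A"
    proof (rule has_sum_SigmaD[OF hs])
      fix s assume "s \<in> A"
      have "(\<lambda>(s, p). h (s, p)) summable_on A \<times> A1" using hs by (auto simp: summable_on_def)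
      from summable_on_SigmaD1[OF this \<open>s \<in> A\<close>]
      show "((\<lambda>p. h (s, p)) has_sum (\<Sum>\<^sub>\<infinity>p\<in>A1. h (s, p))) A1" by (rule has_sum_infsum)
    qed
    moreover have "(\<Sum>\<^sub>\<infinity>p\<in>A1. h (s, p)) = (case s of (n, r) \<Rightarrow> c n r * ee (of_rat n * \<tau> + of_rat r * z))" for s
      by (simp add: h_def c_def case_prod_unfold infsum_cmult_left') (simp add: e_def case_prod_unfold)
    ultimately show "((\<lambda>(n, r). c n r * ee (of_rat n * \<tau> + of_rat r * z)) has_sum f \<tau> z * g \<tau> z)
        ({n. n - (\<alpha>1 + \<alpha>2) \<in> \<int>} \<times> {r. r - (\<beta>1 + \<beta>2) \<in> \<int>})"
      by (simp add: A_def)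
  qed
  moreover have "L1 x + L2 x \<le> n + r * x" if nz: "c n r \<noteq> 0" for n r x
  proof -
    obtain n1 r1 where "c1 n1 r1 \<noteq> 0" "c2 (n - n1) (r - r1) \<noteq> 0"
    proof -
      have "\<exists>p\<in>A1. (case p of (n1, r1) \<Rightarrow> c1 n1 r1 * c2 (n - n1) (r - r1)) \<noteq> 0"
        using nz infsum_0[of A1 "\<lambda>(n1, r1). c1 n1 r1 * c2 (n - n1) (r - r1)"] unfolding c_def by blast
      then show ?thesis using that by auto
    qed
    from add_mono[OF c1(2)[OF this(1), of x] c2(2)[OF this(2), of x]]
    show ?thesis by (simp add: algebra_simps)
  qed
  ultimately show ?thesis unfolding fourier_bounded_def by blast
qed

text \<open>The coefficients are Taylor coefficients at 0. Absolute convergence at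
  \<open>ee \<tau>\<close> comes from convergence at a point of larger modulus in the disc.\<close>

lemma fourier_bounded_q_series:
  assumes "g holomorphic_on ball 0 1"
  shows "fourier_bounded \<alpha> 0 (\<lambda>x. \<alpha>) (\<lambda>\<tau> z. ee (of_rat \<alpha> * \<tau>) * g (ee \<tau>))"
proof -
  define a where "a k = (deriv ^^ k) g 0 / fact k" for k
  define h where "h k = (\<alpha> + of_nat k, 0 :: rat)" for k :: nat
  have h: "inj h" by (auto simp: inj_on_def h_def)
  define c where "c n r = (if (n, r) \<in> range h then a (inv h (n, r)) else 0)" for n r
  have ch: "c (fst (h k)) (snd (h k)) = a k" for k
    using inv_f_f[OF h, of k] by (simp add: c_def)
  have "has_fourier_expansion \<alpha> 0 c (\<lambda>\<tau> z. ee (of_rat \<alpha> * \<tau>) * g (ee \<tau>))"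
    unfolding has_fourier_expansion_def
  proof (intro allI impI)
    fix \<tau> z :: complex assume \<tau>: "Im \<tau> > 0"
    have ser: "(\<lambda>k. a k * w ^ k) sums g w" if "norm w < 1" for w
      using holomorphic_power_series[OF assms, of w] that by (simp add: a_def)
    obtain t where t: "norm (ee \<tau>) < t" "t < 1" using dense[OF norm_ee_less_1[OF \<tau>]] by blast
    moreover have "0 < t" using norm_ge_zero[of "ee \<tau>"] t(1) by linarith
    ultimately have "norm (complex_of_real t) < 1" "norm (ee \<tau>) < norm (complex_of_real t)"
      by auto
    then have "summable (\<lambda>k. norm (a k * ee \<tau> ^ k))"
      using powser_insidea[OF sums_summable[OF ser]] by blast
    then have "((\<lambda>k. a k * ee \<tau> ^ k) has_sum g (ee \<tau>)) UNIV"
      by (rule norm_summable_imp_has_sum[OF _ ser[OF norm_ee_less_1[OF \<tau>]]])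
    then have "((\<lambda>k. ee (of_rat \<alpha> * \<tau>) * (a k * ee \<tau> ^ k)) has_sum ee (of_rat \<alpha> * \<tau>) * g (ee \<tau>)) UNIV"
      by (rule has_sum_cmult_right)
    moreover have "ee (of_rat \<alpha> * \<tau>) * (a k * ee \<tau> ^ k) =
        (\<lambda>(n, r). c n r * ee (of_rat n * \<tau> + of_rat r * z)) (h k)" for k
      using ch[of k] by (simp add: h_def of_rat_add distrib_right ee_add ee_power)
    ultimately have "((\<lambda>(n, r). c n r * ee (of_rat n * \<tau> + of_rat r * z)) has_sum ee (of_rat \<alpha> * \<tau>) * g (ee \<tau>)) (range h)"
      by (subst has_sum_reindex[OF h]) (simp add: o_def)
    also have "?this \<longleftrightarrow> ((\<lambda>(n, r). c n r * ee (of_rat n * \<tau> + of_rat r * z)) has_sum ee (of_rat \<alpha> * \<tau>) * g (ee \<tau>))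
        ({n. n - \<alpha> \<in> \<int>} \<times> {r. r - 0 \<in> \<int>})"
      by (rule has_sum_cong_neutral) (auto simp: c_def h_def)
    finally show "((\<lambda>(n, r). c n r * ee (of_rat n * \<tau> + of_rat r * z)) has_sum ee (of_rat \<alpha> * \<tau>) * g (ee \<tau>))
        ({n. n - \<alpha> \<in> \<int>} \<times> {r. r - 0 \<in> \<int>})" .
  qed
  moreover have "\<alpha> \<le> n + r * x" if "c n r \<noteq> 0" for n r x
    using that by (auto simp: c_def h_def split: if_splits)
  ultimately show ?thesis unfolding fourier_bounded_def by blast
qed

text \<open>The squared distance from \<open>y\<close> to the nearest half-odd integer; up to the
  constant 1/12 it is the periodic second Bernoulli polynomial.\<close>

definition half_dist :: "rat \<Rightarrow> rat" where
  "half_dist y = (frac y - 1 / 2) ^ 2"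

lemma half_dist_le:
  assumes "odd r"
  shows "half_dist y \<le> (of_int r / 2 + y) ^ 2"
proof -
  obtain k where k: "r = 2 * k + 1" using assms by (elim oddE)
  define K where "K = k + \<lfloor>y\<rfloor>"
  define t where "t = frac y"
  have t: "0 \<le> t" "t < 1" by (simp_all add: t_def frac_lt_1)
  have "of_int r / 2 + y = of_int K + 1 / 2 + t" by (simp add: k K_def t_def frac_def field_simps)
  \<comment> \<open>A difference of squares. As \<open>K\<close> is an integer and
    \<open>0 \<le> t < 1\<close>, the two factors never have opposite signs.\<close>
  then have "(of_int r / 2 + y) ^ 2 - half_dist y = (of_int K + 1) * (of_int K + 2 * t)"
    unfolding half_dist_def t_def[symmetric] by (simp add: power2_eq_square algebra_simps)
  moreover have "0 \<le> (of_int K + 1) * (of_int K + 2 * t)"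
  proof -
    consider "K \<ge> 0" | "K = - 1" | "K \<le> - 2" by linarith
    then show ?thesis
    proof cases
      case 1 then show ?thesis using t by (intro mult_nonneg_nonneg) auto
    next
      case 3
      then have "of_int K \<le> (- 2 :: rat)" by (metis of_int_le_iff of_int_minus of_int_numeral)
      then show ?thesis using t by (intro mult_nonpos_nonpos) auto
    qed simp
  qed
  ultimately show ?thesis by simp
qed

text \<open>The least value of r^2/8 + r b x/2 over odd \<open>r\<close>, found by completing the
  square. The subtracted term is b^2/2, the index of \<open>theta_mult b\<close>, times x^2.\<close>

definition theta_bound :: "int \<Rightarrow> rat \<Rightarrow> rat" where
  "theta_bound b x = half_dist (of_int b * x) / 2 - of_int (b ^ 2) * x ^ 2 / 2"

text \<open>Since \<open>b\<close> is nonzero, \<open>h\<close> is injective, so each coefficient is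
  a single Kronecker symbol instead of a sum over \<open>r\<close> and \<open>- r\<close>.\<close>

lemma fourier_bounded_theta_mult:
  assumes "b \<noteq> 0"
  shows "fourier_bounded (1 / 8) (of_int b / 2) (theta_bound b) (theta_mult b)"
proof -
  define h where "h r = (of_int (r ^ 2) / 8 :: rat, of_int (r * b) / 2 :: rat)" for r :: int
  have h: "inj h" using assms by (auto simp: inj_on_def h_def)
  define c where "c n r = (if (n, r) \<in> range h then of_int (kronecker_m4 (inv h (n, r))) else 0 :: complex)" for n r
  have ch: "c (fst (h r)) (snd (h r)) = of_int (kronecker_m4 r)" for r
    using inv_f_f[OF h, of r] by (simp add: c_def)
  have "has_fourier_expansion (1 / 8) (of_int b / 2) c (theta_mult b)"
    unfolding has_fourier_expansion_def
  proof (intro allI impI)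
    fix \<tau> z :: complex assume \<tau>: "Im \<tau> > 0"
    have "((\<lambda>r. of_int (kronecker_m4 r) * theta_term \<tau> (of_int b * z) r) has_sum theta_mult b \<tau> z) UNIV"
      unfolding theta_mult_def by (rule theta_has_sum_pairs(1)[OF \<tau>])
    moreover have "of_int (kronecker_m4 r) * theta_term \<tau> (of_int b * z) r =
        (\<lambda>(n, r). c n r * ee (of_rat n * \<tau> + of_rat r * z)) (h r)" for r
    proof -
      have "of_int (r ^ 2) * \<tau> / 8 + of_int r * (of_int b * z) / 2 = of_rat (fst (h r)) * \<tau> + of_rat (snd (h r)) * z"
        by (simp add: h_def of_rat_divide of_rat_mult of_rat_power)
      then show ?thesis using ch[of r] by (simp add: theta_term_def case_prod_unfold)
    qed
    ultimately have "((\<lambda>(n, r). c n r * ee (of_rat n * \<tau> + of_rat r * z)) has_sum theta_mult b \<tau> z) (range h)"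
      by (subst has_sum_reindex[OF h]) (simp add: o_def)
    also have "?this \<longleftrightarrow> ((\<lambda>(n, r). c n r * ee (of_rat n * \<tau> + of_rat r * z)) has_sum theta_mult b \<tau> z)
        ({n. n - 1 / 8 \<in> \<int>} \<times> {r. r - of_int b / 2 \<in> \<int>})"
    proof (rule has_sum_cong_neutral)
      fix p assume p: "p \<in> range h - {n. n - 1 / 8 \<in> \<int>} \<times> {r. r - of_int b / 2 \<in> \<int>}"
      then obtain r where r: "p = h r" by blast
      have "even r"
      proof (rule ccontr)
        assume "odd r"
        then obtain k where k: "r = 2 * k + 1" by (elim oddE)
        have "even (k * (k + 1))" by auto
        then obtain m where m: "k * (k + 1) = 2 * m" by (elim evenE)
        have "r ^ 2 = 4 * (k * (k + 1)) + 1" unfolding k by (simp add: power2_eq_square algebra_simps)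
        then have "r ^ 2 = 8 * m + 1" unfolding m by simp
        then have "fst (h r) - 1 / 8 = of_int m" unfolding h_def by (simp only: fst_conv) (simp add: add_divide_distrib)
        moreover have "snd (h r) - of_int b / 2 = of_int (k * b)" unfolding h_def k by (simp add: field_simps)
        ultimately show False using p r by (auto simp: mem_Times_iff)
      qed
      then show "(case p of (n, r) \<Rightarrow> c n r * ee (of_rat n * \<tau> + of_rat r * z)) = 0"
        using ch[of r] kronecker_m4_nonzero_odd[of r] by (auto simp: r case_prod_unfold)
    qed (auto simp: c_def)
    finally show "((\<lambda>(n, r). c n r * ee (of_rat n * \<tau> + of_rat r * z)) has_sum theta_mult b \<tau> z)
        ({n. n - 1 / 8 \<in> \<int>} \<times> {r. r - of_int b / 2 \<in> \<int>})" .
  qed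
  moreover have "theta_bound b x \<le> n + s * x" if nz: "c n s \<noteq> 0" for n s x
  proof -
    obtain r where r: "(n, s) = h r" using nz by (auto simp: c_def split: if_splits)
    then have "c n s = of_int (kronecker_m4 r)" using ch[of r] by (metis fst_conv snd_conv)
    then have "odd r" using nz kronecker_m4_nonzero_odd[of r] by auto
    from half_dist_le[OF this, of "of_int b * x"]
    have "theta_bound b x \<le> (of_int r / 2 + of_int b * x) ^ 2 / 2 - of_int (b ^ 2) * x ^ 2 / 2"
      by (simp add: theta_bound_def)
    also have "\<dots> = of_int (r ^ 2) / 8 + of_int (r * b) / 2 * x"
      by (simp add: power2_eq_square field_simps)
    also have "\<dots> = n + s * x"
      using r unfolding h_def prod.inject by (elim conjE) (simp only:)
    finally show ?thesis .
  qed
  ultimately show ?thesis unfolding fourier_bounded_def by blast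
qed

text \<open>Euler's product has no zero in the unit disc, so its negative powers are power series as
  well; the leading power q^(s/24) gives both the class of the exponents and the bound.\<close>

lemma fourier_bounded_eta_power:
  "fourier_bounded (of_int s / 24) 0 (\<lambda>x. of_int s / 24) (\<lambda>\<tau> z. eta \<tau> powi s)"
proof (rule fourier_bounded_cong[OF fourier_bounded_q_series[of "\<lambda>q. qpoch q q powi s"]])
  show "(\<lambda>q. qpoch q q powi s) holomorphic_on ball 0 1"
    by (intro holomorphic_intros holomorphic_euler) (auto simp: qpoch_self_nonzero)
  fix \<tau> z :: complex
  have "of_rat (of_int s / 24) * \<tau> = of_int s * (\<tau> / 24)" by (simp add: of_rat_divide)
  then show "eta \<tau> powi s = ee (of_rat (of_int s / 24) * \<tau>) * qpoch (ee \<tau>) (ee \<tau>) powi s"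
    by (simp only: eta_eq power_int_mult_distrib ee_power_int)
qed

lemma fourier_bounded_block:
  assumes "0 \<notin> set bs"
  shows "fourier_bounded (of_int s / 24 + of_nat (length bs) / 8) (\<Sum>b\<leftarrow>bs. of_int b / 2)
    (\<lambda>x. of_int s / 24 + (\<Sum>b\<leftarrow>bs. theta_bound b x)) (block s bs)"
  using assms
proof (induction bs)
  case Nil
  show ?case using fourier_bounded_eta_power[of s] by (simp add: block_def)
next
  case (Cons b bs)
  have "fourier_bounded ((of_int s / 24 + of_nat (length bs) / 8) + 1 / 8) ((\<Sum>b\<leftarrow>bs. of_int b / 2) + of_int b / 2)
    (\<lambda>x. (of_int s / 24 + (\<Sum>b\<leftarrow>bs. theta_bound b x)) + theta_bound b x) (\<lambda>\<tau> z. block s bs \<tau> z * theta_mult b \<tau> z)"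
    using Cons by (intro fourier_bounded_mult fourier_bounded_theta_mult) auto
  moreover have "(\<lambda>\<tau> z. block s bs \<tau> z * theta_mult b \<tau> z) = block s (b # bs)"
    by (simp add: block_def fun_eq_iff)
  ultimately show ?case by (simp add: add_ac add_divide_distrib)
qed

section \<open>Order at infinity\<close>

lemma half_dist_diff_cong: "half_dist (u - v) = half_dist (frac u - frac v)"
proof -
  have "frac (u - v) = frac (frac u - frac v)"
    using frac_add_of_int_right[of "frac u - frac v" "\<lfloor>u\<rfloor> - \<lfloor>v\<rfloor>"] by (simp add: frac_def algebra_simps)
  then show ?thesis by (simp add: half_dist_def)
qed

lemma half_dist_minus: "half_dist (- y) = half_dist y"
  by (auto simp: half_dist_def frac_neg power2_eq_square algebra_simps)

lemma half_dist_eq: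
  assumes "\<bar>y\<bar> < 1"
  shows "half_dist y = (\<bar>y\<bar> - 1 / 2) ^ 2"
proof -
  have *: "half_dist w = (w - 1 / 2) ^ 2" if "0 \<le> w" "w < 1" for w
    using that by (simp add: half_dist_def frac_eq[THEN iffD2])
  show ?thesis
    using *[of y] *[of "- y"] assms by (cases "y \<ge> 0") (simp_all add: half_dist_minus)
qed

text \<open>\<open>y j\<close> occurs with positive sign in \<open>j\<close> pairs and with negative
  sign in \<open>n - j\<close>, whence the weight \<open>2 * j - n\<close> of the linear term. The
  identity is applied with \<open>t = 1/2\<close> to the points and with \<open>t = 0\<close> to
  their deviations from equal spacing.\<close>

lemma sum_pairs_squared_diff:
  fixes y :: "nat \<Rightarrow> rat"
  shows "(\<Sum>j\<le>n. \<Sum>i<j. (y j - y i - t) ^ 2) =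
    of_nat (n + 1) * (\<Sum>j\<le>n. y j ^ 2) - (\<Sum>j\<le>n. y j) ^ 2 - 2 * t * (\<Sum>j\<le>n. (2 * of_nat j - of_nat n) * y j) +
    t ^ 2 * of_nat n * of_nat (n + 1) / 2"
proof (induction n)
  case (Suc n)
  define Y where "Y = y (Suc n)"
  have "(\<Sum>i\<le>n. (Y - y i - t) ^ 2) = of_nat (n + 1) * (Y - t) ^ 2 - 2 * (Y - t) * (\<Sum>i\<le>n. y i) + (\<Sum>i\<le>n. y i ^ 2)"
  proof -
    have "(Y - y i - t) ^ 2 = (Y - t) ^ 2 - 2 * (Y - t) * y i + y i ^ 2" for i
      by (simp add: power2_eq_square algebra_simps)
    then show ?thesis by (simp add: sum.distrib sum_subtractf sum_distrib_left)
  qed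
  moreover have "(\<Sum>j\<le>Suc n. (2 * of_nat j - of_nat (Suc n)) * y j) =
      (\<Sum>j\<le>n. (2 * of_nat j - of_nat n) * y j) - (\<Sum>j\<le>n. y j) + of_nat (n + 1) * Y"
  proof -
    have "(2 * of_nat j - of_nat (Suc n)) * y j = (2 * of_nat j - of_nat n) * y j - y j" for j
      by (simp add: algebra_simps)
    then have "(\<Sum>j\<le>n. (2 * of_nat j - of_nat (Suc n)) * y j) =
        (\<Sum>j\<le>n. (2 * of_nat j - of_nat n) * y j) - (\<Sum>j\<le>n. y j)"
      by (simp only: sum_subtractf)
    moreover have "(2 * of_nat (Suc n) - of_nat (Suc n)) * y (Suc n) = of_nat (n + 1) * Y"
      by (simp add: Y_def algebra_simps)
    ultimately show ?thesis by (simp only: sum.atMost_Suc)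
  qed
  ultimately show ?case
    using Suc by (simp add: lessThan_Suc_atMost Y_def[symmetric]) (simp add: power2_eq_square field_simps)
qed (simp add: power2_eq_square)

text \<open>
  The difference of the two sides is the sum of the squares \<open>(u_j - u_i)^2\<close>, where \<open>u\<close> is the deviation from
  equally spaced points.
\<close>

lemma sum_pairs_lower_bound:
  fixes y :: "nat \<Rightarrow> rat"
  shows "of_nat n * (of_nat n - 1) / 24 \<le> (\<Sum>j\<le>n. \<Sum>i<j. (y j - y i - 1 / 2) ^ 2)"
proof -
  define m where "m = (of_nat (n + 1) :: rat)"
  have m: "m > 0" "of_nat n = m - 1" by (simp_all add: m_def)
  \<comment> \<open>The spacing \<open>1 / (n + 1)\<close> is the one at which the terms linear in
    \<open>u\<close> cancel, so that the remainder is a sum of squares.\<close>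
  define u where "u j = y j - of_nat j / m" for j
  have s1: "(\<Sum>j\<le>n. of_nat j) = (of_nat n * of_nat (n + 1) / 2 :: rat)" for n
    by (induction n) (simp_all add: field_simps)
  have s2: "(\<Sum>j\<le>n. of_nat j ^ 2) = (of_nat n * of_nat (n + 1) * of_nat (2 * n + 1) / 6 :: rat)" for n
    by (induction n) (simp_all add: field_simps power2_eq_square)
  have U1: "(\<Sum>j\<le>n. u j) = (\<Sum>j\<le>n. y j) - (m - 1) / 2"
    unfolding u_def sum_subtractf sum_divide_distrib[symmetric] s1 using m by (simp add: m_def[symmetric])
  have U2: "(\<Sum>j\<le>n. u j ^ 2) = (\<Sum>j\<le>n. y j ^ 2) - 2 / m * (\<Sum>j\<le>n. of_nat j * y j) + (m - 1) * (2 * m - 1) / (6 * m)"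
  proof -
    have "u j ^ 2 = y j ^ 2 - 2 / m * (of_nat j * y j) + of_nat j ^ 2 / m ^ 2" for j
      using m by (simp add: u_def power2_eq_square field_simps)
    moreover have "of_nat n * of_nat (n + 1) * of_nat (2 * n + 1) / 6 / m ^ 2 = (m - 1) * (2 * m - 1) / (6 * m)"
    proof -
      have "of_nat (2 * n + 1) = 2 * m - 1" by (simp add: m_def)
      then show ?thesis unfolding m_def[symmetric] m(2) using m(1) by (simp add: power2_eq_square)
    qed
    ultimately show ?thesis
      by (simp add: sum.distrib sum_subtractf sum_distrib_left sum_divide_distrib[symmetric] s2)
  qed
  have Y: "(\<Sum>j\<le>n. (2 * of_nat j - (m - 1)) * y j) = 2 * (\<Sum>j\<le>n. of_nat j * y j) - (m - 1) * (\<Sum>j\<le>n. y j)"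
    by (simp add: left_diff_distrib sum_subtractf sum_distrib_left mult.assoc)
  have U3: "m * (A - 2 / m * B + C / (6 * m)) = m * A - 2 * B + C / 6" for A B C
    using m(1) by (simp add: field_simps)
  have "0 \<le> (\<Sum>j\<le>n. \<Sum>i<j. (u j - u i - 0) ^ 2)"
    by (intro sum_nonneg) auto
  also have "\<dots> = m * (\<Sum>j\<le>n. u j ^ 2) - (\<Sum>j\<le>n. u j) ^ 2"
    unfolding sum_pairs_squared_diff m_def by simp
  finally have "0 \<le> m * (\<Sum>j\<le>n. y j ^ 2) - 2 * (\<Sum>j\<le>n. of_nat j * y j) + (m - 1) * (2 * m - 1) / 6 -
      ((\<Sum>j\<le>n. y j) - (m - 1) / 2) ^ 2"
    unfolding U1 U2 U3 .
  then show ?thesis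
    unfolding sum_pairs_squared_diff Y m_def[symmetric] m(2)
    by (simp add: power2_eq_square field_simps)
qed

lemma sum_list_cong_mset:
  fixes h :: "'a \<Rightarrow> 'b :: comm_monoid_add"
  assumes "mset xs = mset ys"
  shows "(\<Sum>x\<leftarrow>xs. h x) = (\<Sum>y\<leftarrow>ys. h y)"
  using assms by (metis mset_map sum_mset_sum_list)

lemma double_sum_pairs:
  fixes g :: "nat \<Rightarrow> nat \<Rightarrow> 'a :: comm_ring_1"
  assumes "\<And>i j. g i j = g j i"
  shows "(\<Sum>i\<le>n. \<Sum>j\<le>n. g i j) = 2 * (\<Sum>j\<le>n. \<Sum>i<j. g i j) + (\<Sum>i\<le>n. g i i)"
proof (induction n)
  case (Suc n)
  have "(\<Sum>i\<le>n. g i (Suc n)) = (\<Sum>i\<le>n. g (Suc n) i)" using assms by simp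
  then show ?case
    using Suc by (simp add: sum.distrib lessThan_Suc_atMost algebra_simps)
qed simp

text \<open>\<open>half_dist\<close> is even and 1-periodic, so the points may be reduced mod 1 and
  sorted; then the differences lie in [0, 1), where \<open>half_dist\<close> is a plain square.
  Sorting is done on the sum over all ordered pairs, which is visibly invariant under
  permutations.\<close>

lemma half_dist_sum_bound:
  fixes y :: "nat \<Rightarrow> rat"
  shows "of_nat n * (of_nat n - 1) / 24 \<le> (\<Sum>j\<le>n. \<Sum>i<j. half_dist (y i - y j))"
proof -
  define xs where "xs = map (\<lambda>i. frac (y i)) [0..<Suc n]"
  define ys where "ys = sort xs"
  have len: "length xs = Suc n" "length ys = Suc n" by (simp_all add: xs_def ys_def)
  have ms: "mset xs = mset ys" by (simp add: ys_def)
  have ys: "0 \<le> ys ! i" "ys ! i < 1" if "i \<le> n" for i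
  proof -
    have "ys ! i \<in> set ys" using that len by simp
    then have "ys ! i \<in> set xs" by (simp add: ys_def)
    then show "0 \<le> ys ! i" "ys ! i < 1" by (auto simp: xs_def frac_lt_1)
  qed
  have conv: "(\<Sum>u\<leftarrow>zs. \<Sum>v\<leftarrow>zs. half_dist (u - v)) = (\<Sum>i\<le>n. \<Sum>j\<le>n. half_dist (zs ! i - zs ! j))"
    if "length zs = Suc n" for zs
    using that by (simp add: sum_list_sum_nth atLeast0LessThan lessThan_Suc_atMost)
  have D: "half_dist (u - v) = half_dist (v - u)" for u v
    using half_dist_minus[of "u - v"] by simp
  have "2 * (\<Sum>j\<le>n. \<Sum>i<j. half_dist (y i - y j)) + (\<Sum>i\<le>n. half_dist (y i - y i)) = (\<Sum>i\<le>n. \<Sum>j\<le>n. half_dist (y i - y j))"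
    using double_sum_pairs[of "\<lambda>i j. half_dist (y i - y j)" n] D by simp
  also have "\<dots> = (\<Sum>i\<le>n. \<Sum>j\<le>n. half_dist (xs ! i - xs ! j))"
    unfolding half_dist_diff_cong[of "y _"] xs_def by (intro sum.cong refl) (simp del: upt_Suc)
  also have "\<dots> = (\<Sum>u\<leftarrow>xs. \<Sum>v\<leftarrow>xs. half_dist (u - v))"
    by (rule conv[OF len(1), symmetric])
  also have "\<dots> = (\<Sum>u\<leftarrow>ys. \<Sum>v\<leftarrow>ys. half_dist (u - v))"
    unfolding sum_list_cong_mset[OF ms] ..
  also have "\<dots> = (\<Sum>i\<le>n. \<Sum>j\<le>n. half_dist (ys ! i - ys ! j))"
    by (rule conv[OF len(2)])
  also have "\<dots> = 2 * (\<Sum>j\<le>n. \<Sum>i<j. half_dist (ys ! i - ys ! j)) + (\<Sum>i\<le>n. half_dist (ys ! i - ys ! i))"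
    using double_sum_pairs[of "\<lambda>i j. half_dist (ys ! i - ys ! j)" n] D by simp
  finally have "(\<Sum>j\<le>n. \<Sum>i<j. half_dist (y i - y j)) = (\<Sum>j\<le>n. \<Sum>i<j. half_dist (ys ! i - ys ! j))"
    by simp
  also have "\<dots> = (\<Sum>j\<le>n. \<Sum>i<j. (ys ! j - ys ! i - 1 / 2) ^ 2)"
  proof (intro sum.cong refl)
    fix j i assume ij: "j \<in> {..n}" "i \<in> {..<j}"
    have "ys ! i \<le> ys ! j"
      using ij len unfolding ys_def by (intro sorted_nth_mono) auto
    moreover have "0 \<le> ys ! i" "ys ! j < 1" using ys ij by auto
    ultimately have "\<bar>ys ! i - ys ! j\<bar> = ys ! j - ys ! i" "\<bar>ys ! i - ys ! j\<bar> < 1" by auto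
    then show "half_dist (ys ! i - ys ! j) = (ys ! j - ys ! i - 1 / 2) ^ 2"
      using half_dist_eq by metis
  qed
  finally show ?thesis using sum_pairs_lower_bound[of n "\<lambda>i. ys ! i"] by (simp only:)
qed

text \<open>For an integral exponent the principal powers of the nonzero factors are ordinary
  powers, and these commute with the convergent product.\<close>

lemma eta_rpow_of_int:
  assumes "Im \<tau> > 0"
  shows "eta_rpow (of_int s) \<tau> = eta \<tau> powi s"
proof -
  have q: "norm (ee \<tau>) < 1" using assms by (rule norm_ee_less_1)
  have nz: "1 - ee \<tau> ^ Suc n \<noteq> 0" for n
    using q by (metis norm_one norm_power power_less_one_iff less_irrefl norm_ge_zero zero_less_Suc right_minus_eq)
  have c: "convergent_prod (\<lambda>n. 1 - ee \<tau> ^ Suc n)"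
    using convergent_qpoch[OF q, of "ee \<tau>"] by simp
  have "(\<Prod>n. (1 - ee \<tau> ^ Suc n) powr of_int s) = (\<Prod>n. 1 - ee \<tau> ^ Suc n) powi s"
  proof (cases "s \<ge> 0")
    case True
    then have "(1 - ee \<tau> ^ Suc n) powr of_int s = (1 - ee \<tau> ^ Suc n) ^ nat s" for n
      using nz by (simp add: powr_of_int)
    then show ?thesis using True prodinf_power[OF c, of "nat s"] by (simp add: power_int_def)
  next
    case False
    then have "(1 - ee \<tau> ^ Suc n) powr of_int s = inverse ((1 - ee \<tau> ^ Suc n) ^ nat (- s))" for n
      using nz by (simp add: powr_of_int)
    then show ?thesis using False prodinf_power[OF c, of "nat (- s)"] prodinf_inverse[OF convergent_prod_power[OF c, of "nat (- s)"]]
      by (simp add: power_int_def power_inverse)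
  qed
  moreover have "ee (of_int s * \<tau> / 24) = ee (\<tau> / 24) powi s"
    using ee_power_int[of s "\<tau> / 24"] by simp
  ultimately show ?thesis by (simp add: eta_rpow_def eta_def power_int_mult_distrib)
qed

text \<open>The double product in \<open>Theta\<close> as one list, so that the results on
  \<open>block\<close> apply.\<close>

definition diff_list :: "nat \<Rightarrow> (nat \<Rightarrow> int) \<Rightarrow> int list" where
  "diff_list n a = concat (map (\<lambda>j. map (\<lambda>i. a i - a j) [0..<j]) [0..<Suc n])"

lemma diff_list_Suc: "diff_list (Suc n) a = diff_list n a @ map (\<lambda>i. a i - a (Suc n)) [0..<Suc n]"
  by (simp add: diff_list_def)

lemma diff_list_0 [simp]: "diff_list 0 a = []"
  by (simp add: diff_list_def)

lemma sum_diff_list: "(\<Sum>b\<leftarrow>diff_list n a. f b) = (\<Sum>j\<le>n. \<Sum>i<j. f (a i - a j))"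
  for f :: "int \<Rightarrow> 'a :: comm_monoid_add"
  by (induction n)
     (simp_all add: diff_list_Suc interv_sum_list_conv_sum_set_nat comp_def atLeast0LessThan del: upt_Suc)

lemma prod_diff_list: "(\<Prod>b\<leftarrow>diff_list n a. f b) = (\<Prod>j\<le>n. \<Prod>i<j. f (a i - a j))"
  for f :: "int \<Rightarrow> 'a :: comm_monoid_mult"
proof -
  have "(\<Prod>i\<leftarrow>[0..<k]. g i) = (\<Prod>i<k. g i)" for k and g :: "nat \<Rightarrow> 'a"
    by (induction k) (simp_all add: mult.commute)
  then show ?thesis
    by (induction n) (simp_all add: diff_list_Suc comp_def del: upt_Suc)
qed

lemma length_diff_list: "2 * length (diff_list n a) = n * (n + 1)"
  by (induction n) (simp_all add: diff_list_Suc)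

lemma zero_notin_diff_list:
  assumes "inj_on a {..n}"
  shows "0 \<notin> set (diff_list n a)"
proof
  assume "0 \<in> set (diff_list n a)"
  then obtain i j where "i < j" "j \<le> n" "a i = a j"
    by (auto simp: diff_list_def less_Suc_eq_le simp del: upt_Suc)
  then show False using inj_onD[OF assms, of i j] by simp
qed

section \<open>Theta blocks of type A\<close>

text \<open>With this \<open>s\<close> the q-exponents lie in the class of the integer
  \<open>k\<close>. The zeta-exponents are integral because the entries and their squares have sums
  of equal parity. The bound at \<open>x = 0\<close> involves n alone and yields
  \<open>N\<close>.\<close>

lemma block_fourier_integral:
  assumes nz: "0 \<notin> set bs" and s: "s = 24 * int k - 3 * int (length bs)" and sq: "square_sum bs = 2 * int M"
  shows "\<exists>c N. has_fourier_expansion 0 0 c (block s bs) \<and> (\<forall>n r. n < N \<longrightarrow> c n r = 0)"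
proof -
  define L where "L x = of_int s / 24 + (\<Sum>b\<leftarrow>bs. theta_bound b x)" for x
  obtain c where c: "has_fourier_expansion (of_int s / 24 + of_nat (length bs) / 8) (\<Sum>b\<leftarrow>bs. of_int b / 2) c (block s bs)"
      "\<And>n r x. c n r \<noteq> 0 \<Longrightarrow> L x \<le> n + r * x"
    using fourier_bounded_block[OF nz, of s] unfolding fourier_bounded_def L_def by blast
  have "of_int s / 24 + of_nat (length bs) / 8 = (of_nat k :: rat)"
    by (simp add: s field_simps)
  moreover have "(\<Sum>b\<leftarrow>bs. of_int b / 2) - 0 \<in> (\<int> :: rat set)"
  proof -
    have sm: "(\<Sum>b\<leftarrow>bs. of_int b / 2) = (of_int (sum_list bs) / 2 :: rat)"
      by (induction bs) (simp_all add: add_divide_distrib)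
    have "even (sum_list bs) \<longleftrightarrow> even (square_sum bs)"
      by (induction bs) auto
    then have "even (sum_list bs)" by (simp add: sq)
    then obtain t where "sum_list bs = 2 * t" by (elim evenE)
    then show ?thesis by (simp add: sm)
  qed
  ultimately have "has_fourier_expansion 0 0 c (block s bs)"
    by (intro has_fourier_expansion_shift[OF c(1)]) auto
  moreover have "c n r = 0" if "n < L 0" for n r
    using c(2)[of n r 0] that by (cases "c n r = 0") auto
  ultimately show ?thesis by blast
qed

lemma weakly_holomorphic_jacobi_form_block:
  assumes nz: "0 \<notin> set bs" and sq: "square_sum bs = 2 * int M" and w: "w = 12 * int k - int (length bs)"
    and s: "s = 24 * int k - 3 * int (length bs)"
    and \<psi>: "\<And>\<tau> z. Im \<tau> > 0 \<Longrightarrow> \<psi> \<tau> z = block s bs \<tau> z"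
  shows "weakly_holomorphic_jacobi_form w M \<psi>"
proof -
  \<comment> \<open>\<open>\<psi>\<close> agrees with the block only on the upper half-plane, so the
    transformation law carries over once the Moebius image is known to stay there.\<close>
  have M: "Im ((of_int a * \<tau> + of_int b) / (of_int c * \<tau> + of_int d)) > 0"
    if "a * d - b * c = (1 :: int)" "Im \<tau> > 0" for a b c d \<tau>
  proof -
    define j where "j = of_int c * \<tau> + of_int d"
    have "j \<noteq> 0"
    proof
      assume "j = 0"
      then have "Im j = 0" "Re j = 0" by simp_all
      then have "c = 0" "d = 0" using that(2) by (auto simp: j_def)
      then show False using that(1) by simp
    qed
    have "Im ((of_int a * \<tau> + of_int b) / j) = Im ((of_int a * \<tau> + of_int b) * cnj j) / norm j ^ 2"
      by (subst complex_div_cnj) (simp add: Im_divide_of_real flip: of_real_power)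
    also have "Im ((of_int a * \<tau> + of_int b) * cnj j) = of_int (a * d - b * c) * Im \<tau>"
      by (simp add: j_def algebra_simps)
    also have "a * d - b * c = 1" by (rule that(1))
    finally show ?thesis using that(2) \<open>j \<noteq> 0\<close> unfolding j_def[symmetric] by simp
  qed
  show ?thesis
    unfolding weakly_holomorphic_jacobi_form_def
  proof (intro conjI allI impI)
    show "holomorphic_HC \<psi>" by (rule holomorphic_HC_cong[OF holomorphic_HC_block \<psi>])
    obtain c N where "has_fourier_expansion 0 0 c (block s bs)" "\<forall>n r. n < N \<longrightarrow> c n r = 0"
      using block_fourier_integral[OF nz s sq] by blast
    then show "\<exists>c N. has_fourier_expansion 0 0 c \<psi> \<and> (\<forall>n r. n < N \<longrightarrow> c n r = 0)"
      using \<psi> unfolding has_fourier_expansion_def by (intro exI[of _ c] exI[of _ N]) auto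
  next
    fix a b c d :: int and \<tau> z assume "a * d - b * c = 1" "Im \<tau> > 0"
    then show "\<psi> ((of_int a * \<tau> + of_int b) / (of_int c * \<tau> + of_int d)) (z / (of_int c * \<tau> + of_int d)) =
        (of_int c * \<tau> + of_int d) powi w * ee (of_nat M * of_int c * z ^ 2 / (of_int c * \<tau> + of_int d)) * \<psi> \<tau> z"
      using block_modular[OF sq w s] M \<psi> by simp
  next
    fix l p :: int and \<tau> z assume "Im \<tau> > 0"
    then show "\<psi> \<tau> (z + of_int l * \<tau> + of_int p) =
        ee (- of_nat M * (of_int (l ^ 2) * \<tau> + 2 * of_int l * z)) * \<psi> \<tau> z"
      using block_elliptic[OF sq s] \<psi> by simp
  qed
qed

lemma Theta_eq_block: "Theta n a = block (- int (n * (n - 1) div 2)) (diff_list n a)"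
  by (simp add: Theta_def block_def prod_diff_list fun_eq_iff)

lemma Qform_eq_square_sum: "Qform n a = of_int (square_sum (diff_list n a)) / 2"
  by (simp add: Qform_def square_sum_def sum_diff_list)

text \<open>Half of \<open>half_dist_sum_bound\<close> gives n(n-1)/48, exactly what the factor
  eta^(-n(n-1)/2) takes away; the quadratic terms add up to \<open>Qform\<close>.\<close>

lemma sum_theta_bound_diff_list:
  "of_nat n * (of_nat n - 1) / 48 - Qform n a * x ^ 2 \<le> (\<Sum>b\<leftarrow>diff_list n a. theta_bound b x)"
proof -
  have "theta_bound (a i - a j) x = half_dist (of_int (a i) * x - of_int (a j) * x) / 2 - of_int ((a i - a j) ^ 2) * (x ^ 2 / 2)" for i j
    by (simp add: theta_bound_def left_diff_distrib)
  then have "(\<Sum>b\<leftarrow>diff_list n a. theta_bound b x) =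
      (\<Sum>j\<le>n. \<Sum>i<j. half_dist (of_int (a i) * x - of_int (a j) * x)) / 2 - Qform n a * x ^ 2"
    unfolding sum_diff_list
    by (simp only: sum_subtractf sum_divide_distrib[symmetric] sum_distrib_right[symmetric]) (simp add: Qform_def)
  then show ?thesis
    using half_dist_sum_bound[of n "\<lambda>i. of_int (a i) * x"] by simp
qed

lemma Qform_pos:
  assumes "n \<ge> 2" "inj_on a {..n}"
  shows "Qform n a > 0"
proof -
  have "a 0 - a 1 \<noteq> 0" using inj_onD[OF assms(2), of 0 1] assms(1) by auto
  then have "0 < (\<Sum>i<Suc 0. (a i - a 1) ^ 2)" by simp
  also have "\<dots> \<le> (\<Sum>j\<le>n. \<Sum>i<j. (a i - a j) ^ 2)"
  proof -
    have "(\<lambda>j. \<Sum>i<j. (a i - a j) ^ 2) 1 \<le> (\<Sum>j\<le>n. \<Sum>i<j. (a i - a j) ^ 2)"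
      by (rule member_le_sum) (use assms(1) in \<open>auto intro!: sum_nonneg\<close>)
    then show ?thesis by simp
  qed
  finally have "0 < square_sum (diff_list n a)"
    unfolding square_sum_def sum_diff_list .
  then show ?thesis by (simp add: Qform_eq_square_sum)
qed

text \<open>With the eta exponent cancelled, a nonzero coefficient satisfies n' + r x + Q x^2 >= 0
  for every rational x, where Q = \<open>Qform n a\<close> is positive; the minimum over x is the
  claim. The parameter \<open>h\<close> matters only mod 24, which covers both characters.\<close>

lemma Theta_fourier_holomorphic:
  assumes "n \<ge> 2" "inj_on a {..n}" and h: "of_nat (n * (n + 2)) / 24 - h / 24 \<in> \<int>"
  shows "\<exists>c. has_fourier_expansion (h / 24) (Qform n a) c (Theta n a) \<and>
    (\<forall>n' r. c n' r \<noteq> 0 \<longrightarrow> 4 * n' * Qform n a - r ^ 2 \<ge> 0)"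
proof -
  let ?bs = "diff_list n a"
  define s where "s = - int (n * (n - 1) div 2)"
  have "even (n * (n - 1))" by (cases n) auto
  then have "2 * (n * (n - 1) div 2) = n * (n - 1)" by simp
  then have "2 * s = - int (n * (n - 1))" unfolding s_def by linarith
  moreover have "of_nat (n * (n - 1)) = (of_nat n * (of_nat n - 1) :: rat)" using assms(1) by simp
  ultimately have s: "(of_int s :: rat) = - (of_nat n * (of_nat n - 1) / 2)"
  proof -
    have "(2 :: rat) * of_int s = of_int (2 * s)" by simp
    also have "\<dots> = - of_nat (n * (n - 1))" unfolding \<open>2 * s = _\<close> by simp
    also have "\<dots> = - (of_nat n * (of_nat n - 1))" unfolding \<open>of_nat (n * (n - 1)) = _\<close> ..
    finally show ?thesis by simp
  qed
  have len: "(of_nat (length ?bs) :: rat) = of_nat n * (of_nat n + 1) / 2"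
  proof -
    have "(of_nat (2 * length ?bs) :: rat) = of_nat (n * (n + 1))" by (simp only: length_diff_list)
    then show ?thesis by (simp add: field_simps)
  qed
  have \<alpha>: "of_int s / 24 + of_nat (length ?bs) / 8 = (of_nat (n * (n + 2)) / 24 :: rat)"
    unfolding s len by (simp add: field_simps)
  obtain c where c: "has_fourier_expansion (of_int s / 24 + of_nat (length ?bs) / 8) (\<Sum>b\<leftarrow>?bs. of_int b / 2) c (block s ?bs)"
      "\<And>n r x. c n r \<noteq> 0 \<Longrightarrow> of_int s / 24 + (\<Sum>b\<leftarrow>?bs. theta_bound b x) \<le> n + r * x"
    using fourier_bounded_block[OF zero_notin_diff_list[OF assms(2)], of s] unfolding fourier_bounded_def by blast
  \<comment> \<open>\<open>b\<close> and \<open>b ^ 2\<close> have the same parity, so the half sums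
    differ by an integer.\<close>
  have \<beta>: "(\<Sum>b\<leftarrow>?bs. of_int b / 2) - Qform n a \<in> \<int>"
  proof -
    have "(\<Sum>b\<leftarrow>bs. of_int b / 2) - of_int (square_sum bs) / 2 \<in> (\<int> :: rat set)" for bs
    proof (induction bs)
      case (Cons b bs)
      have "even (b - b ^ 2)" by simp
      then obtain t where "b - b ^ 2 = 2 * t" by (elim evenE)
      then have "of_int b / 2 - of_int (b ^ 2) / 2 = (of_int t :: rat)"
        unfolding diff_divide_distrib[symmetric] of_int_diff[symmetric] by simp
      then have "(\<Sum>b\<leftarrow>b # bs. of_int b / 2) - of_int (square_sum (b # bs)) / 2 =
          of_int t + ((\<Sum>b\<leftarrow>bs. of_int b / 2) - of_int (square_sum bs) / (2 :: rat))"
        by (simp add: add_divide_distrib)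
      then show ?case using Cons by (metis Ints_add Ints_of_int)
    qed simp
    then show ?thesis by (simp add: Qform_eq_square_sum)
  qed
  have "has_fourier_expansion (h / 24) (Qform n a) c (Theta n a)"
    unfolding Theta_eq_block s_def[symmetric]
    by (rule has_fourier_expansion_shift[OF c(1)[unfolded \<alpha>] h \<beta>])
  moreover have "4 * n' * Qform n a - r ^ 2 \<ge> 0" if "c n' r \<noteq> 0" for n' r
  proof -
    have Q: "Qform n a > 0" by (rule Qform_pos[OF assms(1,2)])
    define x where "x = - r / (2 * Qform n a)"
    have "- (Qform n a * x ^ 2) \<le> n' + r * x"
      using c(2)[OF that, of x] sum_theta_bound_diff_list[of n a x] unfolding s by simp
    then have "0 \<le> (n' + r * x + Qform n a * x ^ 2) * (4 * Qform n a)"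
      using Q by (intro mult_nonneg_nonneg) auto
    also have "\<dots> = 4 * n' * Qform n a - r ^ 2"
      using Q by (simp add: x_def power2_eq_square field_simps)
    finally show ?thesis .
  qed
  ultimately show ?thesis by blast
qed

text \<open>One statement for both characters: \<open>h = n (n + 2)\<close> with
  \<open>k = 0\<close>, and \<open>h = 0\<close> with \<open>24 k = n (n + 2)\<close>. Here
  \<open>k\<close> counts the factors eta^24 left after the character has been removed.\<close>

lemma Theta_in_jacobi_forms:
  assumes "n \<ge> 2" "inj_on a {..n}" and h: "int (n * (n + 2)) - int h = 24 * int k"
  shows "Theta n a \<in> jacobi_forms (of_nat n / 2) (Qform n a) (of_nat h)"
proof -
  let ?bs = "diff_list n a"
  define s where "s = - int (n * (n - 1) div 2)"
  define l where "l = int (length ?bs)"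
  have "even (n * (n - 1))" by (cases n) auto
  then have "2 * (n * (n - 1) div 2) = n * (n - 1)" by simp
  then have "2 * s = - int (n * (n - 1))" unfolding s_def by linarith
  then have s: "2 * s = - (int n * int n) + int n" using assms(1) by (simp add: algebra_simps)
  have l: "2 * l = int n * int n + int n"
    using arg_cong[OF length_diff_list[of n a], of int] by (simp add: l_def algebra_simps)
  have h': "int n * int n + 2 * int n - int h = 24 * int k" using h by (simp add: algebra_simps)
  \<comment> \<open>Three eta factors per theta, less the n(n-1)/2 in the denominator, make n(n+2);
    so the exponent has the form that the block lemmas ask for.\<close>
  have s': "s - int h = 24 * int k - 3 * l" using s l h' by linarith
  have T: "Theta n a \<tau> z = block s ?bs \<tau> z" for \<tau> z by (simp add: Theta_eq_block s_def)
  have nz: "0 \<notin> set ?bs" by (rule zero_notin_diff_list[OF assms(2)])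
  define w where "w = 12 * int k - l"
  have "2 * w = 24 * int k - 2 * l" by (simp add: w_def)
  also have "\<dots> = int n - int h" using l h' by linarith
  finally have w: "2 * w = int n - int h" .
  have w_rat: "of_nat n / 2 - of_nat h / 2 = (of_int w :: rat)"
  proof -
    have "(2 :: rat) * of_int w = of_int (2 * w)" by simp
    also have "\<dots> = of_nat n - of_nat h" unfolding w by simp
    finally show ?thesis by simp
  qed
  have eta_h: "eta_rpow (- of_nat h) \<tau> = eta \<tau> powi (- int h)"
      "eta_rpow (- of_nat h - 3) \<tau> = eta \<tau> powi (- int h - 3)" if "Im \<tau> > 0" for \<tau>
    using eta_rpow_of_int[OF that, of "- int h"] eta_rpow_of_int[OF that, of "- int h - 3"] by simp_all
  have "square_sum ?bs \<ge> 0" unfolding square_sum_def by (intro sum_list_nonneg) auto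
  \<comment> \<open>The parity of the square sum, twice the index, decides between the two clauses
    of \<open>jacobi_forms\<close>.\<close>
  then consider M where "square_sum ?bs = 2 * int M" | M where "square_sum ?bs + 1 = 2 * int (M + 1)"
  proof (cases "even (square_sum ?bs)")
    case True
    then obtain t where "square_sum ?bs = 2 * t" by (elim evenE)
    then show ?thesis using that(1)[of "nat t"] \<open>square_sum ?bs \<ge> 0\<close> by simp
  next
    case False
    then obtain t where "square_sum ?bs = 2 * t + 1" by (elim oddE)
    then show ?thesis using that(2)[of "nat t"] \<open>square_sum ?bs \<ge> 0\<close> by simp
  qed
  then have "(\<exists>(M::nat) w. Qform n a = of_nat M \<and> (of_nat n / 2 - of_nat h / 2 :: rat) = of_int w \<and>
        weakly_holomorphic_jacobi_form w M (\<lambda>\<tau> z. eta_rpow (- of_nat h) \<tau> * Theta n a \<tau> z)) \<or>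
     (\<exists>(M::nat) w. Qform n a = of_nat M + 1 / 2 \<and> (of_nat n / 2 - 1 - of_nat h / 2 :: rat) = of_int w \<and>
        weakly_holomorphic_jacobi_form w (M + 1)
          (\<lambda>\<tau> z. eta_rpow (- of_nat h - 3) \<tau> * theta \<tau> z * Theta n a \<tau> z))"
  proof cases
    case (1 M)
    have "weakly_holomorphic_jacobi_form w M (\<lambda>\<tau> z. eta_rpow (- of_nat h) \<tau> * Theta n a \<tau> z)"
    proof (rule weakly_holomorphic_jacobi_form_block[OF nz 1])
      show "w = 12 * int k - int (length ?bs)" by (simp add: w_def l_def)
      show "s - int h = 24 * int k - 3 * int (length ?bs)" using s' by (simp add: l_def)
      show "eta_rpow (- of_nat h) \<tau> * Theta n a \<tau> z = block (s - int h) ?bs \<tau> z" if "Im \<tau> > 0" for \<tau> z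
        using eta_nonzero[OF that] by (simp add: eta_h[OF that] T block_def power_int_diff power_int_minus field_simps)
    qed
    moreover have "Qform n a = of_nat M" by (simp add: Qform_eq_square_sum 1)
    ultimately show ?thesis using w_rat by blast
  next
    case (2 M)
    have "weakly_holomorphic_jacobi_form (w - 1) (M + 1)
        (\<lambda>\<tau> z. eta_rpow (- of_nat h - 3) \<tau> * theta \<tau> z * Theta n a \<tau> z)"
    \<comment> \<open>The extra \<open>theta\<close> is \<open>theta_mult 1\<close>, so it is
      absorbed as one more list entry: the square sum becomes even, the weight drops by 1, and the
      additional eta^(-3) keeps the exponent in the required form.\<close>
    proof (rule weakly_holomorphic_jacobi_form_block[where bs = "1 # ?bs"])
      show "0 \<notin> set (1 # ?bs)" using nz by simp
      show "square_sum (1 # ?bs) = 2 * int (M + 1)" using 2 by simp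
      show "w - 1 = 12 * int k - int (length (1 # ?bs))" by (simp add: w_def l_def)
      show "s - int h - 3 = 24 * int k - 3 * int (length (1 # ?bs))" using s' by (simp add: l_def)
      show "eta_rpow (- of_nat h - 3) \<tau> * theta \<tau> z * Theta n a \<tau> z = block (s - int h - 3) (1 # ?bs) \<tau> z"
        if "Im \<tau> > 0" for \<tau> z
      proof -
        have "eta \<tau> powi (s - int h - 3) = eta \<tau> powi (- int h - 3) * eta \<tau> powi s"
        proof -
          have "s - int h - 3 = (- int h - 3) + s" by simp
          then show ?thesis by (simp only: power_int_add[OF disjI1[OF eta_nonzero[OF that]]])
        qed
        then show ?thesis by (simp add: eta_h[OF that] T block_def theta_mult_def)
      qed
    qed
    moreover have "Qform n a = of_nat M + 1 / 2"
    proof -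
      have "square_sum ?bs = 2 * int M + 1" using 2 by simp
      then show ?thesis by (simp add: Qform_eq_square_sum add_divide_distrib)
    qed
    moreover have "of_nat n / 2 - 1 - of_nat h / 2 = (of_int (w - 1) :: rat)" using w_rat by simp
    ultimately show ?thesis by blast
  qed
  moreover have "holomorphic_HC (Theta n a)"
    unfolding Theta_eq_block by (rule holomorphic_HC_block)
  moreover have "of_nat (n * (n + 2)) / 24 - of_nat h / 24 \<in> (\<int> :: rat set)"
  proof -
    have "(of_nat (n * (n + 2)) - of_nat h :: rat) = of_int (int (n * (n + 2)) - int h)"
      by (simp only: of_int_diff of_int_of_nat_eq)
    also have "\<dots> = 24 * of_nat k" unfolding h by simp
    finally have "(of_nat (n * (n + 2)) - of_nat h :: rat) / 24 = of_nat k" by simp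
    then show ?thesis unfolding diff_divide_distrib[symmetric] by simp
  qed
  ultimately show ?thesis
    using Theta_fourier_holomorphic[OF assms(1,2)] unfolding jacobi_forms_def by blast
qed

text \<open>\<open>n * (n + 2) = (n + 1)^2 - 1\<close>, and the square of a number prime to 6 is 1
  mod 24.\<close>

lemma coprime_6_imp_24_dvd:
  fixes n :: nat
  assumes "coprime (n + 1) 6"
  shows "24 dvd n * (n + 2)"
proof -
  have c: "\<not> 2 dvd n + 1" "\<not> 3 dvd n + 1"
    using assms coprime_common_divisor_nat[of "n + 1" 6 2] coprime_common_divisor_nat[of "n + 1" 6 3] by auto
  from c(1) obtain t where t: "n = 2 * t" by (auto elim!: evenE)
  have "n * (n + 2) = 4 * (t * (t + 1))" unfolding t by simp
  moreover have "even (t * (t + 1))" by simp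
  then obtain u where "t * (t + 1) = 2 * u" by (elim evenE)
  ultimately have "n * (n + 2) = 8 * u" by simp
  then have 8: "8 dvd n * (n + 2)" by (simp only: dvd_triv_left)
  have "n mod 3 = 0 \<or> n mod 3 = 1" using c(2) by presburger
  then have 3: "3 dvd n * (n + 2)"
  proof
    assume "n mod 3 = 1"
    then have "3 dvd n + 2" by presburger
    then show ?thesis by (rule dvd_mult)
  qed auto
  have "24 dvd m" if "8 dvd m" "3 dvd m" for m :: nat
    using that by presburger
  from this[OF 8 3] show ?thesis .
qed

theorem theorem8p1:
  fixes n :: nat and a :: "nat \<Rightarrow> int"
  assumes "n \<ge> 2" and "inj_on a {..n}"
  shows "is_theta_block (n * (n + 1) div 2) (of_nat n / 2) (Theta n a) \<and>
         Theta n a \<in> jacobi_forms (of_nat n / 2) (Qform n a) (of_nat (n * (n + 2))) \<and>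
         (coprime (n + 1) 6 \<longrightarrow> Theta n a \<in> jacobi_forms (of_nat n / 2) (Qform n a) 0)"
proof (intro conjI impI)
  have len: "length (diff_list n a) = n * (n + 1) div 2"
    using length_diff_list[of n a] by simp
  \<comment> \<open>The theta factors outnumber the eta factors of the denominator by
    \<open>n\<close>, which gives weight n/2.\<close>
  have "n * (n - 1) + 2 * n = n * (n + 1)" using assms(1) by (cases n) auto
  moreover have "2 * (n * (n - 1) div 2) = n * (n - 1)" by (cases n) auto
  moreover have "2 * (n * (n + 1) div 2) = n * (n + 1)" by simp
  ultimately have "n * (n - 1) div 2 + n = n * (n + 1) div 2" by linarith
  then have "(of_nat n :: rat) = of_nat (n * (n + 1) div 2) - of_nat (n * (n - 1) div 2)"
    by (metis add_diff_cancel_left' of_nat_add)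
  then have "of_nat n / 2 = (of_nat (n * (n + 1) div 2) + of_int (- int (n * (n - 1) div 2))) / (2 :: rat)"
    by simp
  then show "is_theta_block (n * (n + 1) div 2) (of_nat n / 2) (Theta n a)"
    unfolding is_theta_block_def Theta_eq_block block_def
    using len zero_notin_diff_list[OF assms(2)] by blast
next
  show "Theta n a \<in> jacobi_forms (of_nat n / 2) (Qform n a) (of_nat (n * (n + 2)))"
    by (rule Theta_in_jacobi_forms[OF assms, where k = 0]) simp
next
  assume "coprime (n + 1) 6"
  from coprime_6_imp_24_dvd[OF this] obtain k where "n * (n + 2) = 24 * k" by (elim dvdE)
  then have "int (n * (n + 2)) - int 0 = 24 * int k" by (simp only: of_nat_mult of_nat_numeral of_nat_0 diff_zero)
  from Theta_in_jacobi_forms[OF assms this]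
  show "Theta n a \<in> jacobi_forms (of_nat n / 2) (Qform n a) 0" by simp
qed

end
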